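(* Let $\mathcal{X}$ be a determinantal point process on $\Lambda$ (with reference measure $\mu$) with kernel $$K(x,y)=\sum_{k=1}^{n}\lambda_k\,\phi_k(x)\overline{\phi_k(y)},$$ where $n\in\{1,2,\dots\}\cup\{\infty\}$, the $\phi_k$ are orthonormal in $L^2(\Lambda,\mu)$ (they are normalized eigenfunctions of the integral operator with kernel $K$), the eigenvalues satisfy $\lambda_k\in[0,1]$, and the operator is trace class, i.e. $\sum_k\lambda_k<\infty$. Let $I_k$, $1\le k\le n$, be independent random variables with $I_k\sim\mathrm{Bernoulli}(\lambda_k)$, and set $$K_I(x,y)=\sum_{k=1}^{n} I_k\,\phi_k(x)\overline{\phi_k(y)}.$$ Let $\mathcal{X}_I$ be the point process obtained by first sampling $(I_k)_k$ and then, given $(I_k)_k$, sampling a determinantal process with kernel $K_I$. Then $$\mathcal{X}\stackrel{d}{=}\mathcal{X}_I .$$ In particular, the total number of points $\mathcal{X}(\Lambda)$ has the distribution of a sum of independent $\mathrm{Bernoulli}(\lambda_k)$ random variables, $1\le k\le n$.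
   Context: $\Lambda$ is a locally compact Polish space with a Radon (reference) measure $\mu$. A point process on $\Lambda$ is a random integer-valued positive Radon measure $\mathcal{X}$ on $\Lambda$; it is simple if almost surely it assigns measure at most $1$ to singletons (it is then identified with a random discrete subset of $\Lambda$, and $\mathcal X(D)$ is the number of its points in $D$). The joint intensities of $\mathcal{X}$ with respect to $\mu$ are functions $\rho_k:\Lambda^k\to[0,\infty)$, $k\ge1$, such that for every family of mutually disjoint Borel subsets $D_1,\dots,D_k$ of $\Lambda$, $\mathbf{E}\big[\prod_{i=1}^k\mathcal{X}(D_i)\big]=\int_{D_1\times\cdots\times D_k}\rho_k(x_1,\dots,x_k)\,d\mu(x_1)\cdots d\mu(x_k)$. A point process is determinantal with kernel $K$ if it is simple and its joint intensities are $\rho_k(x_1,\dots,x_k)=\det(K(x_i,x_j))_{1\le i,j\le k}$ for every $k\ge1$. The kernel $K$ defines the operator $(\mathcal{K}f)(x)=\int_\Lambda K(x,y)f(y)\,d\mu(y)$ on $L^2(\Lambda,\mu)$. Kernels are interpreted pointwise, $\mu$-almost everywhere in each variable, through their eigenfunction expansion. *)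

theory Defs
  imports
    "HOL-Probability.Probability"
    "HOL-Library.Extended_Nat"
    "Jordan_Normal_Form.Determinant"
begin

text \<open>
  A Radon measure is a Borel measure that is finite on compact sets. On the locally compact
  Polish spaces considered here such a measure is automatically sigma-finite and regular.
\<close>

definition radon_measure :: "'a::topological_space measure \<Rightarrow> bool" where
  "radon_measure \<mu> \<longleftrightarrow> sets \<mu> = sets borel \<and> (\<forall>C. compact C \<longrightarrow> emeasure \<mu> C < \<infinity>)"

definition point_configs :: "'a::topological_space measure set" where
  "point_configs =
    {\<xi>. radon_measure \<xi> \<and> (\<forall>A\<in>sets borel. emeasure \<xi> A \<in> \<nat> \<union> {\<infinity>})}"

text \<open>
  The set of integer-valued Radon measures carries the sigma-algebra generated by the
  evaluations \<open>\<xi> \<mapsto> \<xi>(A)\<close>, \<open>A\<close> Borel; compare \<^const>\<open>subprob_algebra\<close>. Equality in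
  distribution of point processes is equality of their laws on \<open>config_space\<close>.
\<close>

definition config_space :: "'a::topological_space measure measure" where
  "config_space = (SUP A\<in>sets borel. vimage_algebra point_configs (\<lambda>\<xi>. emeasure \<xi> A) borel)"

lemma space_config_space [simp]: "space config_space = point_configs"
  by (auto simp: config_space_def space_Sup_eq_UN)

lemma measurable_emeasure_config_space:
  assumes "A \<in> sets borel"
  shows "(\<lambda>\<xi>. emeasure \<xi> A) \<in> borel_measurable config_space"
  unfolding config_space_def using assms
  by (intro measurable_SUP1[of A] measurable_vimage_algebra1) auto

lemma measurable_config_spaceI:
  assumes "X \<in> space M \<rightarrow> point_configs"
    and "\<And>A. A \<in> sets borel \<Longrightarrow> (\<lambda>\<omega>. emeasure (X \<omega>) A) \<in> borel_measurable M"
  shows "X \<in> measurable M config_space"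
  unfolding config_space_def
  by (intro measurable_SUP2 measurable_vimage_algebra2 assms) auto

definition point_process :: "'w measure \<Rightarrow> ('w \<Rightarrow> 'a::topological_space measure) \<Rightarrow> bool" where
  "point_process M X \<longleftrightarrow> prob_space M \<and> X \<in> measurable M config_space"

definition simple_process :: "'w measure \<Rightarrow> ('w \<Rightarrow> 'a::topological_space measure) \<Rightarrow> bool" where
  "simple_process M X \<longleftrightarrow> (AE \<omega> in M. \<forall>x. emeasure (X \<omega>) {x} \<le> 1)"

text \<open>
  A point \<open>(x\<^sub>1, \<dots>, x\<^sub>k)\<close> of \<open>\<Lambda>\<^sup>k\<close> is an element of the product space \<open>\<Pi>\<^sub>M i\<in>{..<k}. \<mu>\<close>,
  so indices start at 0.
\<close>

definition joint_intensities ::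
  "'w measure \<Rightarrow> ('w \<Rightarrow> 'a::topological_space measure) \<Rightarrow> 'a measure
    \<Rightarrow> (nat \<Rightarrow> (nat \<Rightarrow> 'a) \<Rightarrow> real) \<Rightarrow> bool" where
  "joint_intensities M X \<mu> \<rho> \<longleftrightarrow>
    (\<forall>k\<ge>1.
      \<rho> k \<in> borel_measurable (\<Pi>\<^sub>M i\<in>{..<k}. \<mu>) \<and>
      (\<forall>x\<in>space (\<Pi>\<^sub>M i\<in>{..<k}. \<mu>). 0 \<le> \<rho> k x) \<and>
      (\<forall>D. (\<forall>i<k. D i \<in> sets borel) \<longrightarrow> disjoint_family_on D {..<k} \<longrightarrow>
        (\<integral>\<^sup>+ \<omega>. (\<Prod>i<k. emeasure (X \<omega>) (D i)) \<partial>M) =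
        set_nn_integral (\<Pi>\<^sub>M i\<in>{..<k}. \<mu>) (\<Pi>\<^sub>E i\<in>{..<k}. D i) (\<lambda>x. ennreal (\<rho> k x))))"

text \<open>
  Joint intensities and kernels are only determined almost everywhere, so the determinantal
  formula is required almost everywhere with respect to \<open>\<mu>\<^sup>k\<close>. In particular the determinant
  need not be a nonnegative real on an exceptional null set.
\<close>

definition determinantal_process ::
  "'w measure \<Rightarrow> ('w \<Rightarrow> 'a::topological_space measure) \<Rightarrow> 'a measure
    \<Rightarrow> ('a \<Rightarrow> 'a \<Rightarrow> complex) \<Rightarrow> bool" where
  "determinantal_process M X \<mu> K \<longleftrightarrow>
    point_process M X \<and> simple_process M X \<and>
    (\<exists>\<rho>. joint_intensities M X \<mu> \<rho> \<and>
      (\<forall>k\<ge>1. AE x in (\<Pi>\<^sub>M i\<in>{..<k}. \<mu>).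
        complex_of_real (\<rho> k x) = Determinant.det (mat k k (\<lambda>(i, j). K (x i) (x j)))))"

definition orthonormal_L2 :: "'a measure \<Rightarrow> nat set \<Rightarrow> (nat \<Rightarrow> 'a \<Rightarrow> complex) \<Rightarrow> bool" where
  "orthonormal_L2 \<mu> J \<phi> \<longleftrightarrow>
    (\<forall>k\<in>J. \<phi> k \<in> borel_measurable \<mu> \<and> integrable \<mu> (\<lambda>x. (cmod (\<phi> k x))\<^sup>2)) \<and>
    (\<forall>j\<in>J. \<forall>k\<in>J. (\<integral>x. \<phi> j x * cnj (\<phi> k x) \<partial>\<mu>) = (if j = k then 1 else 0))"

text \<open>
  For summable nonnegative \<open>c\<close> and orthonormal \<open>\<phi>\<close>, the expansion converges absolutely
  whenever \<open>x\<close> and \<open>y\<close> lie outside a fixed \<open>\<mu>\<close>-null set; where it does not converge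
  unconditionally, \<^const>\<open>infsum\<close> returns 0.
\<close>

definition spectral_kernel ::
  "nat set \<Rightarrow> (nat \<Rightarrow> real) \<Rightarrow> (nat \<Rightarrow> 'a \<Rightarrow> complex) \<Rightarrow> 'a \<Rightarrow> 'a \<Rightarrow> complex" where
  "spectral_kernel J c \<phi> x y = (\<Sum>\<^sub>\<infinity>k\<in>J. complex_of_real (c k) * \<phi> k x * cnj (\<phi> k y))"

definition index_range :: "enat \<Rightarrow> nat set" where
  "index_range n = {k. 1 \<le> k \<and> enat k \<le> n}"

text \<open>
  The law of the sequence \<open>(I\<^sub>k)\<^sub>k\<^sub>\<in>\<^sub>J\<close> on the product space of 0/1-sequences.
\<close>

definition selection_law ::
  "'v measure \<Rightarrow> nat set \<Rightarrow> (nat \<Rightarrow> 'v \<Rightarrow> bool) \<Rightarrow> (nat \<Rightarrow> bool) measure" where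
  "selection_law N J I =
    distr N (\<Pi>\<^sub>M k\<in>J. count_space UNIV) (\<lambda>\<omega>. \<lambda>k\<in>J. I k \<omega>)"

text \<open>
  \<open>Q\<close> is a conditional law of \<open>\<X>\<^sub>I\<close> given \<open>(I\<^sub>k)\<^sub>k\<close>: a probability kernel such that, for almost
  every outcome \<open>\<iota>\<close> of \<open>(I\<^sub>k)\<^sub>k\<close>, a configuration drawn from \<open>Q \<iota>\<close> is determinantal with kernel
  \<open>K\<^sub>\<iota>\<close>. Sampling first \<open>\<iota>\<close> from \<open>P\<close> and then a configuration from \<open>Q \<iota>\<close> gives a
  configuration with law \<open>P \<bind> Q\<close>.
\<close>

definition determinantal_sampler ::
  "'a::topological_space measure \<Rightarrow> nat set \<Rightarrow> (nat \<Rightarrow> 'a \<Rightarrow> complex)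
    \<Rightarrow> (nat \<Rightarrow> bool) measure \<Rightarrow> ((nat \<Rightarrow> bool) \<Rightarrow> 'a measure measure) \<Rightarrow> bool" where
  "determinantal_sampler \<mu> J \<phi> P Q \<longleftrightarrow>
    Q \<in> measurable (\<Pi>\<^sub>M k\<in>J. count_space UNIV) (prob_algebra config_space) \<and>
    (AE \<iota> in P. determinantal_process (Q \<iota>) (\<lambda>\<xi>. \<xi>) \<mu> (spectral_kernel J (\<lambda>k. of_bool (\<iota> k)) \<phi>))"

end

theory Submission
  imports Defs
begin

text \<open>
  The intensities of a determinantal process depend on its eigenvalues through a sum with
  nonnegative terms. Expanding each kernel entry in the determinant and collecting terms
  (\<open>Cauchy_Binet_kernel\<close>) gives
  \<open>det (K(x\<^sub>i, x\<^sub>j)) = (1/k!) \<Sum>\<^sub>g (\<Prod>\<^sub>i \<lambda>\<^sub>g\<^sub>(\<^sub>i\<^sub>)) |S\<^sub>g(x)|\<^sup>2\<close>, where \<open>g\<close> runs over the maps from the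
  \<open>k\<close> positions to the index set and \<open>S\<^sub>g(x) = det (\<phi>\<^sub>g\<^sub>(\<^sub>i\<^sub>)(x\<^sub>j))\<close> is a Slater determinant. It vanishes
  unless \<open>g\<close> is injective, and for injective \<open>g\<close> independence turns the coefficient
  \<open>\<Prod>\<^sub>i \<lambda>\<^sub>g\<^sub>(\<^sub>i\<^sub>)\<close> into the expectation of \<open>\<Prod>\<^sub>i I\<^sub>g\<^sub>(\<^sub>i\<^sub>)\<close>. Hence the intensities for \<open>K\<close> are the averages of
  those for \<open>K\<^sub>I\<close> (\<open>nn_integral_intensity_selected\<close>), and by Tonelli the process and the mixture
  have the same expectations \<open>E \<Prod>\<^sub>i X(D\<^sub>i)\<close> for disjoint \<open>D\<^sub>i\<close>.

  Passing from these expectations to laws is a moment problem (\<open>law_eq_of_same_moments\<close>). For a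
  finite partition of a set \<open>A\<close> into cells \<open>C\<close>, the expectation of \<open>\<Prod>\<^sub>C (1 - X(C))\<close> is a finite
  alternating sum of such moments. When the partitions get finer, a simple finite configuration
  has at most one point per cell, so the product becomes the indicator of \<open>X(A) = 0\<close>; it is
  dominated by \<open>2^X(\<Lambda>)\<close>. If that variable is integrable, the moments therefore determine all void
  probabilities, and these determine the law of a simple process. The mixture has \<open>\<Sum>\<^sub>k I\<^sub>k\<close>
  points, so integrability follows from \<open>E 2^X(\<Lambda>) = \<Prod>\<^sub>k (1 + \<lambda>\<^sub>k) \<le> exp (\<Sum>\<^sub>k \<lambda>\<^sub>k)\<close>; integrability for
  the other process then comes from Fatou's lemma.

  Since \<open>\<Sum>\<^sub>k \<lambda>\<^sub>k\<close> is finite, almost surely only finitely many \<open>I\<^sub>k\<close> are 1, so conditionally on the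
  selection the kernel is a projection of finite rank \<open>m\<close>. The corresponding process consists of
  \<open>m\<close> random points with joint density \<open>|S(x)|\<^sup>2 / m!\<close> (\<open>determinantal_projection_law\<close>). This yields
  existence of the conditional laws, the same uniqueness result shows that they are essentially
  unique, and having exactly \<open>m\<close> points gives the distribution of \<open>X(\<Lambda>)\<close>.
\<close>

section \<open>Slater determinants and signed sums over permutations\<close>

text \<open>
  The determinant of the matrix with entries \<open>\<phi>\<^sub>g\<^sub>(\<^sub>i\<^sub>)(x\<^sub>j)\<close>, written as a Leibniz sum so that the positions
  can be an arbitrary finite set: both \<open>{..<k}\<close> and a set of selected indices occur below.
\<close>

definition slater :: "(nat \<Rightarrow> 'a \<Rightarrow> complex) \<Rightarrow> 'i set \<Rightarrow> ('i \<Rightarrow> nat) \<Rightarrow> ('i \<Rightarrow> 'a) \<Rightarrow> complex" where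
  "slater \<phi> A g x = (\<Sum>\<sigma> | \<sigma> permutes A. of_int (sign \<sigma>) * (\<Prod>i\<in>A. \<phi> (g (\<sigma> i)) (x i)))"

text \<open>
  Composition with a transposition flips the sign, so invariant summands cancel in pairs.
\<close>

lemma signed_sum_eq_0:
  fixes F :: "('i \<Rightarrow> 'i) \<Rightarrow> complex"
  assumes "finite A" "i \<in> A" "j \<in> A" "i \<noteq> j"
    and F: "\<And>\<sigma>. \<sigma> permutes A \<Longrightarrow> F (Transposition.transpose i j \<circ> \<sigma>) = F \<sigma>"
  shows "(\<Sum>\<sigma> | \<sigma> permutes A. of_int (sign \<sigma>) * F \<sigma>) = 0"
proof -
  have t: "Transposition.transpose i j permutes A"
    using assms by (intro permutes_swap_id)
  have "(\<Sum>\<sigma> | \<sigma> permutes A. of_int (sign \<sigma>) * F \<sigma>)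
      = (\<Sum>\<sigma> | \<sigma> permutes A. of_int (sign (Transposition.transpose i j \<circ> \<sigma>)) * F (Transposition.transpose i j \<circ> \<sigma>))"
    by (rule setum_permutations_compose_left[OF t])
  also have "\<dots> = (\<Sum>\<sigma> | \<sigma> permutes A. - (of_int (sign \<sigma>) * F \<sigma>))"
  proof (rule sum.cong)
    fix \<sigma> assume "\<sigma> \<in> {\<sigma>. \<sigma> permutes A}"
    then have s: "\<sigma> permutes A" by simp
    have "permutation \<sigma>" using s assms(1) permutation_permutes by blast
    then have "sign (Transposition.transpose i j \<circ> \<sigma>) = - sign \<sigma>"
      using assms(4) by (simp add: sign_compose permutation_swap_id sign_swap_id)
    then show "of_int (sign (Transposition.transpose i j \<circ> \<sigma>)) * F (Transposition.transpose i j \<circ> \<sigma>) = - (of_int (sign \<sigma>) * F \<sigma>)"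
      by (simp add: F[OF s])
  qed simp
  finally show ?thesis by (simp add: sum_negf)
qed

lemma slater_repeated_index:
  assumes "finite A" "\<not> inj_on g A"
  shows "slater \<phi> A g x = 0"
proof -
  obtain i j where ij: "i \<in> A" "j \<in> A" "i \<noteq> j" "g i = g j"
    using assms(2) by (auto simp: inj_on_def)
  have "g (Transposition.transpose i j k) = g k" for k
    using ij(4) by (auto simp: Transposition.transpose_def)
  then show ?thesis
    unfolding slater_def by (intro signed_sum_eq_0[OF assms(1) ij(1,2,3)]) simp
qed

lemma slater_compose:
  assumes "finite A" "\<pi> permutes A"
  shows "slater \<phi> A (g \<circ> \<pi>) x = of_int (sign \<pi>) * slater \<phi> A g x"
proof -
  have p: "permutation \<pi>" using assms permutation_permutes by blast
  have "slater \<phi> A g x = (\<Sum>\<sigma> | \<sigma> permutes A. of_int (sign (\<pi> \<circ> \<sigma>)) * (\<Prod>i\<in>A. \<phi> (g ((\<pi> \<circ> \<sigma>) i)) (x i)))"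
    unfolding slater_def by (rule setum_permutations_compose_left[OF assms(2)])
  also have "\<dots> = of_int (sign \<pi>) * slater \<phi> A (g \<circ> \<pi>) x"
    unfolding slater_def sum_distrib_left
  proof (rule sum.cong)
    fix \<sigma> assume "\<sigma> \<in> {\<sigma>. \<sigma> permutes A}"
    then have "permutation \<sigma>" using assms(1) permutation_permutes by blast
    then show "of_int (sign (\<pi> \<circ> \<sigma>)) * (\<Prod>i\<in>A. \<phi> (g ((\<pi> \<circ> \<sigma>) i)) (x i)) =
        of_int (sign \<pi>) * (of_int (sign \<sigma>) * (\<Prod>i\<in>A. \<phi> ((g \<circ> \<pi>) (\<sigma> i)) (x i)))"
      by (simp add: sign_compose p)
  qed simp
  finally have "slater \<phi> A g x = of_int (sign \<pi>) * slater \<phi> A (g \<circ> \<pi>) x" .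
  then have "of_int (sign \<pi>) * slater \<phi> A g x = of_int (sign \<pi> * sign \<pi>) * slater \<phi> A (g \<circ> \<pi>) x"
    by (simp only: of_int_mult mult.assoc)
  then show ?thesis unfolding sign_idempotent by simp
qed

lemma slater_repeated_point:
  assumes "finite A" "\<not> inj_on x A"
  shows "slater \<phi> A g x = 0"
proof -
  obtain i j where ij: "i \<in> A" "j \<in> A" "i \<noteq> j" "x i = x j"
    using assms(2) by (auto simp: inj_on_def)
  have t: "Transposition.transpose i j permutes A"
    using ij by (intro permutes_swap_id)
  have x: "x (Transposition.transpose i j k) = x k" for k
    using ij(4) by (auto simp: Transposition.transpose_def)
  have "slater \<phi> A g x = (\<Sum>\<sigma> | \<sigma> permutes A.
      of_int (sign (\<sigma> \<circ> Transposition.transpose i j)) * (\<Prod>k\<in>A. \<phi> (g ((\<sigma> \<circ> Transposition.transpose i j) k)) (x k)))"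
    unfolding slater_def by (rule sum_permutations_compose_right[OF t])
  also have "\<dots> = (\<Sum>\<sigma> | \<sigma> permutes A. - (of_int (sign \<sigma>) * (\<Prod>k\<in>A. \<phi> (g (\<sigma> k)) (x k))))"
  proof (rule sum.cong)
    fix \<sigma> assume "\<sigma> \<in> {\<sigma>. \<sigma> permutes A}"
    then have "permutation \<sigma>" using assms(1) permutation_permutes by blast
    then have "sign (\<sigma> \<circ> Transposition.transpose i j) = - sign \<sigma>"
      using ij by (simp add: sign_compose permutation_swap_id sign_swap_id)
    moreover have "(\<Prod>k\<in>A. \<phi> (g ((\<sigma> \<circ> Transposition.transpose i j) k)) (x k)) = (\<Prod>k\<in>A. \<phi> (g (\<sigma> k)) (x k))"
      using prod.permute[OF t, of "\<lambda>k. \<phi> (g (\<sigma> k)) (x k)"] by (simp add: o_def x)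
    ultimately show "of_int (sign (\<sigma> \<circ> Transposition.transpose i j)) * (\<Prod>k\<in>A. \<phi> (g ((\<sigma> \<circ> Transposition.transpose i j) k)) (x k)) =
      - (of_int (sign \<sigma>) * (\<Prod>k\<in>A. \<phi> (g (\<sigma> k)) (x k)))" by simp
  qed simp
  also have "\<dots> = - slater \<phi> A g x" by (simp add: sum_negf slater_def)
  finally show ?thesis by simp
qed

text \<open>
  This is the determinant of a block-triangular matrix with an identity block: only permutations
  fixing every point outside \<open>R\<close> contribute.
\<close>

lemma signed_sum_restrict:
  fixes b :: "'i \<Rightarrow> 'i \<Rightarrow> complex"
  assumes "finite S" "R \<subseteq> S"
    and b: "\<And>s t. s \<in> S - R \<Longrightarrow> t \<in> S \<Longrightarrow> b s t = of_bool (s = t)"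
  shows "(\<Sum>\<tau> | \<tau> permutes S. of_int (sign \<tau>) * (\<Prod>s\<in>S. b s (\<tau> s)))
    = (\<Sum>\<tau> | \<tau> permutes R. of_int (sign \<tau>) * (\<Prod>s\<in>R. b s (\<tau> s)))"
proof (rule sum.mono_neutral_cong_right)
  show "finite {\<tau>. \<tau> permutes S}" by (rule finite_permutations[OF assms(1)])
  show "{\<tau>. \<tau> permutes R} \<subseteq> {\<tau>. \<tau> permutes S}"
    using assms(2) permutes_subset by blast
  show "\<forall>\<tau>\<in>{\<tau>. \<tau> permutes S} - {\<tau>. \<tau> permutes R}. of_int (sign \<tau>) * (\<Prod>s\<in>S. b s (\<tau> s)) = 0"
  proof
    fix \<tau> assume "\<tau> \<in> {\<tau>. \<tau> permutes S} - {\<tau>. \<tau> permutes R}"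
    then have \<tau>: "\<tau> permutes S" "\<not> \<tau> permutes R" by auto
    then obtain s where s: "s \<in> S - R" "\<tau> s \<noteq> s"
      using permutes_superset by metis
    have "b s (\<tau> s) = 0"
      using b[OF s(1), of "\<tau> s"] s \<tau>(1) permutes_in_image by fastforce
    then have "(\<Prod>s\<in>S. b s (\<tau> s)) = 0"
      using s(1) assms(1) by (intro prod_zero) auto
    then show "of_int (sign \<tau>) * (\<Prod>s\<in>S. b s (\<tau> s)) = 0" by simp
  qed
  fix \<tau> assume "\<tau> \<in> {\<tau>. \<tau> permutes R}"
  then have \<tau>: "\<tau> permutes R" by simp
  have "b s (\<tau> s) = 1" if "s \<in> S - R" for s
    using b[OF that, of s] that \<tau> by (simp add: permutes_not_in)
  then have "(\<Prod>s\<in>S. b s (\<tau> s)) = (\<Prod>s\<in>R. b s (\<tau> s))"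
    using assms by (intro prod.mono_neutral_right) auto
  then show "of_int (sign \<tau>) * (\<Prod>s\<in>S. b s (\<tau> s)) = of_int (sign \<tau>) * (\<Prod>s\<in>R. b s (\<tau> s))" by simp
qed

lemma signed_sum_image:
  fixes b :: "'j \<Rightarrow> 'j \<Rightarrow> complex"
  assumes "finite A" "inj_on f A"
  shows "(\<Sum>\<tau> | \<tau> permutes f ` A. of_int (sign \<tau>) * (\<Prod>s\<in>f ` A. b s (\<tau> s)))
    = (\<Sum>\<pi> | \<pi> permutes A. of_int (sign \<pi>) * (\<Prod>i\<in>A. b (f i) (f (\<pi> i))))"
proof -
  let ?m = "map_permutation A f"
  have bij: "bij_betw f A (f ` A)" using assms(2) by (simp add: bij_betw_def)
  have "bij_betw ?m {\<pi>. \<pi> permutes A} {\<pi>. \<pi> permutes f ` A}"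
    using bij_betw_permutations[OF bij]
    by (rule bij_betw_cong[THEN iffD1, rotated]) (auto simp: map_permutation_def restrict_id_def fun_eq_iff)
  from sum.reindex_bij_betw[OF this, of "\<lambda>\<tau>. of_int (sign \<tau>) * (\<Prod>s\<in>f ` A. b s (\<tau> s))", symmetric]
  have "(\<Sum>\<tau> | \<tau> permutes f ` A. of_int (sign \<tau>) * (\<Prod>s\<in>f ` A. b s (\<tau> s)))
    = (\<Sum>\<pi> | \<pi> permutes A. of_int (sign (?m \<pi>)) * (\<Prod>s\<in>f ` A. b s (?m \<pi> s)))" .
  also have "\<dots> = (\<Sum>\<pi> | \<pi> permutes A. of_int (sign \<pi>) * (\<Prod>i\<in>A. b (f i) (f (\<pi> i))))"
    using assms by (intro sum.cong) (auto simp: sign_map_permutation prod.reindex map_permutation_apply)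
  finally show ?thesis .
qed

text \<open>
  When \<open>a i\<close> is the Gram matrix of the functions \<open>\<phi>\<^sub>s\<close> on a set \<open>D\<^sub>i\<close>, this is the contribution of the
  index map \<open>g\<close> to the integral of \<open>det (K(x\<^sub>i, x\<^sub>j))\<close> over the product of the sets \<open>D\<^sub>i\<close>.
\<close>

definition signed_product_sum :: "('i \<Rightarrow> nat \<Rightarrow> nat \<Rightarrow> complex) \<Rightarrow> 'i set \<Rightarrow> ('i \<Rightarrow> nat) \<Rightarrow> complex" where
  "signed_product_sum a A g = (\<Sum>\<pi> | \<pi> permutes A. of_int (sign \<pi>) * (\<Prod>i\<in>A. a i (g i) (g (\<pi> i))))"

lemma signed_product_sum_cong:
  assumes "\<And>i. i \<in> A \<Longrightarrow> g i = h i"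
  shows "signed_product_sum a A g = signed_product_sum a A h"
  unfolding signed_product_sum_def
  by (intro sum.cong prod.cong arg_cong2[where f="(*)"] refl)
     (use assms in \<open>auto simp: permutes_in_image\<close>)

lemma signed_product_sum_repeated_index:
  assumes "finite A" "\<not> inj_on g A"
  shows "signed_product_sum a A g = 0"
proof -
  obtain i j where ij: "i \<in> A" "j \<in> A" "i \<noteq> j" "g i = g j"
    using assms(2) by (auto simp: inj_on_def)
  have "g (Transposition.transpose i j k) = g k" for k
    using ij(4) by (auto simp: Transposition.transpose_def)
  then show ?thesis
    unfolding signed_product_sum_def by (intro signed_sum_eq_0[OF assms(1) ij(1,2,3)]) simp
qed

text \<open>
  The left-hand side is what remains of \<open>|S(x)|\<^sup>2\<close> after integrating out all coordinates. Positions
  outside \<open>f ` A\<close> are integrated over the whole space, where orthonormality makes the Gram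
  matrix trivial; writing the second permutation as \<open>\<sigma> \<circ> \<tau>\<close>, it forces \<open>\<tau>\<close> to permute \<open>f ` A\<close> only,
  and such permutations correspond to permutations of \<open>A\<close>.
\<close>

lemma double_signed_sum:
  fixes S :: "nat set" and b a
  assumes "finite S" "finite A" "inj_on f A" "f ` A \<subseteq> S"
    and b_in: "\<And>i. i \<in> A \<Longrightarrow> b (f i) = a i"
    and b_out: "\<And>s t u. s \<in> S - f ` A \<Longrightarrow> t \<in> S \<Longrightarrow> u \<in> S \<Longrightarrow> b s t u = of_bool (t = u)"
  shows "(\<Sum>\<sigma> | \<sigma> permutes S. \<Sum>\<tau> | \<tau> permutes S.
      of_int (sign \<sigma> * sign \<tau>) * (\<Prod>s\<in>S. b s (\<sigma> s) (\<tau> s)))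
    = (\<Sum>\<sigma> | \<sigma> permutes S. signed_product_sum a A (\<sigma> \<circ> f))"
proof (rule sum.cong)
  fix \<sigma> assume "\<sigma> \<in> {\<sigma>. \<sigma> permutes S}"
  then have \<sigma>: "\<sigma> permutes S" by simp
  have p\<sigma>: "permutation \<sigma>" using \<sigma> assms(1) permutation_permutes by blast
  have "(\<Sum>\<tau> | \<tau> permutes S. of_int (sign \<sigma> * sign \<tau>) * (\<Prod>s\<in>S. b s (\<sigma> s) (\<tau> s)))
      = (\<Sum>\<tau> | \<tau> permutes S. of_int (sign \<sigma> * sign (\<sigma> \<circ> \<tau>)) * (\<Prod>s\<in>S. b s (\<sigma> s) ((\<sigma> \<circ> \<tau>) s)))"
    by (rule setum_permutations_compose_left[OF \<sigma>])
  also have "\<dots> = (\<Sum>\<tau> | \<tau> permutes S. of_int (sign \<tau>) * (\<Prod>s\<in>S. b s (\<sigma> s) (\<sigma> (\<tau> s))))"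
  proof (rule sum.cong)
    fix \<tau> assume "\<tau> \<in> {\<tau>. \<tau> permutes S}"
    then have "permutation \<tau>" using assms(1) permutation_permutes by blast
    then have "sign \<sigma> * sign (\<sigma> \<circ> \<tau>) = sign \<tau>"
      by (simp add: sign_compose p\<sigma> sign_idempotent flip: mult.assoc)
    then show "of_int (sign \<sigma> * sign (\<sigma> \<circ> \<tau>)) * (\<Prod>s\<in>S. b s (\<sigma> s) ((\<sigma> \<circ> \<tau>) s))
      = of_int (sign \<tau>) * (\<Prod>s\<in>S. b s (\<sigma> s) (\<sigma> (\<tau> s)))" by simp
  qed simp
  also have "\<dots> = (\<Sum>\<tau> | \<tau> permutes f ` A. of_int (sign \<tau>) * (\<Prod>s\<in>f ` A. b s (\<sigma> s) (\<sigma> (\<tau> s))))"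
    using \<sigma> assms(1,4) b_out
    by (intro signed_sum_restrict) (auto simp: permutes_in_image inj_eq[OF permutes_inj[OF \<sigma>]])
  also have "\<dots> = (\<Sum>\<pi> | \<pi> permutes A. of_int (sign \<pi>) * (\<Prod>i\<in>A. b (f i) (\<sigma> (f i)) (\<sigma> (f (\<pi> i)))))"
    by (rule signed_sum_image[OF assms(2,3)])
  also have "\<dots> = signed_product_sum a A (\<sigma> \<circ> f)"
    unfolding signed_product_sum_def by (intro sum.cong refl) (simp add: b_in)
  finally show "(\<Sum>\<tau> | \<tau> permutes S. of_int (sign \<sigma> * sign \<tau>) * (\<Prod>s\<in>S. b s (\<sigma> s) (\<tau> s)))
    = signed_product_sum a A (\<sigma> \<circ> f)" .
qed simp

text \<open>
  For a fixed permutation \<open>\<sigma>\<close> the map \<open>f \<mapsto> \<sigma> \<circ> f\<close> permutes the injections, so every \<open>\<sigma>\<close> contributes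
  the same amount. The factor \<open>fact (card S)\<close> cancels the normalization of the projection density.
\<close>

lemma sum_injections_permuted:
  fixes S :: "nat set"
  assumes "finite S" "finite A"
  shows "(\<Sum>f | f \<in> A \<rightarrow>\<^sub>E S \<and> inj_on f A. \<Sum>\<sigma> | \<sigma> permutes S. signed_product_sum a A (\<sigma> \<circ> f))
    = fact (card S) * (\<Sum>g\<in>A \<rightarrow>\<^sub>E S. signed_product_sum a A g)"
proof -
  let ?I = "{f. f \<in> A \<rightarrow>\<^sub>E S \<and> inj_on f A}"
  have *: "(\<Sum>f\<in>?I. signed_product_sum a A (\<sigma> \<circ> f)) = (\<Sum>g\<in>?I. signed_product_sum a A g)"
    if \<sigma>: "\<sigma> permutes S" for \<sigma>
  proof (rule sum.reindex_bij_witness[where i="\<lambda>g. restrict (inv_into UNIV \<sigma> \<circ> g) A" and j="\<lambda>f. restrict (\<sigma> \<circ> f) A"])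
    fix f assume f: "f \<in> ?I"
    have inv: "inv_into UNIV \<sigma> permutes S" using \<sigma> by (rule permutes_inv)
    show "restrict (inv_into UNIV \<sigma> \<circ> restrict (\<sigma> \<circ> f) A) A = f"
      using f \<sigma> by (auto simp: fun_eq_iff PiE_def extensional_def permutes_inverses)
    show "restrict (\<sigma> \<circ> restrict (inv_into UNIV \<sigma> \<circ> f) A) A = f"
      using f \<sigma> by (auto simp: fun_eq_iff PiE_def extensional_def permutes_inverses)
    show "restrict (\<sigma> \<circ> f) A \<in> ?I"
      using f by (auto simp: permutes_in_image[OF \<sigma>] inj_on_def inj_eq[OF permutes_inj[OF \<sigma>]])
    show "restrict (inv_into UNIV \<sigma> \<circ> f) A \<in> ?I"
      using f by (auto simp: permutes_in_image[OF inv] inj_on_def inj_eq[OF permutes_inj[OF inv]])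
    show "signed_product_sum a A (restrict (\<sigma> \<circ> f) A) = signed_product_sum a A (\<sigma> \<circ> f)"
      by (rule signed_product_sum_cong) simp
  qed
  have "(\<Sum>f\<in>?I. \<Sum>\<sigma> | \<sigma> permutes S. signed_product_sum a A (\<sigma> \<circ> f))
      = (\<Sum>\<sigma> | \<sigma> permutes S. \<Sum>f\<in>?I. signed_product_sum a A (\<sigma> \<circ> f))"
    by (rule sum.swap)
  also have "\<dots> = (\<Sum>\<sigma> | \<sigma> permutes S. \<Sum>g\<in>?I. signed_product_sum a A g)"
    by (intro sum.cong refl *) simp
  also have "\<dots> = fact (card S) * (\<Sum>g\<in>?I. signed_product_sum a A g)"
    using assms(1) by (simp add: card_permutations of_nat_fact)
  also have "(\<Sum>g\<in>?I. signed_product_sum a A g) = (\<Sum>g\<in>A \<rightarrow>\<^sub>E S. signed_product_sum a A g)"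
    using assms by (intro sum.mono_neutral_left finite_PiE) (auto simp: signed_product_sum_repeated_index)
  finally show ?thesis .
qed

lemma slater_cong:
  assumes "\<And>i. i \<in> A \<Longrightarrow> g i = h i"
  shows "slater \<phi> A g x = slater \<phi> A h x"
  unfolding slater_def
  by (intro sum.cong prod.cong arg_cong2[where f="(*)"] refl)
     (use assms in \<open>auto simp: permutes_in_image\<close>)

text \<open>
  A matrix and its transpose have the same determinant.
\<close>

lemma slater_inverse:
  "slater \<phi> A g x = (\<Sum>\<sigma> | \<sigma> permutes A. of_int (sign \<sigma>) * (\<Prod>i\<in>A. \<phi> (g i) (x (\<sigma> i))))"
    if "finite A"
proof -
  have "slater \<phi> A g x = (\<Sum>\<sigma> | \<sigma> permutes A.
      of_int (sign (inv_into UNIV \<sigma>)) * (\<Prod>i\<in>A. \<phi> (g (inv_into UNIV \<sigma> i)) (x i)))"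
    unfolding slater_def by (rule sum_permutations_inverse)
  also have "\<dots> = (\<Sum>\<sigma> | \<sigma> permutes A. of_int (sign \<sigma>) * (\<Prod>i\<in>A. \<phi> (g i) (x (\<sigma> i))))"
  proof (rule sum.cong)
    fix \<sigma> assume "\<sigma> \<in> {\<sigma>. \<sigma> permutes A}"
    then have \<sigma>: "\<sigma> permutes A" by simp
    have "permutation \<sigma>" using \<sigma> that permutation_permutes by blast
    then have "sign (inv_into UNIV \<sigma>) = sign \<sigma>" by (rule sign_inverse)
    moreover have "(\<Prod>i\<in>A. \<phi> (g (inv_into UNIV \<sigma> i)) (x i)) = (\<Prod>i\<in>A. \<phi> (g i) (x (\<sigma> i)))"
      using prod.permute[OF \<sigma>, of "\<lambda>i. \<phi> (g (inv_into UNIV \<sigma> i)) (x i)"]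
      by (simp add: o_def permutes_inverses[OF \<sigma>])
    ultimately show "of_int (sign (inv_into UNIV \<sigma>)) * (\<Prod>i\<in>A. \<phi> (g (inv_into UNIV \<sigma> i)) (x i)) =
      of_int (sign \<sigma>) * (\<Prod>i\<in>A. \<phi> (g i) (x (\<sigma> i)))" by simp
  qed simp
  finally show ?thesis .
qed

lemma sum_PiE_compose_permutation:
  assumes "\<pi> permutes A"
    and F: "\<And>g h. (\<And>i. i \<in> A \<Longrightarrow> g i = h i) \<Longrightarrow> F g = F h"
  shows "(\<Sum>g\<in>A \<rightarrow>\<^sub>E S. F (g \<circ> \<pi>)) = (\<Sum>g\<in>A \<rightarrow>\<^sub>E S. F g)"
proof (rule sum.reindex_bij_witness[where i="\<lambda>g. restrict (g \<circ> inv_into UNIV \<pi>) A" and j="\<lambda>g. restrict (g \<circ> \<pi>) A"])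
  have inv: "inv_into UNIV \<pi> permutes A" using assms(1) by (rule permutes_inv)
  fix g assume g: "g \<in> A \<rightarrow>\<^sub>E S"
  show "restrict (restrict (g \<circ> \<pi>) A \<circ> inv_into UNIV \<pi>) A = g"
    using g by (auto simp: fun_eq_iff PiE_def extensional_def permutes_in_image[OF inv]
        permutes_inverses[OF assms(1)])
  show "restrict (restrict (g \<circ> inv_into UNIV \<pi>) A \<circ> \<pi>) A = g"
    using g by (auto simp: fun_eq_iff PiE_def extensional_def permutes_in_image[OF assms(1)]
        permutes_inverses[OF assms(1)])
  show "restrict (g \<circ> \<pi>) A \<in> A \<rightarrow>\<^sub>E S"
    using g by (auto simp: permutes_in_image[OF assms(1)])
  show "restrict (g \<circ> inv_into UNIV \<pi>) A \<in> A \<rightarrow>\<^sub>E S"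
    using g by (auto simp: permutes_in_image[OF inv])
  show "F (restrict (g \<circ> \<pi>) A) = F (g \<circ> \<pi>)"
    by (rule F) simp
qed

lemma double_signed_sum_same_index:
  fixes a :: "nat \<Rightarrow> nat \<Rightarrow> nat \<Rightarrow> complex"
  assumes "finite A"
  shows "(\<Sum>\<sigma> | \<sigma> permutes A. \<Sum>\<tau> | \<tau> permutes A.
      of_int (sign \<sigma> * sign \<tau>) * (\<Prod>i\<in>A. a i (g (\<sigma> i)) (g (\<tau> i))))
    = (\<Sum>\<sigma> | \<sigma> permutes A. signed_product_sum a A (g \<circ> \<sigma>))"
proof -
  have "(\<Sum>\<sigma> | \<sigma> permutes A. \<Sum>\<tau> | \<tau> permutes A.
      of_int (sign \<sigma> * sign \<tau>) * (\<Prod>i\<in>A. a i (g (\<sigma> i)) (g (\<tau> i))))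
    = (\<Sum>\<sigma> | \<sigma> permutes A. signed_product_sum (\<lambda>i t u. a i (g t) (g u)) A (\<sigma> \<circ> id))"
    by (rule double_signed_sum[of A A id "\<lambda>i t u. a i (g t) (g u)" "\<lambda>i t u. a i (g t) (g u)"])
      (use assms in auto)
  then show ?thesis by (simp add: signed_product_sum_def)
qed

section \<open>The Cauchy--Binet expansion of a spectral kernel\<close>

text \<open>
  Multilinearity gives a sum over index maps \<open>g\<close> of \<open>\<Prod>\<^sub>i c\<^sub>g\<^sub>(\<^sub>i\<^sub>) \<phi>\<^sub>g\<^sub>(\<^sub>i\<^sub>)(x\<^sub>i)\<close> times a conjugate Slater
  determinant. Averaging over precompositions of \<open>g\<close> with permutations turns the first factor
  into the Slater determinant itself. The result displays the determinant as a nonnegative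
  combination of squared moduli, and the numbers \<open>c\<^sub>s\<close> enter through products only.
\<close>

lemma Cauchy_Binet_kernel:
  fixes c :: "nat \<Rightarrow> real" and \<phi> :: "nat \<Rightarrow> 'a \<Rightarrow> complex"
  assumes "finite S"
  shows "Determinant.det (mat k k (\<lambda>(i, j). \<Sum>s\<in>S. complex_of_real (c s) * \<phi> s (x i) * cnj (\<phi> s (x j))))
    = complex_of_real ((\<Sum>g\<in>{..<k} \<rightarrow>\<^sub>E S. (\<Prod>i<k. c (g i)) * (cmod (slater \<phi> {..<k} g x))\<^sup>2) / fact k)"
proof -
  let ?A = "{..<k}"
  let ?C = "\<lambda>g. \<Prod>i\<in>?A. complex_of_real (c (g i))"
  let ?D = "\<lambda>g. \<Prod>i\<in>?A. \<phi> (g i) (x i)"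
  define T where "T g = ?C g * ?D g * cnj (slater \<phi> ?A g x)" for g
  have "Determinant.det (mat k k (\<lambda>(i, j). \<Sum>s\<in>S. complex_of_real (c s) * \<phi> s (x i) * cnj (\<phi> s (x j))))
      = (\<Sum>p | p permutes ?A. of_int (sign p) *
          (\<Prod>i\<in>?A. \<Sum>s\<in>S. complex_of_real (c s) * \<phi> s (x i) * cnj (\<phi> s (x (p i)))))"
    unfolding det_def'[OF mat_carrier] lessThan_atLeast0
    by (intro sum.cong refl arg_cong2[where f="(*)"] prod.cong) (auto simp: permutes_in_image)
  also have "\<dots> = (\<Sum>p | p permutes ?A. of_int (sign p) *
          (\<Sum>g\<in>?A \<rightarrow>\<^sub>E S. ?C g * ?D g * (\<Prod>i\<in>?A. cnj (\<phi> (g i) (x (p i))))))"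
    using assms by (simp add: prod_sum_PiE prod.distrib)
  also have "\<dots> = (\<Sum>g\<in>?A \<rightarrow>\<^sub>E S. \<Sum>p | p permutes ?A. of_int (sign p) *
          (?C g * ?D g * (\<Prod>i\<in>?A. cnj (\<phi> (g i) (x (p i))))))"
    unfolding sum_distrib_left by (rule sum.swap)
  also have "\<dots> = (\<Sum>g\<in>?A \<rightarrow>\<^sub>E S. T g)"
    unfolding T_def slater_inverse[OF finite_lessThan] cnj_sum sum_distrib_left
    by (intro sum.cong refl) (simp add: mult_ac)
  finally have det: "Determinant.det (mat k k (\<lambda>(i, j). \<Sum>s\<in>S. complex_of_real (c s) * \<phi> s (x i) * cnj (\<phi> s (x j))))
      = (\<Sum>g\<in>?A \<rightarrow>\<^sub>E S. T g)" (is "?det = _") .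
  have "of_nat (fact k) * ?det = (\<Sum>\<pi> | \<pi> permutes ?A. \<Sum>g\<in>?A \<rightarrow>\<^sub>E S. T g)"
    by (simp add: det card_permutations)
  also have "\<dots> = (\<Sum>\<pi> | \<pi> permutes ?A. \<Sum>g\<in>?A \<rightarrow>\<^sub>E S. T (g \<circ> \<pi>))"
  proof (rule sum.cong[OF refl], rule sum_PiE_compose_permutation[symmetric])
    fix g h :: "nat \<Rightarrow> nat" assume "\<And>i. i \<in> ?A \<Longrightarrow> g i = h i"
    then show "T g = T h" unfolding T_def
      by (intro arg_cong2[where f="(*)"] arg_cong[where f=cnj] prod.cong slater_cong) auto
  qed simp
  also have "\<dots> = (\<Sum>g\<in>?A \<rightarrow>\<^sub>E S. \<Sum>\<pi> | \<pi> permutes ?A. T (g \<circ> \<pi>))"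
    by (rule sum.swap)
  also have "\<dots> = (\<Sum>g\<in>?A \<rightarrow>\<^sub>E S. ?C g * (slater \<phi> ?A g x * cnj (slater \<phi> ?A g x)))"
  proof (intro sum.cong refl)
    fix g :: "nat \<Rightarrow> nat"
    \<comment> \<open>The coefficients are symmetric under permutations, the Slater determinant is antisymmetric.\<close>
    have "T (g \<circ> \<pi>) = ?C g * (of_int (sign \<pi>) * ?D (g \<circ> \<pi>)) * cnj (slater \<phi> ?A g x)"
      if "\<pi> permutes ?A" for \<pi>
    proof -
      have "?C (g \<circ> \<pi>) = ?C g"
        using prod.permute[OF that, of "\<lambda>i. complex_of_real (c (g i))"] by (simp add: o_def)
      then show ?thesis
        unfolding T_def slater_compose[OF finite_lessThan that] by simp
    qed
    then have "(\<Sum>\<pi> | \<pi> permutes ?A. T (g \<circ> \<pi>))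
        = (\<Sum>\<pi> | \<pi> permutes ?A. ?C g * (of_int (sign \<pi>) * ?D (g \<circ> \<pi>)) * cnj (slater \<phi> ?A g x))"
      by (intro sum.cong) auto
    also have "\<dots> = ?C g * (\<Sum>\<pi> | \<pi> permutes ?A. of_int (sign \<pi>) * ?D (g \<circ> \<pi>)) * cnj (slater \<phi> ?A g x)"
      by (simp only: sum_distrib_left sum_distrib_right)
    also have "(\<Sum>\<pi> | \<pi> permutes ?A. of_int (sign \<pi>) * ?D (g \<circ> \<pi>)) = slater \<phi> ?A g x"
      by (simp add: slater_def)
    finally show "(\<Sum>\<pi> | \<pi> permutes ?A. T (g \<circ> \<pi>)) = ?C g * (slater \<phi> ?A g x * cnj (slater \<phi> ?A g x))"
      by (simp only: mult.assoc)
  qed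
  also have "\<dots> = complex_of_real (\<Sum>g\<in>?A \<rightarrow>\<^sub>E S. (\<Prod>i\<in>?A. c (g i)) * (cmod (slater \<phi> ?A g x))\<^sup>2)"
    by (simp only: of_real_sum of_real_mult of_real_prod complex_norm_square)
  finally have *: "of_nat (fact k) * ?det
    = complex_of_real (\<Sum>g\<in>?A \<rightarrow>\<^sub>E S. (\<Prod>i\<in>?A. c (g i)) * (cmod (slater \<phi> ?A g x))\<^sup>2)" .
  show ?thesis
    unfolding of_real_divide *[symmetric] by simp
qed

text \<open>
  The right-hand side of the Cauchy--Binet expansion over all of \<open>J\<close>, as an element of \<open>[0,\<infinity>]\<close>.
  Every point \<open>x\<close> is allowed here, while the kernel expansion itself converges only almost
  everywhere; sums and integrals can then be exchanged freely.
\<close>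

definition intensity :: "nat set \<Rightarrow> (nat \<Rightarrow> 'a \<Rightarrow> complex) \<Rightarrow> (nat \<Rightarrow> real) \<Rightarrow> nat \<Rightarrow> (nat \<Rightarrow> 'a) \<Rightarrow> ennreal" where
  "intensity J \<phi> c k x =
    (\<integral>\<^sup>+ g. ennreal ((\<Prod>i<k. c (g i)) * (cmod (slater \<phi> {..<k} g x))\<^sup>2) \<partial>count_space ({..<k} \<rightarrow>\<^sub>E J)) / fact k"

definition finite_intensity :: "nat set \<Rightarrow> (nat \<Rightarrow> 'a \<Rightarrow> complex) \<Rightarrow> (nat \<Rightarrow> real) \<Rightarrow> nat \<Rightarrow> (nat \<Rightarrow> 'a) \<Rightarrow> real" where
  "finite_intensity S \<phi> c k x =
    (\<Sum>g\<in>{..<k} \<rightarrow>\<^sub>E S. (\<Prod>i<k. c (g i)) * (cmod (slater \<phi> {..<k} g x))\<^sup>2) / fact k"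

lemma fact_ennreal: "(fact k :: ennreal) = ennreal (fact k)"
  using ennreal_of_nat_eq_real_of_nat[of "fact k"] by (simp only: of_nat_fact)

lemma intensity_finite_support:
  assumes "finite S" "S \<subseteq> J" "\<And>s. s \<in> J \<Longrightarrow> s \<notin> S \<Longrightarrow> c s = 0" "\<And>s. s \<in> S \<Longrightarrow> 0 \<le> c s"
  shows "intensity J \<phi> c k x = ennreal (finite_intensity S \<phi> c k x)"
proof -
  have "(\<integral>\<^sup>+ g. ennreal ((\<Prod>i<k. c (g i)) * (cmod (slater \<phi> {..<k} g x))\<^sup>2) \<partial>count_space ({..<k} \<rightarrow>\<^sub>E J))
      = (\<Sum>g\<in>{..<k} \<rightarrow>\<^sub>E S. ennreal ((\<Prod>i<k. c (g i)) * (cmod (slater \<phi> {..<k} g x))\<^sup>2))"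
  proof (rule nn_integral_count_space')
    show "finite ({..<k} \<rightarrow>\<^sub>E S)" using assms(1) by (intro finite_PiE) auto
    show "{..<k} \<rightarrow>\<^sub>E S \<subseteq> {..<k} \<rightarrow>\<^sub>E J" using assms(2) by (intro PiE_mono) auto
    fix g assume g: "g \<in> {..<k} \<rightarrow>\<^sub>E J" "g \<notin> {..<k} \<rightarrow>\<^sub>E S"
    then obtain i where "i < k" "g i \<notin> S" by (auto simp: PiE_iff)
    then have "c (g i) = 0" using g(1) by (intro assms(3)) auto
    then have "(\<Prod>i<k. c (g i)) = 0" using \<open>i < k\<close> by (intro prod_zero) auto
    then show "ennreal ((\<Prod>i<k. c (g i)) * (cmod (slater \<phi> {..<k} g x))\<^sup>2) = 0"
      by (simp only: mult_zero_left ennreal_0)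
  qed
  also have "\<dots> = ennreal (\<Sum>g\<in>{..<k} \<rightarrow>\<^sub>E S. (\<Prod>i<k. c (g i)) * (cmod (slater \<phi> {..<k} g x))\<^sup>2)"
    using assms(4) by (intro sum_ennreal mult_nonneg_nonneg prod_nonneg) auto
  finally have *: "intensity J \<phi> c k x =
      ennreal (\<Sum>g\<in>{..<k} \<rightarrow>\<^sub>E S. (\<Prod>i<k. c (g i)) * (cmod (slater \<phi> {..<k} g x))\<^sup>2) / ennreal (fact k)"
    unfolding intensity_def fact_ennreal by (rule arg_cong2[where f="(/)", OF _ refl])
  show ?thesis
    unfolding * finite_intensity_def using assms(4)
    by (intro divide_ennreal sum_nonneg mult_nonneg_nonneg prod_nonneg) auto
qed

lemma finite_intensity_tendsto:
  assumes "\<forall>s\<in>J. 0 \<le> c s"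
  shows "(\<lambda>n. ennreal (finite_intensity (J \<inter> {..<n}) \<phi> c k x)) \<longlonglongrightarrow> intensity J \<phi> c k x"
proof -
  let ?F = "\<lambda>n g. ennreal ((\<Prod>i<k. c (g i)) * (cmod (slater \<phi> {..<k} g x))\<^sup>2) * indicator ({..<k} \<rightarrow>\<^sub>E (J \<inter> {..<n})) g"
  have eq: "ennreal (finite_intensity (J \<inter> {..<n}) \<phi> c k x) = (\<integral>\<^sup>+ g. ?F n g \<partial>count_space ({..<k} \<rightarrow>\<^sub>E J)) / fact k" for n
  proof -
    have "finite_intensity (J \<inter> {..<n}) \<phi> c k x
        = finite_intensity (J \<inter> {..<n}) \<phi> (\<lambda>s. if s < n then c s else 0) k x"
      unfolding finite_intensity_def
      by (intro arg_cong2[where f="(/)"] sum.cong arg_cong2[where f="(*)"] prod.cong refl) (auto simp: PiE_iff)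
    then have "ennreal (finite_intensity (J \<inter> {..<n}) \<phi> c k x)
        = intensity J \<phi> (\<lambda>s. if s < n then c s else 0) k x"
      using assms by (subst intensity_finite_support[of "J \<inter> {..<n}"]) auto
    also have "\<dots> = (\<integral>\<^sup>+ g. ?F n g \<partial>count_space ({..<k} \<rightarrow>\<^sub>E J)) / fact k"
      unfolding intensity_def
    proof (intro arg_cong2[where f="(/)"] nn_integral_cong refl)
      fix g assume g: "g \<in> space (count_space ({..<k} \<rightarrow>\<^sub>E J))"
      show "ennreal ((\<Prod>i<k. if g i < n then c (g i) else 0) * (cmod (slater \<phi> {..<k} g x))\<^sup>2) = ?F n g"
      proof (cases "\<forall>i<k. g i < n")
        case True
        then have "g \<in> {..<k} \<rightarrow>\<^sub>E (J \<inter> {..<n})" using g by (auto simp: PiE_iff)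
        then show ?thesis using True by simp
      next
        case False
        then have "(\<Prod>i<k. if g i < n then c (g i) else 0) = 0" by (intro prod_zero) auto
        moreover have "indicator ({..<k} \<rightarrow>\<^sub>E (J \<inter> {..<n})) g = (0::ennreal)"
          using False by (auto simp: PiE_iff indicator_def)
        ultimately show ?thesis by (simp only: mult_zero_left mult_zero_right ennreal_0)
      qed
    qed
    finally show ?thesis .
  qed
  have "(\<lambda>n. \<integral>\<^sup>+ g. ?F n g \<partial>count_space ({..<k} \<rightarrow>\<^sub>E J))
      \<longlonglongrightarrow> (\<integral>\<^sup>+ g. ennreal ((\<Prod>i<k. c (g i)) * (cmod (slater \<phi> {..<k} g x))\<^sup>2) *
        indicator ({..<k} \<rightarrow>\<^sub>E J) g \<partial>count_space ({..<k} \<rightarrow>\<^sub>E J))"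
  proof (rule nn_integral_LIMSEQ)
    have "{..<k} \<rightarrow>\<^sub>E (J \<inter> {..<m}) \<subseteq> {..<k} \<rightarrow>\<^sub>E (J \<inter> {..<n})" if "m \<le> n" for m n
      using that by (intro PiE_mono) auto
    then show "incseq ?F"
      unfolding incseq_def le_fun_def
      by (intro allI impI mult_left_mono) (auto simp: indicator_def)
    fix g :: "nat \<Rightarrow> nat"
    show "(\<lambda>n. ?F n g) \<longlonglongrightarrow> ennreal ((\<Prod>i<k. c (g i)) * (cmod (slater \<phi> {..<k} g x))\<^sup>2) * indicator ({..<k} \<rightarrow>\<^sub>E J) g"
    proof (rule tendsto_eventually, rule eventually_sequentiallyI)
      fix n assume n: "Suc (\<Sum>i<k. g i) \<le> n"
      have "g i < n" if "i < k" for i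
        using member_le_sum[of i "{..<k}" g] that n by simp
      then have "g \<in> {..<k} \<rightarrow>\<^sub>E (J \<inter> {..<n}) \<longleftrightarrow> g \<in> {..<k} \<rightarrow>\<^sub>E J" by (auto simp: PiE_iff)
      then show "?F n g = ennreal ((\<Prod>i<k. c (g i)) * (cmod (slater \<phi> {..<k} g x))\<^sup>2) * indicator ({..<k} \<rightarrow>\<^sub>E J) g"
        by (simp add: indicator_def)
    qed
  qed simp
  also have "(\<integral>\<^sup>+ g. ennreal ((\<Prod>i<k. c (g i)) * (cmod (slater \<phi> {..<k} g x))\<^sup>2) *
        indicator ({..<k} \<rightarrow>\<^sub>E J) g \<partial>count_space ({..<k} \<rightarrow>\<^sub>E J))
      = (\<integral>\<^sup>+ g. ennreal ((\<Prod>i<k. c (g i)) * (cmod (slater \<phi> {..<k} g x))\<^sup>2) \<partial>count_space ({..<k} \<rightarrow>\<^sub>E J))"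
    by (intro nn_integral_cong) simp
  finally show ?thesis
    unfolding eq intensity_def divide_ennreal_def
    by (intro tendsto_mult_ennreal tendsto_const) (auto simp: ennreal_inverse_eq_0_iff)
qed

section \<open>Counting the points of a configuration\<close>

text \<open>
  Membership in a countable base distinguishes points.
\<close>

definition separating_open :: "nat \<Rightarrow> 'a::{second_countable_topology,t1_space} set" where
  "separating_open = (SOME U. (\<forall>i. open (U i)) \<and> (\<forall>x y. x \<noteq> y \<longrightarrow> (\<exists>i. x \<in> U i \<and> y \<notin> U i)))"

lemma separating_open:
  fixes x y :: "'a::{second_countable_topology,t1_space}"
  shows open_separating_open: "open (separating_open i :: 'a set)"
    and separating_open_separates: "x \<noteq> y \<Longrightarrow> \<exists>i. x \<in> separating_open i \<and> y \<notin> separating_open i"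
proof -
  obtain B :: "'a set set" where B: "countable B" "topological_basis B"
    using ex_countable_basis by blast
  let ?U = "\<lambda>i. if B = {} then {} else from_nat_into B i"
  have "\<forall>i. open (?U i)"
    using B(2) from_nat_into[of B] by (auto simp: topological_basis_open)
  moreover have "\<exists>i. x \<in> ?U i \<and> y \<notin> ?U i" if xy: "x \<noteq> y" for x y
  proof -
    obtain V where V: "open V" "x \<in> V" "y \<notin> V" using t1_space[OF xy] by blast
    obtain W where W: "W \<in> B" "x \<in> W" "W \<subseteq> V"
      using topological_basisE[OF B(2) V(1,2)] by blast
    obtain i where "from_nat_into B i = W"
      using from_nat_into_surj[OF B(1) W(1)] by blast
    with W V show ?thesis by (intro exI[of _ i]) auto
  qed
  ultimately have *: "\<exists>U. (\<forall>i. open (U i)) \<and> (\<forall>x y::'a. x \<noteq> y \<longrightarrow> (\<exists>i::nat. x \<in> U i \<and> y \<notin> U i))"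
    by (intro exI[of _ ?U]) blast
  note sep = someI_ex[OF *, folded separating_open_def]
  show "open (separating_open i :: 'a set)"
    using sep by simp
  show "x \<noteq> y \<Longrightarrow> \<exists>i. x \<in> separating_open i \<and> y \<notin> separating_open i"
    by (rule sep[THEN conjunct2, rule_format])
qed

lemma borel_separating_open [simp]: "separating_open i \<in> sets borel"
  by (intro borel_open open_separating_open)

text \<open>
  The sets \<open>cell n T\<close> with \<open>T \<subseteq> {..<n}\<close> are the atoms of the algebra generated by the first \<open>n\<close> of the
  separating sets. They form finite partitions which become finer as \<open>n\<close> grows and eventually
  separate any two given points.
\<close>

definition cell :: "nat \<Rightarrow> nat set \<Rightarrow> 'a::{second_countable_topology,t1_space} set" where
  "cell n T = {x. \<forall>i<n. x \<in> separating_open i \<longleftrightarrow> i \<in> T}"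

lemma borel_cell [simp]: "cell n T \<in> sets borel"
proof -
  define V where "V i = (if i \<in> T then separating_open i else - separating_open i :: 'a set)" for i
  have V: "V i \<in> sets borel" for i
    unfolding V_def by (simp add: borel_comp)
  have "cell n T = (\<Inter>i\<in>{..<n}. V i)"
    by (auto simp: cell_def V_def)
  also have "\<dots> \<in> sets borel"
    by (rule sets.countable_INT'') (auto intro: V)
  finally show ?thesis .
qed

lemma disjoint_cells: "disjoint_family_on (\<lambda>T. A \<inter> cell n T) (Pow {..<n})"
  by (auto simp: disjoint_family_on_def cell_def)

lemma UN_cells: "(\<Union>T\<in>Pow {..<n}. A \<inter> cell n T) = A"
proof -
  have "x \<in> cell n {i. i < n \<and> x \<in> separating_open i}" for x :: 'a
    by (auto simp: cell_def)
  then show ?thesis by fastforce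
qed

lemma emeasure_Int_Diff:
  assumes "A \<in> sets M" "B \<in> sets M"
  shows "emeasure M A = emeasure M (A \<inter> B) + emeasure M (A - B)"
proof -
  have "A \<inter> B \<union> (A - B) = A" "A \<inter> B \<inter> (A - B) = {}" by auto
  then show ?thesis
    using plus_emeasure[of "A \<inter> B" M "A - B"] assms by (metis sets.Diff sets.Int)
qed

lemma of_nat_le_ennreal_iff: "(of_nat m :: ennreal) \<le> of_nat n \<longleftrightarrow> m \<le> n"
  by (simp only: ennreal_of_nat_eq_real_of_nat ennreal_le_iff of_nat_0_le_iff of_nat_le_iff)

definition point_count :: "'a measure \<Rightarrow> 'a set \<Rightarrow> nat" where
  "point_count \<xi> A = nat \<lfloor>measure \<xi> A\<rfloor>"

lemma sets_point_config: "\<xi> \<in> point_configs \<Longrightarrow> sets \<xi> = sets borel"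
  by (simp add: point_configs_def radon_measure_def)

lemma emeasure_point_count:
  assumes "\<xi> \<in> point_configs" "emeasure \<xi> UNIV < \<infinity>" "A \<in> sets borel"
  shows "emeasure \<xi> A = of_nat (point_count \<xi> A)"
proof -
  have "emeasure \<xi> A \<le> emeasure \<xi> UNIV"
    using sets_point_config[OF assms(1)] by (intro emeasure_mono) auto
  then have "emeasure \<xi> A \<noteq> \<infinity>" using assms(2) by auto
  then obtain m where m: "emeasure \<xi> A = of_nat m"
    using assms by (auto simp: point_configs_def Nats_def)
  then show ?thesis
    by (simp add: point_count_def measure_def)
qed

lemma measurable_point_count:
  assumes "A \<in> sets borel"
  shows "(\<lambda>\<xi>. point_count \<xi> A) \<in> measurable config_space (count_space UNIV)"
proof -
  have [measurable]: "(\<lambda>\<xi>. emeasure \<xi> A) \<in> borel_measurable config_space"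
    by (rule measurable_emeasure_config_space[OF assms])
  show ?thesis unfolding point_count_def measure_def by measurable
qed

lemma point_count_UN:
  assumes "\<xi> \<in> point_configs" "emeasure \<xi> UNIV < \<infinity>" "finite P"
    and "\<And>T. T \<in> P \<Longrightarrow> C T \<in> sets borel" "disjoint_family_on C P"
  shows "point_count \<xi> (\<Union>T\<in>P. C T) = (\<Sum>T\<in>P. point_count \<xi> (C T))"
proof -
  have "of_nat (point_count \<xi> (\<Union>T\<in>P. C T)) = emeasure \<xi> (\<Union>T\<in>P. C T)"
    using assms by (intro emeasure_point_count[symmetric]) auto
  also have "\<dots> = (\<Sum>T\<in>P. emeasure \<xi> (C T))"
    using assms sets_point_config[OF assms(1)] by (intro sum_emeasure[symmetric]) auto
  also have "\<dots> = of_nat (\<Sum>T\<in>P. point_count \<xi> (C T))"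
    unfolding of_nat_sum by (intro sum.cong refl emeasure_point_count assms(1,2,4))
  finally show ?thesis by (simp only: of_nat_eq_iff)
qed

lemma point_count_mono:
  assumes "\<xi> \<in> point_configs" "emeasure \<xi> UNIV < \<infinity>" "A \<in> sets borel" "B \<in> sets borel" "A \<subseteq> B"
  shows "point_count \<xi> A \<le> point_count \<xi> B"
proof -
  have "emeasure \<xi> A \<le> emeasure \<xi> B"
    using assms sets_point_config[OF assms(1)] by (intro emeasure_mono) auto
  then show ?thesis
    unfolding emeasure_point_count[OF assms(1,2,3)] emeasure_point_count[OF assms(1,2,4)]
      of_nat_le_ennreal_iff .
qed

lemma sum_point_count_cells:
  assumes "\<xi> \<in> point_configs" "emeasure \<xi> UNIV < \<infinity>" "A \<in> sets borel"
  shows "(\<Sum>T\<in>Pow {..<n}. point_count \<xi> (A \<inter> cell n T)) = point_count \<xi> A"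
proof -
  have "point_count \<xi> (\<Union>T\<in>Pow {..<n}. A \<inter> cell n T) = (\<Sum>T\<in>Pow {..<n}. point_count \<xi> (A \<inter> cell n T))"
    using assms(3) by (intro point_count_UN[OF assms(1,2)] disjoint_cells) auto
  then show ?thesis by (simp only: UN_cells)
qed

text \<open>
  Halving \<open>A\<close> successively by the separating sets, one can always keep a part of nonzero measure,
  hence of measure at least 1 because the measure is integer-valued. Continuity from above gives
  measure at least 1 to the intersection, which contains at most one point.
\<close>

lemma point_config_atom:
  fixes \<xi> :: "'a::{second_countable_topology,t1_space} measure"
  assumes \<xi>: "\<xi> \<in> point_configs" "emeasure \<xi> UNIV < \<infinity>"
    and A: "A \<in> sets borel" "emeasure \<xi> A \<noteq> 0"
  shows "\<exists>x\<in>A. emeasure \<xi> {x} \<noteq> 0"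
proof -
  define W where "W = rec_nat A (\<lambda>n V. if emeasure \<xi> (V \<inter> separating_open n) \<noteq> 0
     then V \<inter> separating_open n else V - separating_open n)"
  have W0: "W 0 = A"
    and WS: "W (Suc n) = (if emeasure \<xi> (W n \<inter> separating_open n) \<noteq> 0
     then W n \<inter> separating_open n else W n - separating_open n)" for n
    by (simp_all add: W_def)
  have sW: "W n \<in> sets borel" for n
    by (induction n) (auto simp: W0 WS A(1))
  have W1: "emeasure \<xi> (W n) \<noteq> 0" for n
  proof (induction n)
    case 0 then show ?case by (simp add: W0 A)
  next
    case (Suc n)
    have "emeasure \<xi> (W n) = emeasure \<xi> (W n \<inter> separating_open n) + emeasure \<xi> (W n - separating_open n)"
      using sW[of n] sets_point_config[OF \<xi>(1)] by (intro emeasure_Int_Diff) simp_all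
    with Suc show ?case by (auto simp: WS)
  qed
  have dec: "decseq W" by (rule decseq_SucI) (auto simp: WS)
  have W1': "1 \<le> emeasure \<xi> (W n)" for n
    using W1[of n] emeasure_point_count[OF \<xi> sW[of n]] of_nat_le_ennreal_iff[of 1]
    by (cases "point_count \<xi> (W n)") auto
  have fin: "emeasure \<xi> (W n) \<noteq> \<infinity>" for n
    using emeasure_point_count[OF \<xi> sW[of n]] by simp
  have "(INF n. emeasure \<xi> (W n)) = emeasure \<xi> (\<Inter>n. W n)"
    by (rule INF_emeasure_decseq[OF _ dec fin]) (use sW sets_point_config[OF \<xi>(1)] in blast)
  moreover have "1 \<le> (INF n. emeasure \<xi> (W n))" using W1' by (rule INF_greatest)
  ultimately have ge: "1 \<le> emeasure \<xi> (\<Inter>n. W n)" by simp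
  have "(\<Inter>n. W n) \<noteq> {}"
  proof
    assume "(\<Inter>n. W n) = {}"
    with ge show False by simp
  qed
  then obtain x where x: "\<And>n. x \<in> W n" by blast
  have "y = x" if y: "\<And>n. y \<in> W n" for y
  proof (rule ccontr)
    assume "y \<noteq> x"
    then obtain i where i: "y \<in> separating_open i" "x \<notin> separating_open i"
      using separating_open_separates by blast
    show False using x[of "Suc i"] y[of "Suc i"] i by (auto simp: WS split: if_splits)
  qed
  then have "(\<Inter>n. W n) = {x}" using x by blast
  with ge have "emeasure \<xi> {x} \<noteq> 0" by (metis not_one_le_zero)
  moreover have "x \<in> A" using x[of 0] by (simp add: W0)
  ultimately show ?thesis by blast
qed

definition simple_configs :: "'a::topological_space measure set" where
  "simple_configs = {\<xi>\<in>point_configs. emeasure \<xi> UNIV < \<infinity> \<and> (\<forall>x. emeasure \<xi> {x} \<le> 1)}"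

text \<open>
  A finite configuration is carried by its finitely many atoms, and finitely many atoms lie in
  different cells of all sufficiently fine partitions.
\<close>

lemma simple_configs_resolved:
  fixes \<xi> :: "'a::{second_countable_topology,t1_space} measure"
  assumes "\<xi> \<in> simple_configs"
  shows "\<forall>\<^sub>F n in sequentially. \<forall>T. point_count \<xi> (cell n T) \<le> 1"
proof -
  have \<xi>: "\<xi> \<in> point_configs" "emeasure \<xi> UNIV < \<infinity>" "\<And>x. emeasure \<xi> {x} \<le> 1"
    using assms by (auto simp: simple_configs_def)
  define F where "F = {x. emeasure \<xi> {x} \<noteq> 0}"
  have card_F: "finite G \<Longrightarrow> G \<subseteq> F \<Longrightarrow> card G \<le> point_count \<xi> UNIV" for G
  proof -
    assume G: "finite G" "G \<subseteq> F"
    have "point_count \<xi> {x} \<noteq> 0" if "x \<in> G" for x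
      using that G emeasure_point_count[OF \<xi>(1,2), of "{x}"] by (auto simp: F_def)
    then have "card G \<le> (\<Sum>x\<in>G. point_count \<xi> {x})"
      using sum_mono[of G "\<lambda>_. 1" "\<lambda>x. point_count \<xi> {x}"] by (force simp: Suc_le_eq)
    also have "\<dots> = point_count \<xi> (\<Union>x\<in>G. {x})"
      using G by (intro point_count_UN[OF \<xi>(1,2), symmetric]) (auto simp: disjoint_family_on_def)
    also have "\<dots> \<le> point_count \<xi> UNIV"
      using G by (intro point_count_mono \<xi>) (auto simp: borel_closed finite_imp_closed)
    finally show "card G \<le> point_count \<xi> UNIV" .
  qed
  have finF: "finite F"
  proof (rule ccontr)
    assume "infinite F"
    then obtain G where "G \<subseteq> F" "finite G" "card G = Suc (point_count \<xi> UNIV)"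
      using infinite_arbitrarily_large by blast
    then show False using card_F[of G] by simp
  qed
  have null: "emeasure \<xi> (A - F) = 0" if "A \<in> sets borel" for A
  proof (rule ccontr)
    assume "emeasure \<xi> (A - F) \<noteq> 0"
    from point_config_atom[OF \<xi>(1,2) _ this] show False
      using that finF by (auto simp: F_def finite_imp_closed intro: borel_closed)
  qed
  have "\<exists>i. x \<in> separating_open i \<and> y \<notin> separating_open i" if "x \<in> F" "y \<in> F - {x}" for x y
    using that separating_open_separates[of x y] by auto
  then obtain s where s: "\<And>x y. x \<in> F \<Longrightarrow> y \<in> F - {x} \<Longrightarrow>
      x \<in> separating_open (s x y) \<and> y \<notin> separating_open (s x y)"
    by metis
  \<comment> \<open>Any bound for all the separating indices \<open>s x y\<close> would do.\<close>
  define m where "m = Suc (\<Sum>x\<in>F. \<Sum>y\<in>F. s x y)"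
  have sm: "s x y < m" if "x \<in> F" "y \<in> F" for x y
  proof -
    have "s x y \<le> (\<Sum>y\<in>F. s x y)" using that finF by (intro member_le_sum) auto
    also have "\<dots> \<le> (\<Sum>x\<in>F. \<Sum>y\<in>F. s x y)"
      using that finF by (intro member_le_sum[of x F "\<lambda>x. \<Sum>y\<in>F. s x y"]) auto
    finally show ?thesis by (simp add: m_def)
  qed
  have "point_count \<xi> (cell n T) \<le> 1" if n: "n \<ge> m" for n T
  proof -
    have one: "y = x" if "x \<in> F \<inter> cell n T" "y \<in> F \<inter> cell n T" for x y
    proof (rule ccontr)
      assume "y \<noteq> x"
      with that s[of x y] sm[of x y] n show False by (auto simp: cell_def)
    qed
    have le1: "emeasure \<xi> (F \<inter> cell n T) \<le> 1"
    proof (cases "F \<inter> cell n T = {}")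
      case False
      then obtain x where "F \<inter> cell n T = {x}" using one by blast
      then show ?thesis using \<xi>(3) by simp
    qed simp
    have "F \<in> sets borel" using finF by (simp add: borel_closed finite_imp_closed)
    then have "emeasure \<xi> (cell n T) = emeasure \<xi> (F \<inter> cell n T) + emeasure \<xi> (cell n T - F)"
      using sets_point_config[OF \<xi>(1)] emeasure_Int_Diff[of "cell n T" \<xi> F]
      by (simp add: Int_commute)
    also have "\<dots> \<le> 1" using le1 null by simp
    finally show ?thesis
      using emeasure_point_count[OF \<xi>(1,2), of "cell n T"]
      by (metis borel_cell of_nat_1 of_nat_le_ennreal_iff)
  qed
  then show ?thesis unfolding eventually_sequentially by (intro exI[of _ m] allI impI)
qed

text \<open>
  Replacing the condition on all singletons by countably many conditions makes simplicity
  measurable.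
\<close>

lemma simple_configs_eq:
  "simple_configs = {\<xi>\<in>point_configs. emeasure \<xi> UNIV < \<infinity> \<and>
     (\<exists>n. \<forall>T\<in>Pow {..<n}. point_count \<xi> (cell n T :: 'a::{second_countable_topology,t1_space} set) \<le> 1)}"
  (is "_ = ?R")
proof (intro equalityI subsetI)
  fix \<xi> :: "'a measure" assume *: "\<xi> \<in> simple_configs"
  obtain n where "\<forall>T. point_count \<xi> (cell n T) \<le> 1"
    using simple_configs_resolved[OF *] unfolding eventually_sequentially by blast
  then have "\<exists>n. \<forall>T\<in>Pow {..<n}. point_count \<xi> (cell n T) \<le> 1" by blast
  then show "\<xi> \<in> ?R"
    using * unfolding simple_configs_def mem_Collect_eq by blast
next
  fix \<xi> :: "'a measure" assume "\<xi> \<in> ?R"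
  then obtain n where \<xi>: "\<xi> \<in> point_configs" "emeasure \<xi> UNIV < \<infinity>"
    and n: "\<And>T. T \<in> Pow {..<n} \<Longrightarrow> point_count \<xi> (cell n T) \<le> 1" by blast
  have "emeasure \<xi> {x} \<le> 1" for x
  proof -
    have "x \<in> (\<Union>T\<in>Pow {..<n}. UNIV \<inter> cell n T)" unfolding UN_cells by simp
    then obtain T where T: "T \<in> Pow {..<n}" "x \<in> cell n T" by blast
    have "emeasure \<xi> {x} \<le> emeasure \<xi> (cell n T)"
      using T sets_point_config[OF \<xi>(1)] by (intro emeasure_mono) auto
    also have "\<dots> \<le> 1"
      using n[OF T(1)] emeasure_point_count[OF \<xi>, of "cell n T"]
      by (metis borel_cell of_nat_1 of_nat_le_ennreal_iff)
    finally show ?thesis .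
  qed
  with \<xi> show "\<xi> \<in> simple_configs" by (simp add: simple_configs_def)
qed

lemma sets_simple_configs:
  "(simple_configs :: 'a::{second_countable_topology,t1_space} measure set) \<in> sets config_space"
proof -
  define E where "E = (\<lambda>\<xi>. emeasure \<xi> (UNIV :: 'a set)) -` {..<\<infinity>} \<inter> space config_space"
  define C where "C n T = (\<lambda>\<xi>. point_count \<xi> (cell n T :: 'a set)) -` {..1} \<inter> space config_space" for n T
  have "E \<in> sets config_space"
    unfolding E_def
    by (rule measurable_sets[OF measurable_emeasure_config_space]) auto
  moreover have C: "C n T \<in> sets config_space" for n T
    unfolding C_def by (rule measurable_sets[OF measurable_point_count[OF borel_cell]]) simp
  have "(\<Inter>T\<in>Pow {..<n}. C n T) \<in> sets config_space" for n
    by (rule sets.finite_INT) (auto intro: C)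
  then have "(\<Union>n. \<Inter>T\<in>Pow {..<n}. C n T) \<in> sets config_space"
    by (intro sets.countable_UN image_subsetI)
  ultimately have "E \<inter> (\<Union>n. \<Inter>T\<in>Pow {..<n}. C n T) \<in> sets config_space"
    by (rule sets.Int)
  also have "E \<inter> (\<Union>n. \<Inter>T\<in>Pow {..<n}. C n T) = simple_configs"
  proof (intro equalityI subsetI)
    fix \<xi> assume "\<xi> \<in> E \<inter> (\<Union>n. \<Inter>T\<in>Pow {..<n}. C n T)"
    then obtain n where "\<xi> \<in> E" "\<And>T. T \<in> Pow {..<n} \<Longrightarrow> \<xi> \<in> C n T" by auto
    then show "\<xi> \<in> simple_configs"
      unfolding simple_configs_eq by (auto simp: E_def C_def)
  next
    fix \<xi> :: "'a measure" assume "\<xi> \<in> simple_configs"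
    then obtain n where "\<xi> \<in> point_configs" "emeasure \<xi> UNIV < \<infinity>"
      and n: "\<And>T. T \<in> Pow {..<n} \<Longrightarrow> point_count \<xi> (cell n T) \<le> 1"
      unfolding simple_configs_eq by blast
    then have "\<xi> \<in> E" "\<And>T. T \<in> Pow {..<n} \<Longrightarrow> \<xi> \<in> C n T"
      by (simp_all add: E_def C_def)
    then show "\<xi> \<in> E \<inter> (\<Union>n. \<Inter>T\<in>Pow {..<n}. C n T)" by blast
  qed
  finally show ?thesis .
qed

lemma pred_simple_configs:
  "Measurable.pred config_space
    (\<lambda>\<xi>. \<xi> \<in> (simple_configs :: 'a::{second_countable_topology,t1_space} measure set))"
proof -
  have "{\<xi>\<in>space config_space. \<xi> \<in> simple_configs} = (simple_configs :: 'a measure set)"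
    by (auto simp: simple_configs_def)
  then show ?thesis unfolding pred_def using sets_simple_configs by simp
qed

section \<open>Laws of simple point processes are determined by their moments\<close>

definition same_moments :: "'w measure \<Rightarrow> ('w \<Rightarrow> 'a::topological_space measure) \<Rightarrow> 'v measure \<Rightarrow> ('v \<Rightarrow> 'a measure) \<Rightarrow> bool" where
  "same_moments M X N Y \<longleftrightarrow> (\<forall>k\<ge>1::nat. \<forall>D. (\<forall>i<k. D i \<in> sets borel) \<longrightarrow> disjoint_family_on D {..<k} \<longrightarrow>
     (\<integral>\<^sup>+ \<omega>. (\<Prod>i<k. emeasure (X \<omega>) (D i)) \<partial>M) = (\<integral>\<^sup>+ \<omega>. (\<Prod>i<k. emeasure (Y \<omega>) (D i)) \<partial>N))"

lemma same_moments_finite: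
  assumes "prob_space M" "prob_space N" "same_moments M X N Y"
    and "finite P" "\<And>T. T \<in> P \<Longrightarrow> C T \<in> sets borel" "disjoint_family_on C P"
  shows "(\<integral>\<^sup>+ \<omega>. (\<Prod>T\<in>P. emeasure (X \<omega>) (C T)) \<partial>M) = (\<integral>\<^sup>+ \<omega>. (\<Prod>T\<in>P. emeasure (Y \<omega>) (C T)) \<partial>N)"
proof (cases "P = {}")
  case True
  then show ?thesis using assms(1,2) by (simp add: prob_space.emeasure_space_1)
next
  case False
  define k where "k = card P"
  have k: "k \<ge> 1" using False assms(4) by (simp add: k_def Suc_le_eq card_gt_0_iff)
  obtain h where h: "bij_betw h {..<k} P"
    using ex_bij_betw_nat_finite[OF assms(4)] by (auto simp: k_def atLeast0LessThan)
  have "\<forall>i<k. C (h i) \<in> sets borel"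
    using h assms(5) by (auto simp: bij_betw_def)
  moreover have "disjoint_family_on (\<lambda>i. C (h i)) {..<k}"
    using h assms(6) unfolding disjoint_family_on_def bij_betw_def inj_on_def by blast
  ultimately have "(\<integral>\<^sup>+ \<omega>. (\<Prod>i<k. emeasure (X \<omega>) (C (h i))) \<partial>M) =
      (\<integral>\<^sup>+ \<omega>. (\<Prod>i<k. emeasure (Y \<omega>) (C (h i))) \<partial>N)"
    by (rule assms(3)[unfolded same_moments_def, THEN spec, THEN mp, OF k, THEN spec, THEN mp, THEN mp])
  then show ?thesis
    by (simp add: prod.reindex_bij_betw[OF h, of "\<lambda>T. emeasure _ (C T)"])
qed

lemma borel_measurable_config_emeasure:
  assumes "X \<in> measurable M config_space" "A \<in> sets borel"
  shows "(\<lambda>\<omega>. emeasure (X \<omega>) A) \<in> borel_measurable M"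
  using measurable_compose[OF assms(1) measurable_emeasure_config_space[OF assms(2)]] .

lemma borel_measurable_config_count:
  assumes "X \<in> measurable M config_space" "A \<in> sets borel"
  shows "(\<lambda>\<omega>. point_count (X \<omega>) A) \<in> measurable M (count_space UNIV)"
  using measurable_compose[OF assms(1) measurable_point_count[OF assms(2)]] .

lemma same_moments_prod_plus:
  fixes X :: "'w \<Rightarrow> 'a::{second_countable_topology,t1_space} measure"
  assumes "prob_space M" "prob_space N" "same_moments M X N Y"
    and [measurable]: "X \<in> measurable M config_space" "Y \<in> measurable N config_space"
    and A: "A \<in> sets borel"
  shows "(\<integral>\<^sup>+ \<omega>. (\<Prod>T\<in>Pow {..<n}. 1 + emeasure (X \<omega>) (A \<inter> cell n T)) \<partial>M)
    = (\<integral>\<^sup>+ \<omega>. (\<Prod>T\<in>Pow {..<n}. 1 + emeasure (Y \<omega>) (A \<inter> cell n T)) \<partial>N)"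
proof -
  let ?P = "Pow {..<n}"
  have *: "(\<integral>\<^sup>+ \<omega>. (\<Prod>T\<in>?P. 1 + emeasure (Z \<omega>) (A \<inter> cell n T)) \<partial>L)
      = (\<Sum>U\<in>Pow ?P. \<integral>\<^sup>+ \<omega>. (\<Prod>T\<in>U. emeasure (Z \<omega>) (A \<inter> cell n T)) \<partial>L)"
    if Z: "Z \<in> measurable L config_space" for Z :: "'x \<Rightarrow> 'a measure" and L
  proof -
    have "(\<Prod>T\<in>?P. 1 + emeasure (Z \<omega>) (A \<inter> cell n T))
        = (\<Sum>U\<in>Pow ?P. \<Prod>T\<in>U. emeasure (Z \<omega>) (A \<inter> cell n T))" for \<omega>
      using prod_add[of ?P "\<lambda>T. emeasure (Z \<omega>) (A \<inter> cell n T)" "\<lambda>_. 1"] by (simp add: add.commute)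
    then show ?thesis
      by (simp only:) (intro nn_integral_sum borel_measurable_prod_ennreal
        borel_measurable_config_emeasure[OF Z] sets.Int A borel_cell)
  qed
  have "(\<integral>\<^sup>+ \<omega>. (\<Prod>T\<in>U. emeasure (X \<omega>) (A \<inter> cell n T)) \<partial>M)
      = (\<integral>\<^sup>+ \<omega>. (\<Prod>T\<in>U. emeasure (Y \<omega>) (A \<inter> cell n T)) \<partial>N)" if "U \<in> Pow ?P" for U
  proof (rule same_moments_finite[OF assms(1-3)])
    show "finite U" using that by (auto intro: finite_subset)
    show "disjoint_family_on (\<lambda>T. A \<inter> cell n T) U"
      using that disjoint_cells[of A n] by (auto intro: disjoint_family_on_mono)
  qed (use A in auto)
  then show ?thesis
    unfolding *[OF assms(4)] *[OF assms(5)] by (rule sum.cong[OF refl])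
qed

text \<open>
  The factorial moment generating function of the number of points at 1 is the expectation of
  this quantity; it dominates all products over cells that occur below.
\<close>

definition total_power :: "'a measure \<Rightarrow> ennreal" where
  "total_power \<xi> = of_nat (2 ^ point_count \<xi> UNIV)"

lemma prod_Suc_le_power: "finite P \<Longrightarrow> (\<Prod>T\<in>P. 1 + f T) \<le> (2::nat) ^ (\<Sum>T\<in>P. f T)"
  unfolding power_sum by (rule prod_mono) (simp add: Suc_le_eq less_exp)

lemma prod_plus_le_total_power:
  assumes "\<xi> \<in> simple_configs" "A \<in> sets borel"
  shows "(\<Prod>T\<in>Pow {..<n}. 1 + point_count \<xi> (A \<inter> cell n T)) \<le> 2 ^ point_count \<xi> UNIV"
proof -
  have \<xi>: "\<xi> \<in> point_configs" "emeasure \<xi> UNIV < \<infinity>"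
    using assms by (auto simp: simple_configs_def)
  have "(\<Prod>T\<in>Pow {..<n}. 1 + point_count \<xi> (A \<inter> cell n T)) \<le> 2 ^ point_count \<xi> A"
    using prod_Suc_le_power[of "Pow {..<n}" "\<lambda>T. point_count \<xi> (A \<inter> cell n T)"]
    by (simp add: sum_point_count_cells[OF \<xi> assms(2)])
  also have "\<dots> \<le> 2 ^ point_count \<xi> UNIV"
    using assms(2) by (intro power_increasing point_count_mono[OF \<xi>]) auto
  finally show ?thesis .
qed

lemma prod_plus_eventually_total_power:
  fixes \<xi> :: "'a::{second_countable_topology,t1_space} measure"
  assumes "\<xi> \<in> simple_configs"
  shows "\<forall>\<^sub>F n in sequentially.
    (\<Prod>T\<in>Pow {..<n}. 1 + emeasure \<xi> (UNIV \<inter> cell n T)) = total_power \<xi>"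
  using simple_configs_resolved[OF assms]
proof eventually_elim
  case (elim n)
  have \<xi>: "\<xi> \<in> point_configs" "emeasure \<xi> UNIV < \<infinity>"
    using assms by (auto simp: simple_configs_def)
  let ?f = "\<lambda>T. point_count \<xi> (UNIV \<inter> cell n T :: 'a set)"
  have "(1 + ?f T) = 2 ^ ?f T" for T
    using elim[rule_format, of T] by (cases "?f T") auto
  then have "(\<Prod>T\<in>Pow {..<n}. 1 + ?f T) = 2 ^ (\<Sum>T\<in>Pow {..<n}. ?f T)"
    by (simp add: power_sum)
  also have "\<dots> = 2 ^ point_count \<xi> UNIV"
    by (subst sum_point_count_cells[OF \<xi>]) auto
  finally have eq: "(\<Prod>T\<in>Pow {..<n}. 1 + ?f T) = 2 ^ point_count \<xi> UNIV" .
  have "(\<Prod>T\<in>Pow {..<n}. 1 + emeasure \<xi> (UNIV \<inter> cell n T)) = (\<Prod>T\<in>Pow {..<n}. of_nat (1 + ?f T))"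
    using emeasure_point_count[OF \<xi>, of "cell n _"] by (intro prod.cong) auto
  also have "\<dots> = of_nat (\<Prod>T\<in>Pow {..<n}. 1 + ?f T)"
    by (simp only: of_nat_prod)
  finally show ?case unfolding eq total_power_def .
qed

text \<open>
  Along finer partitions \<open>\<Prod>\<^sub>C (1 + X(C))\<close> is at most \<open>2^X(\<Lambda>)\<close> and eventually equal to it, and its
  expectation is a sum of moments. Fatou's lemma for \<open>X\<close> and the bound for \<open>Y\<close> give the claim, so
  integrability needs to be checked for one of the two processes only.
\<close>

lemma nn_integral_total_power_le:
  fixes X :: "'w \<Rightarrow> 'a::{second_countable_topology,t1_space} measure"
  assumes "prob_space M" "prob_space N" "same_moments M X N Y"
    and X: "X \<in> measurable M config_space" and Y: "Y \<in> measurable N config_space"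
    and "AE \<omega> in M. X \<omega> \<in> simple_configs" "AE \<omega> in N. Y \<omega> \<in> simple_configs"
  shows "(\<integral>\<^sup>+ \<omega>. total_power (X \<omega>) \<partial>M) \<le> (\<integral>\<^sup>+ \<omega>. total_power (Y \<omega>) \<partial>N)"
proof -
  let ?g = "\<lambda>n \<xi>. \<Prod>T\<in>Pow {..<n}. 1 + emeasure \<xi> (UNIV \<inter> cell n T :: 'a set)"
  have meas: "(\<lambda>\<omega>. ?g n (X \<omega>)) \<in> borel_measurable M" for n
    by (intro borel_measurable_prod_ennreal borel_measurable_add borel_measurable_const
        borel_measurable_config_emeasure[OF X] sets.Int borel_cell) simp
  have le: "AE \<omega> in N. ?g n (Y \<omega>) \<le> total_power (Y \<omega>)" for n
      using assms(7)
    proof eventually_elim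
      case (elim \<omega>)
      have \<xi>: "Y \<omega> \<in> point_configs" "emeasure (Y \<omega>) UNIV < \<infinity>"
        using elim by (auto simp: simple_configs_def)
      have "?g n (Y \<omega>) = (\<Prod>T\<in>Pow {..<n}. of_nat (1 + point_count (Y \<omega>) (UNIV \<inter> cell n T)))"
        using emeasure_point_count[OF \<xi>, of "cell n _"] by (intro prod.cong) auto
      also have "\<dots> = of_nat (\<Prod>T\<in>Pow {..<n}. 1 + point_count (Y \<omega>) (UNIV \<inter> cell n T))"
        by (simp only: of_nat_prod)
      also have "\<dots> \<le> total_power (Y \<omega>)"
        unfolding total_power_def of_nat_le_ennreal_iff
        by (rule prod_plus_le_total_power[OF elim]) simp
      finally show ?case .
    qed
  have "(\<integral>\<^sup>+ \<omega>. total_power (X \<omega>) \<partial>M) = (\<integral>\<^sup>+ \<omega>. liminf (\<lambda>n. ?g n (X \<omega>)) \<partial>M)"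
  proof (rule nn_integral_cong_AE)
    show "AE \<omega> in M. total_power (X \<omega>) = liminf (\<lambda>n. ?g n (X \<omega>))"
      using assms(6)
    proof eventually_elim
      case (elim \<omega>)
      have "liminf (\<lambda>n. ?g n (X \<omega>)) = liminf (\<lambda>n. total_power (X \<omega>))"
        by (rule Liminf_eq[OF prod_plus_eventually_total_power[OF elim]])
      then show ?case by (simp add: Liminf_const)
    qed
  qed
  also have "\<dots> \<le> liminf (\<lambda>n. \<integral>\<^sup>+ \<omega>. ?g n (X \<omega>) \<partial>M)"
    by (rule nn_integral_liminf[OF meas])
  also have "\<dots> = liminf (\<lambda>n. \<integral>\<^sup>+ \<omega>. ?g n (Y \<omega>) \<partial>N)"
    by (subst same_moments_prod_plus[OF assms(1-3) X Y]) simp_all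
  also have "\<dots> \<le> liminf (\<lambda>n::nat. \<integral>\<^sup>+ \<omega>. total_power (Y \<omega>) \<partial>N)"
    by (intro Liminf_mono always_eventually allI nn_integral_mono_AE le)
  also have "\<dots> = (\<integral>\<^sup>+ \<omega>. total_power (Y \<omega>) \<partial>N)" by (simp add: Liminf_const)
  finally show ?thesis .
qed

text \<open>
  The partial expressions are the expectations of \<open>\<Prod>\<^sub>C (1 - Z(C))\<close> over the cells \<open>C\<close> of \<open>A\<close>. As soon as
  no cell contains two points, the product is 1 or 0 according to whether \<open>Z(A) = 0\<close>, and it is
  bounded by \<open>2^Z(\<Lambda>)\<close>, so dominated convergence applies.
\<close>

lemma void_probability_limit:
  fixes Z :: "'w \<Rightarrow> 'a::{second_countable_topology,t1_space} measure"
  assumes L: "prob_space L" and Z: "Z \<in> measurable L config_space"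
    and simple: "AE \<omega> in L. Z \<omega> \<in> simple_configs"
    and fin: "(\<integral>\<^sup>+ \<omega>. total_power (Z \<omega>) \<partial>L) < \<infinity>"
    and A: "A \<in> sets borel"
  shows "(\<lambda>n. \<Sum>U\<in>Pow (Pow {..<n}).
       (- 1) ^ card U * enn2real (\<integral>\<^sup>+ \<omega>. (\<Prod>T\<in>U. emeasure (Z \<omega>) (A \<inter> cell n T)) \<partial>L))
     \<longlonglongrightarrow> measure L {\<omega>\<in>space L. emeasure (Z \<omega>) A = 0}"
proof -
  let ?y = "\<lambda>n T \<omega>. real (point_count (Z \<omega>) (A \<inter> cell n T))"
  let ?w = "\<lambda>\<omega>. 2 ^ point_count (Z \<omega>) UNIV :: real"
  let ?s = "\<lambda>n \<omega>. \<Prod>T\<in>Pow {..<n}. 1 + - ?y n T \<omega>"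
  interpret L: prob_space L by (rule L)
  have y [measurable]: "(\<lambda>\<omega>. ?y n T \<omega>) \<in> borel_measurable L" for n T
    using borel_measurable_config_count[OF Z sets.Int[OF A borel_cell]] by simp
  have wm [measurable]: "?w \<in> borel_measurable L"
    using borel_measurable_config_count[OF Z, of UNIV] by simp
  have w_int: "integrable L ?w"
  proof (rule integrableI_nonneg)
    have "(\<integral>\<^sup>+ \<omega>. ennreal (?w \<omega>) \<partial>L) = (\<integral>\<^sup>+ \<omega>. total_power (Z \<omega>) \<partial>L)"
      by (simp add: total_power_def ennreal_of_nat_eq_real_of_nat)
    then show "(\<integral>\<^sup>+ \<omega>. ennreal (?w \<omega>) \<partial>L) < \<infinity>" using fin by simp
  qed (use wm in auto)
  have prod_le: "(\<Prod>T\<in>U. ?y n T \<omega>) \<le> (\<Prod>T\<in>Pow {..<n}. 1 + ?y n T \<omega>)"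
    if "U \<subseteq> Pow {..<n}" for U n \<omega>
  proof -
    have "(\<Prod>T\<in>U. ?y n T \<omega>) \<le> (\<Prod>T\<in>U. 1 + ?y n T \<omega>)" by (intro prod_mono) auto
    also have "\<dots> \<le> (\<Prod>T\<in>Pow {..<n}. 1 + ?y n T \<omega>)"
      using that by (intro prod_mono2) auto
    finally show ?thesis .
  qed
  have plus_le: "(\<Prod>T\<in>Pow {..<n}. 1 + ?y n T \<omega>) \<le> ?w \<omega>" if "Z \<omega> \<in> simple_configs" for n \<omega>
  proof -
    have "real (\<Prod>T\<in>Pow {..<n}. 1 + point_count (Z \<omega>) (A \<inter> cell n T)) \<le> real (2 ^ point_count (Z \<omega>) UNIV)"
      by (intro of_nat_mono prod_plus_le_total_power[OF that A])
    then show ?thesis by simp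
  qed
  have U_int: "integrable L (\<lambda>\<omega>. \<Prod>T\<in>U. ?y n T \<omega>)" if "U \<subseteq> Pow {..<n}" for U n
  proof (rule Bochner_Integration.integrable_bound[OF w_int])
    show "(\<lambda>\<omega>. \<Prod>T\<in>U. ?y n T \<omega>) \<in> borel_measurable L"
      by (intro borel_measurable_prod y)
    show "AE \<omega> in L. norm (\<Prod>T\<in>U. ?y n T \<omega>) \<le> norm (?w \<omega>)"
      using simple
    proof eventually_elim
      case (elim \<omega>)
      have "0 \<le> (\<Prod>T\<in>U. ?y n T \<omega>)" by (intro prod_nonneg) simp
      then show ?case using prod_le[OF that, of \<omega>] plus_le[OF elim, of n] by simp
    qed
  qed
  have U_eq: "(\<integral>\<omega>. (\<Prod>T\<in>U. ?y n T \<omega>) \<partial>L) = enn2real (\<integral>\<^sup>+ \<omega>. (\<Prod>T\<in>U. emeasure (Z \<omega>) (A \<inter> cell n T)) \<partial>L)"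
    if "U \<subseteq> Pow {..<n}" for U n
  proof -
    have "(\<integral>\<omega>. (\<Prod>T\<in>U. ?y n T \<omega>) \<partial>L) = enn2real (\<integral>\<^sup>+ \<omega>. ennreal (\<Prod>T\<in>U. ?y n T \<omega>) \<partial>L)"
      by (intro integral_eq_nn_integral borel_measurable_prod y AE_I2 prod_nonneg) simp
    also have "(\<integral>\<^sup>+ \<omega>. ennreal (\<Prod>T\<in>U. ?y n T \<omega>) \<partial>L) = (\<integral>\<^sup>+ \<omega>. (\<Prod>T\<in>U. emeasure (Z \<omega>) (A \<inter> cell n T)) \<partial>L)"
    proof (rule nn_integral_cong_AE)
      show "AE \<omega> in L. ennreal (\<Prod>T\<in>U. ?y n T \<omega>) = (\<Prod>T\<in>U. emeasure (Z \<omega>) (A \<inter> cell n T))"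
        using simple
      proof eventually_elim
        case (elim \<omega>)
        have \<xi>: "Z \<omega> \<in> point_configs" "emeasure (Z \<omega>) UNIV < \<infinity>"
          using elim by (auto simp: simple_configs_def)
        have "emeasure (Z \<omega>) (A \<inter> cell n T) = ennreal (?y n T \<omega>)" for T
          using emeasure_point_count[OF \<xi> sets.Int[OF A borel_cell]]
          by (simp add: ennreal_of_nat_eq_real_of_nat)
        then show ?case by (simp add: prod_ennreal)
      qed
    qed
    finally show ?thesis .
  qed
  \<comment> \<open>Expanding the product over the cells reduces its integral to moments over families of cells.\<close>
  have s_eq: "?s n \<omega> = (\<Sum>U\<in>Pow (Pow {..<n}). (- 1) ^ card U * (\<Prod>T\<in>U. ?y n T \<omega>))" for n \<omega>
  proof -
    have "?s n \<omega> = (\<Sum>U\<in>Pow (Pow {..<n}). \<Prod>T\<in>U. - ?y n T \<omega>)"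
      using prod_add[of "Pow {..<n}" "\<lambda>T. - ?y n T \<omega>" "\<lambda>_. 1"] by (simp add: add.commute)
    also have "\<dots> = (\<Sum>U\<in>Pow (Pow {..<n}). (- 1) ^ card U * (\<Prod>T\<in>U. ?y n T \<omega>))"
      by (intro sum.cong refl) (simp add: prod_uminus)
    finally show ?thesis .
  qed
  have s_int: "(\<integral>\<omega>. ?s n \<omega> \<partial>L) = (\<Sum>U\<in>Pow (Pow {..<n}).
       (- 1) ^ card U * enn2real (\<integral>\<^sup>+ \<omega>. (\<Prod>T\<in>U. emeasure (Z \<omega>) (A \<inter> cell n T)) \<partial>L))" for n
    unfolding s_eq by (subst Bochner_Integration.integral_sum) (auto simp: U_int U_eq intro!: sum.cong)
  have m0: "{\<omega>\<in>space L. emeasure (Z \<omega>) A = 0} \<in> sets L"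
    using measurable_sets[OF borel_measurable_config_emeasure[OF Z A], of "{0}"]
    by (auto simp: vimage_def Int_def conj_commute)
  have "(\<lambda>n. \<integral>\<omega>. ?s n \<omega> \<partial>L) \<longlonglongrightarrow> (\<integral>\<omega>. indicator {\<omega>\<in>space L. emeasure (Z \<omega>) A = 0} \<omega> \<partial>L)"
  proof (rule integral_dominated_convergence[OF _ _ w_int])
    show "?s n \<in> borel_measurable L" for n
      by (intro borel_measurable_prod borel_measurable_add borel_measurable_const borel_measurable_uminus y)
    show "indicator {\<omega>\<in>space L. emeasure (Z \<omega>) A = 0} \<in> borel_measurable L"
      using m0 by (intro borel_measurable_indicator)
    show "AE \<omega> in L. norm (?s n \<omega>) \<le> ?w \<omega>" for n
      using simple
    proof eventually_elim
      case (elim \<omega>)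
      have "norm (?s n \<omega>) = (\<Prod>T\<in>Pow {..<n}. \<bar>1 + - ?y n T \<omega>\<bar>)"
        by (simp add: abs_prod)
      also have "\<dots> \<le> (\<Prod>T\<in>Pow {..<n}. 1 + ?y n T \<omega>)"
        by (intro prod_mono) auto
      also have "\<dots> \<le> ?w \<omega>" by (rule plus_le[OF elim])
      finally show ?case .
    qed
    show "AE \<omega> in L. (\<lambda>n. ?s n \<omega>) \<longlonglongrightarrow> indicator {\<omega>\<in>space L. emeasure (Z \<omega>) A = 0} \<omega>"
      using simple AE_space
    proof eventually_elim
      case (elim \<omega>)
      have \<xi>: "Z \<omega> \<in> point_configs" "emeasure (Z \<omega>) UNIV < \<infinity>"
        using elim(1) by (auto simp: simple_configs_def)
      have "\<forall>\<^sub>F n in sequentially. ?s n \<omega> = indicator {\<omega>\<in>space L. emeasure (Z \<omega>) A = 0} \<omega>"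
        using simple_configs_resolved[OF elim(1)]
      proof eventually_elim
        case (elim n)
        have le1: "point_count (Z \<omega>) (A \<inter> cell n T) \<le> 1" for T
          using point_count_mono[OF \<xi>, of "A \<inter> cell n T" "cell n T"] A elim[rule_format, of T]
          by (simp add: sets.Int)
        have "?s n \<omega> = (\<Prod>T\<in>Pow {..<n}. of_bool (point_count (Z \<omega>) (A \<inter> cell n T) = 0))"
        proof (intro prod.cong refl)
          fix T show "1 + - ?y n T \<omega> = of_bool (point_count (Z \<omega>) (A \<inter> cell n T) = 0)"
            using le1[of T] by (cases "point_count (Z \<omega>) (A \<inter> cell n T)") auto
        qed
        also have "\<dots> = of_bool (\<forall>T\<in>Pow {..<n}. point_count (Z \<omega>) (A \<inter> cell n T) = 0)"
        proof (cases "\<forall>T\<in>Pow {..<n}. point_count (Z \<omega>) (A \<inter> cell n T) = 0")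
          case False
          then have "(\<Prod>T\<in>Pow {..<n}. of_bool (point_count (Z \<omega>) (A \<inter> cell n T) = 0)) = (0::real)"
            by (intro prod_zero) auto
          then show ?thesis using False by simp
        qed simp
        also have "(\<forall>T\<in>Pow {..<n}. point_count (Z \<omega>) (A \<inter> cell n T) = 0) \<longleftrightarrow> point_count (Z \<omega>) A = 0"
          using sum_point_count_cells[OF \<xi> A, of n]
            sum_eq_0_iff[of "Pow {..<n}" "\<lambda>T. point_count (Z \<omega>) (A \<inter> cell n T)"] by simp
        also have "\<dots> \<longleftrightarrow> emeasure (Z \<omega>) A = 0"
          unfolding emeasure_point_count[OF \<xi> A] by simp
        finally show ?case using \<open>\<omega> \<in> space L\<close> by (simp add: indicator_def)
      qed
      then show ?case by (rule tendsto_eventually)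
    qed
  qed
  also have "(\<integral>\<omega>. indicator {\<omega>\<in>space L. emeasure (Z \<omega>) A = 0} \<omega> \<partial>L) = measure L {\<omega>\<in>space L. emeasure (Z \<omega>) A = 0}"
    using m0 by simp
  finally show ?thesis unfolding s_int .
qed

lemma void_probability_eq:
  fixes X :: "'w \<Rightarrow> 'a::{second_countable_topology,t1_space} measure"
  assumes "prob_space M" "prob_space N" "same_moments M X N Y"
    and X: "X \<in> measurable M config_space" and Y: "Y \<in> measurable N config_space"
    and "AE \<omega> in M. X \<omega> \<in> simple_configs" "AE \<omega> in N. Y \<omega> \<in> simple_configs"
    and fin: "(\<integral>\<^sup>+ \<omega>. total_power (Y \<omega>) \<partial>N) < \<infinity>"
    and A: "A \<in> sets borel"
  shows "measure M {\<omega>\<in>space M. emeasure (X \<omega>) A = 0} = measure N {\<omega>\<in>space N. emeasure (Y \<omega>) A = 0}"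
proof (rule LIMSEQ_unique)
  have finX: "(\<integral>\<^sup>+ \<omega>. total_power (X \<omega>) \<partial>M) < \<infinity>"
    using nn_integral_total_power_le[OF assms(1-7)] fin by (rule le_less_trans)
  show "(\<lambda>n. \<Sum>U\<in>Pow (Pow {..<n}).
       (- 1) ^ card U * enn2real (\<integral>\<^sup>+ \<omega>. (\<Prod>T\<in>U. emeasure (X \<omega>) (A \<inter> cell n T)) \<partial>M))
     \<longlonglongrightarrow> measure M {\<omega>\<in>space M. emeasure (X \<omega>) A = 0}"
    by (rule void_probability_limit[OF assms(1) X assms(6) finX A])
  have "(\<integral>\<^sup>+ \<omega>. (\<Prod>T\<in>U. emeasure (X \<omega>) (A \<inter> cell n T)) \<partial>M)
      = (\<integral>\<^sup>+ \<omega>. (\<Prod>T\<in>U. emeasure (Y \<omega>) (A \<inter> cell n T)) \<partial>N)" if "U \<in> Pow (Pow {..<n})" for U n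
  proof (rule same_moments_finite[OF assms(1-3)])
    show "finite U" using that by (auto intro: finite_subset)
    show "disjoint_family_on (\<lambda>T. A \<inter> cell n T) U"
      using that disjoint_cells[of A n] by (auto intro: disjoint_family_on_mono)
  qed (use A in auto)
  then have "(\<lambda>n. \<Sum>U\<in>Pow (Pow {..<n}).
       (- 1) ^ card U * enn2real (\<integral>\<^sup>+ \<omega>. (\<Prod>T\<in>U. emeasure (X \<omega>) (A \<inter> cell n T)) \<partial>M)) =
     (\<lambda>n. \<Sum>U\<in>Pow (Pow {..<n}).
       (- 1) ^ card U * enn2real (\<integral>\<^sup>+ \<omega>. (\<Prod>T\<in>U. emeasure (Y \<omega>) (A \<inter> cell n T)) \<partial>N))"
    by (intro ext sum.cong refl) simp
  then show "(\<lambda>n. \<Sum>U\<in>Pow (Pow {..<n}).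
       (- 1) ^ card U * enn2real (\<integral>\<^sup>+ \<omega>. (\<Prod>T\<in>U. emeasure (X \<omega>) (A \<inter> cell n T)) \<partial>M))
     \<longlonglongrightarrow> measure N {\<omega>\<in>space N. emeasure (Y \<omega>) A = 0}"
    using void_probability_limit[OF assms(2) Y assms(7) fin A] by simp
qed

text \<open>
  Since \<open>\<xi>(A \<union> B) = 0\<close> means \<open>\<xi>(A) = 0\<close> and \<open>\<xi>(B) = 0\<close>, these events are closed under intersection.
\<close>

definition void_events :: "'a::topological_space measure set set" where
  "void_events = (\<lambda>A. {\<xi>\<in>point_configs. emeasure \<xi> A = 0}) ` sets borel"

lemma void_events_subset: "void_events \<subseteq> Pow point_configs"
  by (auto simp: void_events_def)

lemma Int_stable_void_events: "Int_stable void_events"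
proof (rule Int_stableI)
  fix a b :: "'a measure set" assume "a \<in> void_events" "b \<in> void_events"
  then obtain A B where AB: "A \<in> sets borel" "B \<in> sets borel"
    and a: "a = {\<xi>\<in>point_configs. emeasure \<xi> A = 0}" and b: "b = {\<xi>\<in>point_configs. emeasure \<xi> B = 0}"
    by (auto simp: void_events_def)
  have "emeasure \<xi> (A \<union> B) = 0 \<longleftrightarrow> emeasure \<xi> A = 0 \<and> emeasure \<xi> B = 0"
    if "\<xi> \<in> point_configs" for \<xi> :: "'a measure"
  proof -
    have [simp]: "A \<in> sets \<xi>" "B \<in> sets \<xi>" using AB sets_point_config[OF that] by auto
    have "emeasure \<xi> A \<le> emeasure \<xi> (A \<union> B)" "emeasure \<xi> B \<le> emeasure \<xi> (A \<union> B)"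
      by (auto intro!: emeasure_mono)
    moreover have "emeasure \<xi> (A \<union> B) \<le> emeasure \<xi> A + emeasure \<xi> B"
      by (rule emeasure_subadditive) auto
    ultimately show ?thesis by (auto simp: le_zero_eq)
  qed
  then have "a \<inter> b = {\<xi>\<in>point_configs. emeasure \<xi> (A \<union> B) = 0}"
    by (auto simp: a b)
  then show "a \<inter> b \<in> void_events"
    using AB by (auto simp: void_events_def)
qed

text \<open>
  On simple finite configurations, \<open>\<xi>(A)\<close> is the limit of the numbers of cells of \<open>A\<close> that are not
  empty. Hence the void events generate the whole sigma-algebra there.
\<close>

lemma measurable_id_void_events:
  "(\<lambda>\<xi>. \<xi>) \<in> measurable
     (restrict_space (sigma point_configs void_events) simple_configs)
     (config_space :: 'a::{second_countable_topology,t1_space} measure measure)"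
proof (rule measurable_config_spaceI)
  let ?V = "sigma point_configs (void_events :: 'a measure set set)"
  have sp: "simple_configs \<subseteq> (point_configs :: 'a measure set)" by (auto simp: simple_configs_def)
  have space: "space (restrict_space ?V simple_configs) = simple_configs"
    using sp by (auto simp: space_restrict_space space_measure_of_conv)
  then show "(\<lambda>\<xi>. \<xi>) \<in> space (restrict_space ?V simple_configs) \<rightarrow> point_configs"
    using sp by auto
  fix A :: "'a set" assume A: "A \<in> sets borel"
  have void: "(\<lambda>\<xi>. of_bool (emeasure \<xi> B \<noteq> 0) :: ennreal) \<in> borel_measurable (restrict_space ?V simple_configs)"
    if B: "B \<in> sets borel" for B
  proof (rule measurable_restrict_space1)
    have "{\<xi>\<in>point_configs. emeasure \<xi> B = 0} \<in> sets ?V"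
      using B void_events_subset by (auto simp: void_events_def intro!: sigma_sets.Basic)
    then have "indicator (space ?V - {\<xi>\<in>point_configs. emeasure \<xi> B = 0}) \<in> borel_measurable ?V"
      by (intro borel_measurable_indicator sets.compl_sets)
    then show "(\<lambda>\<xi>. of_bool (emeasure \<xi> B \<noteq> 0) :: ennreal) \<in> borel_measurable ?V"
      by (rule measurable_cong[THEN iffD1, rotated]) (auto simp: space_measure_of_conv indicator_def)
  qed
  \<comment> \<open>Number of nonempty cells of \<open>A\<close>; unlike the limit, the lower limit is defined and measurable on all of
    \<open>point_configs\<close>.\<close>
  have "(\<lambda>\<xi>. liminf (\<lambda>n. \<Sum>T\<in>Pow {..<n}. of_bool (emeasure \<xi> (A \<inter> cell n T) \<noteq> 0) :: ennreal))
      \<in> borel_measurable (restrict_space ?V simple_configs)"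
    by (intro borel_measurable_liminf borel_measurable_sum void sets.Int A borel_cell)
  then show "(\<lambda>\<xi>. emeasure \<xi> A) \<in> borel_measurable (restrict_space ?V simple_configs)"
  proof (rule measurable_cong[THEN iffD1, rotated])
    fix \<xi> assume "\<xi> \<in> space (restrict_space ?V simple_configs)"
    then have s: "\<xi> \<in> simple_configs" by (simp add: space)
    then have \<xi>: "\<xi> \<in> point_configs" "emeasure \<xi> UNIV < \<infinity>"
      by (auto simp: simple_configs_def)
    have "\<forall>\<^sub>F n in sequentially. (\<Sum>T\<in>Pow {..<n}. of_bool (emeasure \<xi> (A \<inter> cell n T) \<noteq> 0)) = emeasure \<xi> A"
      using simple_configs_resolved[OF s]
    proof eventually_elim
      case (elim n)
      have e: "emeasure \<xi> (A \<inter> cell n T) = of_nat (point_count \<xi> (A \<inter> cell n T))" for T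
        by (rule emeasure_point_count[OF \<xi> sets.Int[OF A borel_cell]])
      have le1: "point_count \<xi> (A \<inter> cell n T) \<le> 1" for T
        using point_count_mono[OF \<xi>, of "A \<inter> cell n T" "cell n T"] A elim[rule_format, of T]
        by (simp add: sets.Int)
      have "(\<Sum>T\<in>Pow {..<n}. of_bool (emeasure \<xi> (A \<inter> cell n T) \<noteq> 0))
          = (\<Sum>T\<in>Pow {..<n}. of_nat (point_count \<xi> (A \<inter> cell n T)) :: ennreal)"
      proof (intro sum.cong refl)
        fix T show "of_bool (emeasure \<xi> (A \<inter> cell n T) \<noteq> 0) = (of_nat (point_count \<xi> (A \<inter> cell n T)) :: ennreal)"
          unfolding e using le1[of T] by (cases "point_count \<xi> (A \<inter> cell n T)") auto
      qed
      also have "\<dots> = of_nat (\<Sum>T\<in>Pow {..<n}. point_count \<xi> (A \<inter> cell n T))"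
        by (simp only: of_nat_sum)
      also have "\<dots> = emeasure \<xi> A"
        unfolding sum_point_count_cells[OF \<xi> A] emeasure_point_count[OF \<xi> A] ..
      finally show ?case .
    qed
    from Liminf_eq[OF this]
    show "liminf (\<lambda>n. \<Sum>T\<in>Pow {..<n}. of_bool (emeasure \<xi> (A \<inter> cell n T) \<noteq> 0)) = emeasure \<xi> A"
      by (simp only: Liminf_const[OF sequentially_bot])
  qed
qed

theorem law_eq_of_same_moments:
  fixes X :: "'w \<Rightarrow> 'a::{second_countable_topology,t1_space} measure"
  assumes M: "prob_space M" and N: "prob_space N" and "same_moments M X N Y"
    and X: "X \<in> measurable M config_space" and Y: "Y \<in> measurable N config_space"
    and simple: "AE \<omega> in M. X \<omega> \<in> simple_configs" "AE \<omega> in N. Y \<omega> \<in> simple_configs"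
    and fin: "(\<integral>\<^sup>+ \<omega>. total_power (Y \<omega>) \<partial>N) < \<infinity>"
  shows "distr M config_space X = distr N config_space Y"
proof -
  let ?V = "sigma point_configs (void_events :: 'a measure set set)"
  have idV: "(\<lambda>\<xi>. \<xi>) \<in> measurable config_space ?V"
  proof (rule measurable_sigma_sets[OF _ void_events_subset])
    show "sets ?V = sigma_sets point_configs void_events"
      by (rule sets_measure_of[OF void_events_subset])
    show "(\<lambda>\<xi>. \<xi>) \<in> space config_space \<rightarrow> (point_configs :: 'a measure set)" by simp
    fix y :: "'a measure set" assume "y \<in> void_events"
    then obtain A where A: "A \<in> sets borel" "y = {\<xi>\<in>point_configs. emeasure \<xi> A = 0}"
      by (auto simp: void_events_def)
    have "(\<lambda>\<xi>. \<xi>) -` y \<inter> space config_space = (\<lambda>\<xi>. emeasure \<xi> A) -` {0} \<inter> space config_space"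
      by (auto simp: A(2))
    also have "\<dots> \<in> sets config_space"
      by (rule measurable_sets[OF measurable_emeasure_config_space[OF A(1)]]) simp
    finally show "(\<lambda>\<xi>. \<xi>) -` y \<inter> space config_space \<in> sets config_space" .
  qed
  have XV: "X \<in> measurable M ?V" and YV: "Y \<in> measurable N ?V"
    using measurable_compose[OF X idV] measurable_compose[OF Y idV] by simp_all
  interpret M: prob_space M by (rule M)
  interpret N: prob_space N by (rule N)
  \<comment> \<open>The void events are stable under intersection, so void probabilities determine the law on the
    sigma-algebra they generate.\<close>
  have V_eq: "distr M ?V X = distr N ?V Y"
  proof (rule measure_eqI_generator_eq[OF Int_stable_void_events void_events_subset, where A="\<lambda>_. point_configs"])
    fix y :: "'a measure set" assume y: "y \<in> void_events"
    then obtain A where A: "A \<in> sets borel" "y = {\<xi>\<in>point_configs. emeasure \<xi> A = 0}"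
      by (auto simp: void_events_def)
    have yV: "y \<in> sets ?V"
      using y void_events_subset by (auto intro!: sigma_sets.Basic)
    have 1: "X -` y \<inter> space M = {\<omega>\<in>space M. emeasure (X \<omega>) A = 0}"
      using measurable_space[OF X] by (auto simp: A(2))
    have 2: "Y -` y \<inter> space N = {\<omega>\<in>space N. emeasure (Y \<omega>) A = 0}"
      using measurable_space[OF Y] by (auto simp: A(2))
    show "emeasure (distr M ?V X) y = emeasure (distr N ?V Y) y"
      unfolding emeasure_distr[OF XV yV] emeasure_distr[OF YV yV] 1 2
        M.emeasure_eq_measure N.emeasure_eq_measure
      using void_probability_eq[OF assms A(1)] by simp
  next
    show "sets (distr M ?V X) = sigma_sets point_configs void_events"
      "sets (distr N ?V Y) = sigma_sets point_configs void_events"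
      by (simp_all add: sets_measure_of[OF void_events_subset])
    show "range (\<lambda>_. point_configs) \<subseteq> (void_events :: 'a measure set set)"
      by (auto simp: void_events_def intro!: image_eqI[of _ _ "{}"])
    show "(\<Union>i::nat. point_configs) = (point_configs :: 'a measure set)" by simp
    have "emeasure (distr M ?V X) point_configs \<le> 1"
      by (rule prob_space.measure_le_1[OF M.prob_space_distr[OF XV]])
    then show "emeasure (distr M ?V X) point_configs \<noteq> \<infinity>" by (auto simp: top_unique)
  qed
  show ?thesis
  proof (rule measure_eqI)
    fix B assume "B \<in> sets (distr M config_space X)"
    then have B: "B \<in> sets config_space" by simp
    have "B \<inter> simple_configs \<in> sets (restrict_space ?V simple_configs)"
      using measurable_sets[OF measurable_id_void_events B]
      by (simp add: space_restrict_space space_measure_of_conv simple_configs_def Int_def vimage_def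
          conj_ac)
    then obtain B' where B': "B' \<in> sets ?V" "B \<inter> simple_configs = simple_configs \<inter> B'"
      unfolding sets_restrict_space by auto
    have *: "emeasure (distr L config_space Z) B = emeasure (distr L ?V Z) B'"
      if Z: "Z \<in> measurable L config_space" and s: "AE \<omega> in L. Z \<omega> \<in> simple_configs"
      for L and Z :: "'x \<Rightarrow> 'a measure"
    proof -
      have ZV: "Z \<in> measurable L ?V" using measurable_compose[OF Z idV] by simp
      have "emeasure L (Z -` B \<inter> space L) = emeasure L (Z -` B' \<inter> space L)"
      proof (rule emeasure_eq_AE)
        show "AE \<omega> in L. \<omega> \<in> Z -` B \<inter> space L \<longleftrightarrow> \<omega> \<in> Z -` B' \<inter> space L"
          using s B'(2) by (auto elim!: eventually_mono)
      qed (use measurable_sets[OF Z B] measurable_sets[OF ZV B'(1)] in auto)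
      then show ?thesis by (simp add: emeasure_distr[OF Z B] emeasure_distr[OF ZV B'(1)])
    qed
    show "emeasure (distr M config_space X) B = emeasure (distr N config_space Y) B"
      using *[OF X simple(1)] *[OF Y simple(2)] V_eq by simp
  qed simp
qed

text \<open>
  The first moment of the whole space shows that the number of points of \<open>X\<close> is almost surely
  finite, so simplicity is the only path property of \<open>X\<close> to be assumed.
\<close>

theorem law_eq_of_same_moments_simple:
  fixes X :: "'w \<Rightarrow> 'a::{second_countable_topology,t1_space} measure"
  assumes "point_process M X" "simple_process M X" "point_process N Y" "same_moments M X N Y"
    and simple: "AE \<omega> in N. Y \<omega> \<in> simple_configs"
    and fin: "(\<integral>\<^sup>+ \<omega>. total_power (Y \<omega>) \<partial>N) < \<infinity>"
  shows "distr M config_space X = distr N config_space Y"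
proof (rule law_eq_of_same_moments[OF _ _ assms(4) _ _ _ simple fin])
  show M: "prob_space M" and N: "prob_space N"
    and X: "X \<in> measurable M config_space" and Y: "Y \<in> measurable N config_space"
    using assms(1,3) by (auto simp: point_process_def)
  have "disjoint_family_on (\<lambda>_. UNIV :: 'a set) {..<1::nat}" by (simp add: disjoint_family_on_def)
  then have "(\<integral>\<^sup>+ \<omega>. (\<Prod>i<1::nat. emeasure (X \<omega>) UNIV) \<partial>M) = (\<integral>\<^sup>+ \<omega>. (\<Prod>i<1::nat. emeasure (Y \<omega>) UNIV) \<partial>N)"
    using assms(4)[unfolded same_moments_def, THEN spec, of 1, THEN mp, THEN spec, of "\<lambda>_. UNIV"] by simp
  also have "\<dots> \<le> (\<integral>\<^sup>+ \<omega>. total_power (Y \<omega>) \<partial>N)"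
  proof (rule nn_integral_mono_AE)
    show "AE \<omega> in N. (\<Prod>i<1::nat. emeasure (Y \<omega>) UNIV) \<le> total_power (Y \<omega>)"
      using simple
    proof eventually_elim
      case (elim \<omega>)
      then have "emeasure (Y \<omega>) UNIV = of_nat (point_count (Y \<omega>) UNIV)"
        by (intro emeasure_point_count) (auto simp: simple_configs_def)
      then show ?case
        using less_exp[of "point_count (Y \<omega>) UNIV"]
        by (simp add: total_power_def of_nat_le_ennreal_iff del: of_nat_power)
    qed
  qed
  also note fin
  finally have "(\<integral>\<^sup>+ \<omega>. emeasure (X \<omega>) UNIV \<partial>M) \<noteq> \<infinity>" by simp
  then have "AE \<omega> in M. emeasure (X \<omega>) UNIV \<noteq> \<infinity>"
    by (intro nn_integral_noteq_infinite borel_measurable_config_emeasure[OF X]) auto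
  then show "AE \<omega> in M. X \<omega> \<in> simple_configs"
    using assms(2) AE_space unfolding simple_process_def
  proof eventually_elim
    case (elim \<omega>)
    then show ?case using measurable_space[OF X elim(3)]
      by (simp add: simple_configs_def less_top)
  qed
qed

section \<open>Intensities of determinantal processes\<close>

locale orthonormal_system =
  fixes \<mu> :: "'a::{second_countable_topology,t2_space} measure"
    and J :: "nat set" and \<phi> :: "nat \<Rightarrow> 'a \<Rightarrow> complex"
  assumes sigma_finite: "sigma_finite_measure \<mu>"
    and sets_\<mu>: "sets \<mu> = sets borel"
    and orthonormal: "orthonormal_L2 \<mu> J \<phi>"
begin

abbreviation power_space :: "nat set \<Rightarrow> (nat \<Rightarrow> 'a) measure" where
  "power_space A \<equiv> \<Pi>\<^sub>M i\<in>A. \<mu>"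

lemma product: "product_sigma_finite (\<lambda>_::nat. \<mu>)"
  using sigma_finite by (simp add: product_sigma_finite_def)

lemma borel_measurable_\<phi>: "s \<in> J \<Longrightarrow> \<phi> s \<in> borel_measurable \<mu>"
  using orthonormal by (simp add: orthonormal_L2_def)

lemma integrable_\<phi>_square: "s \<in> J \<Longrightarrow> integrable \<mu> (\<lambda>x. (cmod (\<phi> s x))\<^sup>2)"
  using orthonormal by (simp add: orthonormal_L2_def)

lemma integral_\<phi>_square: "s \<in> J \<Longrightarrow> (\<integral>x. (cmod (\<phi> s x))\<^sup>2 \<partial>\<mu>) = 1"
proof -
  assume s: "s \<in> J"
  have "complex_of_real (\<integral>x. (cmod (\<phi> s x))\<^sup>2 \<partial>\<mu>) = (\<integral>x. complex_of_real ((cmod (\<phi> s x))\<^sup>2) \<partial>\<mu>)"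
    by (rule integral_complex_of_real[symmetric])
  also have "\<dots> = (\<integral>x. \<phi> s x * cnj (\<phi> s x) \<partial>\<mu>)"
    by (simp only: complex_norm_square)
  also have "\<dots> = 1" using orthonormal s by (simp add: orthonormal_L2_def)
  finally show ?thesis by (simp only: of_real_eq_1_iff)
qed

lemma borel_measurable_component:
  assumes "s \<in> J" "i \<in> A"
  shows "(\<lambda>x. \<phi> s (x i)) \<in> borel_measurable (power_space A)"
  using measurable_compose[OF measurable_component_singleton[OF assms(2)] borel_measurable_\<phi>[OF assms(1)]] .

lemma borel_measurable_slater:
  assumes "g \<in> A \<rightarrow> J"
  shows "slater \<phi> A g \<in> borel_measurable (power_space A)"
proof -
  have "(\<lambda>x. \<Sum>\<sigma> | \<sigma> permutes A. of_int (sign \<sigma>) * (\<Prod>i\<in>A. \<phi> (g (\<sigma> i)) (x i))) \<in> borel_measurable (power_space A)"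
    using assms by (intro borel_measurable_sum borel_measurable_times borel_measurable_const
        borel_measurable_prod borel_measurable_component) (auto simp: permutes_in_image Pi_iff)
  then show ?thesis unfolding slater_def[abs_def] .
qed

lemma borel_measurable_slater_square:
  assumes "g \<in> A \<rightarrow> J"
  shows "(\<lambda>x. (cmod (slater \<phi> A g x))\<^sup>2) \<in> borel_measurable (power_space A)"
  by (intro borel_measurable_power measurable_compose[OF _ borel_measurable_norm]
      borel_measurable_slater assms)

lemma borel_measurable_indicator_component:
  assumes "B \<in> sets borel" "i \<in> A"
  shows "(\<lambda>x. indicator B (x i)) \<in> borel_measurable (power_space A)"
  using assms(1) sets_\<mu>
  by (intro measurable_compose[OF measurable_component_singleton[OF assms(2)] borel_measurable_indicator]) simp

lemma borel_measurable_finite_intensity: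
  assumes "S \<subseteq> J"
  shows "finite_intensity S \<phi> c k \<in> borel_measurable (power_space {..<k})"
proof -
  have "(\<lambda>x. (cmod (slater \<phi> {..<k} g x))\<^sup>2) \<in> borel_measurable (power_space {..<k})"
    if "g \<in> {..<k} \<rightarrow>\<^sub>E S" for g
    using that assms by (intro borel_measurable_slater_square) auto
  then show ?thesis unfolding finite_intensity_def[abs_def]
    by (intro borel_measurable_divide borel_measurable_sum borel_measurable_times borel_measurable_const)
qed

lemma borel_measurable_intensity:
  assumes "\<forall>s\<in>J. 0 \<le> c s"
  shows "intensity J \<phi> c k \<in> borel_measurable (power_space {..<k})"
proof (rule borel_measurable_LIMSEQ_order)
  show "(\<lambda>n. ennreal (finite_intensity (J \<inter> {..<n}) \<phi> c k x)) \<longlonglongrightarrow> intensity J \<phi> c k x" for x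
    by (rule finite_intensity_tendsto[OF assms])
  show "(\<lambda>x. ennreal (finite_intensity (J \<inter> {..<n}) \<phi> c k x)) \<in> borel_measurable (power_space {..<k})" for n
    using measurable_compose[OF borel_measurable_finite_intensity[of "J \<inter> {..<n}" c k] measurable_ennreal] by simp
qed

lemma AE_power_space:
  assumes "AE x in \<mu>. P x" "finite A"
  shows "AE x in power_space A. \<forall>i\<in>A. P (x i)"
proof (rule AE_finite_allI[OF assms(2)])
  fix i assume i: "i \<in> A"
  interpret product_sigma_finite "\<lambda>_::nat. \<mu>" by (rule product)
  \<comment> \<open>Points whose \<open>i\<close>-th coordinate is exceptional form a product set with one factor of measure 0;
    in \<open>[0,\<infinity>]\<close> the product of the measures of its factors is 0 even if \<open>\<mu>\<close> is infinite.\<close>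
  obtain N where N: "N \<in> sets \<mu>" "emeasure \<mu> N = 0" "{x\<in>space \<mu>. \<not> P x} \<subseteq> N"
    using assms(1) by (auto simp: eventually_ae_filter null_sets_def)
  let ?E = "\<Pi>\<^sub>E j\<in>A. if j = i then N else space \<mu>"
  have "emeasure (power_space A) ?E = (\<Prod>j\<in>A. emeasure \<mu> (if j = i then N else space \<mu>))"
    using N(1) by (intro emeasure_PiM assms(2)) auto
  also have "\<dots> = 0" using i N(2) by (intro prod_zero[OF assms(2)] bexI[of _ i]) auto
  finally have e0: "emeasure (power_space A) ?E = 0" .
  show "AE x in power_space A. P (x i)"
  proof (rule AE_I[OF _ e0])
    show "{x\<in>space (power_space A). \<not> P (x i)} \<subseteq> ?E"
      using N(3) i by (auto simp: space_PiM PiE_iff subset_eq)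
    show "?E \<in> sets (power_space A)"
      using N(1) assms(2) by (intro sets_PiM_I_finite) auto
  qed
qed

text \<open>
  The integral of \<open>\<Sum>\<^sub>s c\<^sub>s |\<phi>\<^sub>s|\<^sup>2\<close> is \<open>\<Sum>\<^sub>s c\<^sub>s < \<infinity>\<close>.
\<close>

lemma AE_diagonal_summable:
  assumes c: "\<forall>s\<in>J. 0 \<le> c s" "c summable_on J"
  shows "AE x in \<mu>. (\<lambda>s. c s * (cmod (\<phi> s x))\<^sup>2) summable_on J"
proof -
  let ?f = "\<lambda>x s. if s \<in> J then c s * (cmod (\<phi> s x))\<^sup>2 else 0"
  have nonneg: "0 \<le> ?f x s" for x s using c(1) by auto
  have meas: "(\<lambda>x. ennreal (?f x s)) \<in> borel_measurable \<mu>" for s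
    by (cases "s \<in> J") (auto intro!: borel_measurable_times borel_measurable_power
        measurable_compose[OF _ borel_measurable_norm] borel_measurable_\<phi> measurable_compose[OF _ measurable_ennreal])
  have int: "(\<integral>\<^sup>+ x. ennreal (?f x s) \<partial>\<mu>) = ennreal (if s \<in> J then c s else 0)" for s
  proof (cases "s \<in> J")
    case True
    have "(\<integral>\<^sup>+ x. ennreal (c s * (cmod (\<phi> s x))\<^sup>2) \<partial>\<mu>) = ennreal (\<integral>x. c s * (cmod (\<phi> s x))\<^sup>2 \<partial>\<mu>)"
      using True c(1) by (intro nn_integral_eq_integral integrable_mult_right integrable_\<phi>_square) auto
    then show ?thesis using True by (simp add: integral_\<phi>_square)
  qed simp
  have sc: "summable (\<lambda>s. if s \<in> J then c s else 0)"
  proof -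
    have "(\<lambda>s. if s \<in> J then c s else 0) summable_on UNIV"
      using c(2) by (rule summable_on_cong_neutral[THEN iffD1, rotated -1]) auto
    then show ?thesis by (rule summable_on_imp_summable)
  qed
  have "(\<integral>\<^sup>+ x. (\<Sum>s. ennreal (?f x s)) \<partial>\<mu>) = (\<Sum>s. ennreal (if s \<in> J then c s else 0))"
    by (subst nn_integral_suminf[OF meas]) (simp only: int)
  also have "\<dots> = ennreal (\<Sum>s. if s \<in> J then c s else 0)"
    using c(1) sc by (intro suminf_ennreal2) auto
  also have "\<dots> \<noteq> \<infinity>" by simp
  finally have "AE x in \<mu>. (\<Sum>s. ennreal (?f x s)) \<noteq> \<infinity>"
    by (intro nn_integral_noteq_infinite borel_measurable_suminf_order meas)
  then show ?thesis
  proof eventually_elim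
    case (elim x)
    then have "summable (?f x)"
      using nonneg by (intro summable_suminf_not_top) auto
    then have "?f x summable_on UNIV"
      using nonneg by (simp add: summable_on_UNIV_nonneg_real_iff)
    then show ?case
      by (rule summable_on_cong_neutral[THEN iffD1, rotated -1]) auto
  qed
qed

lemma spectral_kernel_tendsto:
  assumes c: "\<forall>s\<in>J. 0 \<le> c s"
    and "(\<lambda>s. c s * (cmod (\<phi> s x))\<^sup>2) summable_on J" "(\<lambda>s. c s * (cmod (\<phi> s y))\<^sup>2) summable_on J"
  shows "(\<lambda>n. \<Sum>s\<in>J \<inter> {..<n}. complex_of_real (c s) * \<phi> s x * cnj (\<phi> s y))
    \<longlonglongrightarrow> spectral_kernel J c \<phi> x y"
proof -
  let ?t = "\<lambda>s. complex_of_real (c s) * \<phi> s x * cnj (\<phi> s y)"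
  have "(\<lambda>s. c s * (cmod (\<phi> s x))\<^sup>2 + c s * (cmod (\<phi> s y))\<^sup>2) summable_on J"
    by (intro summable_on_add assms)
  then have "(\<lambda>s. norm (?t s)) summable_on J"
  proof (rule summable_on_comparison_test)
    fix s assume s: "s \<in> J"
    have "0 \<le> (cmod (\<phi> s x) - cmod (\<phi> s y))\<^sup>2 + (cmod (\<phi> s x))\<^sup>2 + (cmod (\<phi> s y))\<^sup>2" by simp
    then have "cmod (\<phi> s x) * cmod (\<phi> s y) \<le> (cmod (\<phi> s x))\<^sup>2 + (cmod (\<phi> s y))\<^sup>2"
      by (simp add: power2_eq_square algebra_simps)
    then have "c s * (cmod (\<phi> s x) * cmod (\<phi> s y)) \<le> c s * ((cmod (\<phi> s x))\<^sup>2 + (cmod (\<phi> s y))\<^sup>2)"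
      using c[rule_format, OF s] by (rule mult_left_mono)
    then show "norm (?t s) \<le> c s * (cmod (\<phi> s x))\<^sup>2 + c s * (cmod (\<phi> s y))\<^sup>2"
      using c[rule_format, OF s] by (simp add: norm_mult distrib_left mult.assoc)
  qed simp
  then have "?t summable_on J" by (rule abs_summable_summable)
  then have "(?t has_sum spectral_kernel J c \<phi> x y) J"
    unfolding spectral_kernel_def by (rule has_sum_infsum)
  then have "((\<lambda>s. if s \<in> J then ?t s else 0) has_sum spectral_kernel J c \<phi> x y) UNIV"
    by (rule has_sum_cong_neutral[THEN iffD1, rotated -1]) auto
  then have "(\<lambda>n. \<Sum>s<n. if s \<in> J then ?t s else 0) \<longlonglongrightarrow> spectral_kernel J c \<phi> x y"
    using has_sum_imp_sums sums_def by blast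
  moreover have "(\<Sum>s<n. if s \<in> J then ?t s else 0) = (\<Sum>s\<in>J \<inter> {..<n}. ?t s)" for n
    by (simp add: sum.inter_restrict[symmetric] Int_commute)
  ultimately show ?thesis by simp
qed

text \<open>
  For finite truncations of \<open>J\<close> the determinant and the intensity agree by Cauchy--Binet. The
  determinants converge because the kernel entries do, the intensities because their terms are
  nonnegative; a limit of nonnegative reals is a nonnegative real.
\<close>

lemma det_spectral_kernel:
  assumes c: "\<forall>s\<in>J. 0 \<le> c s"
    and x: "\<And>i. i < k \<Longrightarrow> (\<lambda>s. c s * (cmod (\<phi> s (x i)))\<^sup>2) summable_on J"
  shows "\<exists>r\<ge>0. Determinant.det (mat k k (\<lambda>(i, j). spectral_kernel J c \<phi> (x i) (x j))) = complex_of_real r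
    \<and> intensity J \<phi> c k x = ennreal r"
proof -
  let ?K = "\<lambda>n. mat k k (\<lambda>(i, j). \<Sum>s\<in>J \<inter> {..<n}. complex_of_real (c s) * \<phi> s (x i) * cnj (\<phi> s (x j)))"
  let ?D = "Determinant.det (mat k k (\<lambda>(i, j). spectral_kernel J c \<phi> (x i) (x j)))"
  have "(\<lambda>n. Determinant.det (?K n)) \<longlonglongrightarrow> ?D"
    unfolding det_def'[OF mat_carrier]
  proof (intro tendsto_sum tendsto_mult tendsto_const tendsto_prod)
    fix p i assume "p \<in> {p. p permutes {0..<k}}" "i \<in> {0..<k}"
    then have "i < k" "p i < k" using permutes_in_image by fastforce+
    then show "(\<lambda>n. ?K n $$ (i, p i)) \<longlonglongrightarrow> mat k k (\<lambda>(i, j). spectral_kernel J c \<phi> (x i) (x j)) $$ (i, p i)"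
      using spectral_kernel_tendsto[OF c x x] by simp
  qed
  then have "(\<lambda>n. complex_of_real (finite_intensity (J \<inter> {..<n}) \<phi> c k x)) \<longlonglongrightarrow> ?D"
    unfolding finite_intensity_def by (simp add: Cauchy_Binet_kernel del: of_real_divide of_real_sum)
  then have re: "(\<lambda>n. finite_intensity (J \<inter> {..<n}) \<phi> c k x) \<longlonglongrightarrow> Re ?D"
    and im: "(\<lambda>n. 0) \<longlonglongrightarrow> Im ?D"
    using tendsto_Re tendsto_Im by (fastforce, fastforce)
  have "Im ?D = 0" using LIMSEQ_unique[OF im tendsto_const] by simp
  then have D: "?D = complex_of_real (Re ?D)" by (simp add: complex_eq_iff)
  have "0 \<le> finite_intensity (J \<inter> {..<n}) \<phi> c k x" for n
    unfolding finite_intensity_def using c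
    by (intro divide_nonneg_nonneg sum_nonneg mult_nonneg_nonneg prod_nonneg) (auto simp: PiE_iff)
  then have "0 \<le> Re ?D" by (intro LIMSEQ_le_const[OF re]) auto
  moreover have "intensity J \<phi> c k x = ennreal (Re ?D)"
    by (rule LIMSEQ_unique[OF finite_intensity_tendsto[OF c] tendsto_ennrealI[OF re]])
  ultimately show ?thesis using D by blast
qed

lemma AE_det_spectral_kernel:
  assumes c: "\<forall>s\<in>J. 0 \<le> c s" "c summable_on J"
  shows "AE x in power_space {..<k}. intensity J \<phi> c k x < \<infinity> \<and>
    Determinant.det (mat k k (\<lambda>(i, j). spectral_kernel J c \<phi> (x i) (x j)))
      = complex_of_real (enn2real (intensity J \<phi> c k x))"
  using AE_power_space[OF AE_diagonal_summable[OF c] finite_lessThan, of k]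
proof eventually_elim
  case (elim x)
  then show ?case using det_spectral_kernel[OF c(1), of k x] by auto
qed

text \<open>
  Outside a null set the determinant in the definition of a determinantal process is the
  intensity, whatever version of the joint intensities was chosen.
\<close>

lemma determinantal_process_moments:
  assumes c: "\<forall>s\<in>J. 0 \<le> c s" "c summable_on J"
    and X: "determinantal_process M X \<mu> (spectral_kernel J c \<phi>)"
    and D: "k \<ge> 1" "\<And>i. i < k \<Longrightarrow> D i \<in> sets borel" "disjoint_family_on D {..<k}"
  shows "(\<integral>\<^sup>+ \<omega>. (\<Prod>i<k. emeasure (X \<omega>) (D i)) \<partial>M)
    = set_nn_integral (power_space {..<k}) (\<Pi>\<^sub>E i\<in>{..<k}. D i) (intensity J \<phi> c k)"
proof -
  obtain \<rho> where \<rho>: "joint_intensities M X \<mu> \<rho>"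
    and det: "AE x in power_space {..<k}.
        complex_of_real (\<rho> k x) = Determinant.det (mat k k (\<lambda>(i, j). spectral_kernel J c \<phi> (x i) (x j)))"
    using X D(1) unfolding determinantal_process_def by blast
  have "(\<integral>\<^sup>+ \<omega>. (\<Prod>i<k. emeasure (X \<omega>) (D i)) \<partial>M)
      = set_nn_integral (power_space {..<k}) (\<Pi>\<^sub>E i\<in>{..<k}. D i) (\<lambda>x. ennreal (\<rho> k x))"
    using \<rho> D unfolding joint_intensities_def by auto
  also have "\<dots> = set_nn_integral (power_space {..<k}) (\<Pi>\<^sub>E i\<in>{..<k}. D i) (intensity J \<phi> c k)"
  proof (rule nn_integral_cong_AE)
    show "AE x in power_space {..<k}. ennreal (\<rho> k x) * indicator (\<Pi>\<^sub>E i\<in>{..<k}. D i) x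
        = intensity J \<phi> c k x * indicator (\<Pi>\<^sub>E i\<in>{..<k}. D i) x"
      using det AE_det_spectral_kernel[OF c, of k]
    proof eventually_elim
      case (elim x)
      then have "complex_of_real (\<rho> k x) = complex_of_real (enn2real (intensity J \<phi> c k x))" by simp
      then have "\<rho> k x = enn2real (intensity J \<phi> c k x)" by (simp only: of_real_eq_iff)
      then show ?case using elim by simp
    qed
  qed
  finally show ?thesis .
qed

end

section \<open>Determinantal processes of finite-rank projections\<close>

text \<open>
  The sum of the Dirac measures at the points \<open>x s\<close>, \<open>s \<in> S\<close>, counted with multiplicity.
\<close>

definition points :: "nat set \<Rightarrow> (nat \<Rightarrow> 'a::topological_space) \<Rightarrow> 'a measure" where
  "points S x = distr (count_space S) borel x"

lemma emeasure_points:
  assumes "finite S" "A \<in> sets borel"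
  shows "emeasure (points S x) A = (\<Sum>s\<in>S. indicator A (x s))"
proof -
  have "emeasure (points S x) A = emeasure (count_space S) (x -` A \<inter> S)"
    unfolding points_def using assms(2) by (subst emeasure_distr) auto
  also have "\<dots> = of_nat (card (x -` A \<inter> S))"
    using assms(1) by (simp add: emeasure_count_space)
  also have "\<dots> = (\<Sum>s\<in>S. indicator A (x s))"
    using assms(1) by (simp add: indicator_def sum.If_cases Int_def vimage_def conj_commute)
  finally show ?thesis .
qed

lemma emeasure_points_nat:
  assumes "finite S" "A \<in> sets borel"
  shows "emeasure (points S x) A = of_nat (card {s\<in>S. x s \<in> A})"
proof -
  have "(\<Sum>s\<in>S. indicator A (x s) :: ennreal) = (\<Sum>s\<in>S. of_nat (if x s \<in> A then 1 else 0))"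
    by (intro sum.cong) auto
  also have "\<dots> = of_nat (card {s\<in>S. x s \<in> A})"
    using assms(1) by (simp only: of_nat_sum[symmetric] sum.If_cases) (simp add: Int_def)
  finally show ?thesis using emeasure_points[OF assms] by simp
qed

lemma sets_points [simp]: "sets (points S x) = sets borel"
  by (simp add: points_def)

lemma points_in_point_configs:
  assumes "finite S"
  shows "points S (x :: nat \<Rightarrow> 'a::t2_space) \<in> point_configs"
proof -
  have "emeasure (points S x) C < \<infinity>" if "compact C" for C
    using emeasure_points_nat[OF assms borel_closed[OF compact_imp_closed[OF that]], of x]
    by (simp add: of_nat_less_top)
  then show ?thesis
    using emeasure_points_nat[OF assms, of _ x] by (simp add: point_configs_def radon_measure_def)
qed

lemma points_in_simple_configs:
  assumes "finite S" "inj_on x S"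
  shows "points S (x :: nat \<Rightarrow> 'a::t2_space) \<in> simple_configs"
proof -
  have "card {s\<in>S. x s = y} \<le> 1" for y
  proof -
    have "\<forall>s\<in>{s\<in>S. x s = y}. \<forall>t\<in>{s\<in>S. x s = y}. s = t"
      using assms(2) by (auto simp: inj_on_def)
    then show ?thesis using card_le_Suc0_iff_eq[of "{s\<in>S. x s = y}"] assms(1) by simp
  qed
  then have "emeasure (points S x) {y} \<le> 1" for y
    using emeasure_points_nat[OF assms(1), of "{y}" x] of_nat_le_ennreal_iff[of _ 1]
    by (simp add: borel_closed)
  moreover have "emeasure (points S x) UNIV < \<infinity>"
    using emeasure_points_nat[OF assms(1), of UNIV x] by (simp add: of_nat_less_top)
  ultimately show ?thesis
    using points_in_point_configs[OF assms(1)] by (simp add: simple_configs_def)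
qed

context orthonormal_system
begin

text \<open>
  The Gram matrix of the functions \<open>\<phi>\<^sub>s\<close> restricted to \<open>B\<close>.
\<close>

definition overlap :: "'a set \<Rightarrow> nat \<Rightarrow> nat \<Rightarrow> complex" where
  "overlap B s t = (\<integral>x. indicator B x *\<^sub>R (\<phi> s x * cnj (\<phi> t x)) \<partial>\<mu>)"

lemma integrable_overlap:
  assumes "s \<in> J" "t \<in> J" "B \<in> sets borel"
  shows "integrable \<mu> (\<lambda>x. indicator B x *\<^sub>R (\<phi> s x * cnj (\<phi> t x)))"
proof (rule Bochner_Integration.integrable_bound)
  show "integrable \<mu> (\<lambda>x. (cmod (\<phi> s x))\<^sup>2 + (cmod (\<phi> t x))\<^sup>2)"
    using assms by (intro Bochner_Integration.integrable_add integrable_\<phi>_square)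
  have [measurable]: "\<phi> s \<in> borel_measurable \<mu>" "\<phi> t \<in> borel_measurable \<mu>" "B \<in> sets \<mu>"
    using assms borel_measurable_\<phi> sets_\<mu> by auto
  have "(\<lambda>x. cnj (\<phi> t x)) \<in> borel_measurable \<mu>"
    by (rule borel_measurable_continuous_on[OF continuous_on_cnj]) (auto intro: continuous_on_id)
  note [measurable] = this
  show "(\<lambda>x. indicator B x *\<^sub>R (\<phi> s x * cnj (\<phi> t x))) \<in> borel_measurable \<mu>"
    by measurable
  show "AE x in \<mu>. norm (indicator B x *\<^sub>R (\<phi> s x * cnj (\<phi> t x)))
      \<le> norm ((cmod (\<phi> s x))\<^sup>2 + (cmod (\<phi> t x))\<^sup>2)"
  proof (rule AE_I2)
    fix x
    have "0 \<le> (cmod (\<phi> s x) - cmod (\<phi> t x))\<^sup>2 + (cmod (\<phi> s x))\<^sup>2 + (cmod (\<phi> t x))\<^sup>2" by simp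
    then have "cmod (\<phi> s x) * cmod (\<phi> t x) \<le> (cmod (\<phi> s x))\<^sup>2 + (cmod (\<phi> t x))\<^sup>2"
      by (simp add: power2_eq_square algebra_simps)
    then show "norm (indicator B x *\<^sub>R (\<phi> s x * cnj (\<phi> t x))) \<le> norm ((cmod (\<phi> s x))\<^sup>2 + (cmod (\<phi> t x))\<^sup>2)"
      by (auto simp: norm_mult indicator_def)
  qed
qed

lemma overlap_UNIV:
  assumes "s \<in> J" "t \<in> J"
  shows "overlap UNIV s t = of_bool (s = t)"
  using orthonormal assms by (simp add: overlap_def orthonormal_L2_def)

text \<open>
  Both Leibniz sums are expanded and integrated coordinate by coordinate. The value is stated as a
  complex equation for a nonnegative real because the individual terms are complex, whereas the
  integral is needed as an extended nonnegative real.
\<close>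

lemma slater_square_integral:
  assumes A: "finite A" and g: "g \<in> A \<rightarrow> J" and B: "\<And>i. i \<in> A \<Longrightarrow> B i \<in> sets borel"
  shows "\<exists>r\<ge>0. (\<integral>\<^sup>+ x. ennreal ((cmod (slater \<phi> A g x))\<^sup>2 * (\<Prod>i\<in>A. indicator (B i) (x i))) \<partial>power_space A) = ennreal r
    \<and> complex_of_real r = (\<Sum>\<sigma> | \<sigma> permutes A. \<Sum>\<tau> | \<tau> permutes A.
        of_int (sign \<sigma> * sign \<tau>) * (\<Prod>i\<in>A. overlap (B i) (g (\<sigma> i)) (g (\<tau> i))))"
proof -
  interpret product_sigma_finite "\<lambda>_::nat. \<mu>" by (rule product)
  let ?w = "\<lambda>x. \<Prod>i\<in>A. indicator (B i) (x i) :: real"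
  let ?f = "\<lambda>x. (cmod (slater \<phi> A g x))\<^sup>2 * ?w x"
  let ?t = "\<lambda>\<sigma> \<tau> i y. indicator (B i) y *\<^sub>R (\<phi> (g (\<sigma> i)) y * cnj (\<phi> (g (\<tau> i)) y))"
  let ?P = "{\<sigma>. \<sigma> permutes A}"
  have int: "integrable \<mu> (?t \<sigma> \<tau> i)" if "\<sigma> \<in> ?P" "\<tau> \<in> ?P" "i \<in> A" for \<sigma> \<tau> i
    using that g B by (intro integrable_overlap) (auto simp: permutes_in_image Pi_iff)
  have expand: "complex_of_real (?f x) =
      (\<Sum>\<sigma>\<in>?P. \<Sum>\<tau>\<in>?P. of_int (sign \<sigma> * sign \<tau>) * (\<Prod>i\<in>A. ?t \<sigma> \<tau> i (x i)))" for x
  proof -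
    have "complex_of_real (?f x) = slater \<phi> A g x * cnj (slater \<phi> A g x) * complex_of_real (?w x)"
      by (simp only: of_real_mult complex_norm_square)
    also have "\<dots> = (\<Sum>\<sigma>\<in>?P. \<Sum>\<tau>\<in>?P. of_int (sign \<sigma>) * (\<Prod>i\<in>A. \<phi> (g (\<sigma> i)) (x i)) *
        (of_int (sign \<tau>) * (\<Prod>i\<in>A. cnj (\<phi> (g (\<tau> i)) (x i)))) * complex_of_real (?w x))"
      unfolding slater_def cnj_sum complex_cnj_mult complex_cnj_of_int cnj_prod
      unfolding sum_product unfolding sum_distrib_right by (rule refl)
    also have "\<dots> = (\<Sum>\<sigma>\<in>?P. \<Sum>\<tau>\<in>?P. of_int (sign \<sigma> * sign \<tau>) * (\<Prod>i\<in>A. ?t \<sigma> \<tau> i (x i)))"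
      by (intro sum.cong refl) (simp add: scaleR_conv_of_real prod.distrib mult_ac)
    finally show ?thesis .
  qed
  have int_prod: "integrable (power_space A) (\<lambda>x. \<Prod>i\<in>A. ?t \<sigma> \<tau> i (x i))" if "\<sigma> \<in> ?P" "\<tau> \<in> ?P" for \<sigma> \<tau>
    using that int by (intro product_integrable_prod[OF A])
  have int_f: "integrable (power_space A) (\<lambda>x. complex_of_real (?f x))"
    unfolding expand using int_prod
    by (intro Bochner_Integration.integrable_sum Bochner_Integration.integrable_mult_right)
  then have int_fr: "integrable (power_space A) ?f"
    by (simp only: complex_of_real_integrable_eq)
  have nonneg: "0 \<le> ?f x" for x
    by (intro mult_nonneg_nonneg prod_nonneg) auto
  have "complex_of_real (\<integral>x. ?f x \<partial>power_space A) = (\<integral>x. complex_of_real (?f x) \<partial>power_space A)"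
    by (rule integral_complex_of_real[symmetric])
  also have "\<dots> = (\<Sum>\<sigma>\<in>?P. \<Sum>\<tau>\<in>?P. \<integral>x. of_int (sign \<sigma> * sign \<tau>) * (\<Prod>i\<in>A. ?t \<sigma> \<tau> i (x i)) \<partial>power_space A)"
  proof -
    have "(\<integral>x. complex_of_real (?f x) \<partial>power_space A) =
       (\<integral>x. (\<Sum>p\<in>?P \<times> ?P. of_int (sign (fst p) * sign (snd p)) * (\<Prod>i\<in>A. ?t (fst p) (snd p) i (x i))) \<partial>power_space A)"
      unfolding expand by (simp add: sum.cartesian_product case_prod_beta)
    also have "\<dots> = (\<Sum>p\<in>?P \<times> ?P. \<integral>x. of_int (sign (fst p) * sign (snd p)) * (\<Prod>i\<in>A. ?t (fst p) (snd p) i (x i)) \<partial>power_space A)"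
      using int_prod
      by (intro Bochner_Integration.integral_sum Bochner_Integration.integrable_mult_right) auto
    finally show ?thesis by (simp add: sum.cartesian_product case_prod_beta)
  qed
  also have "\<dots> = (\<Sum>\<sigma>\<in>?P. \<Sum>\<tau>\<in>?P. of_int (sign \<sigma> * sign \<tau>) * (\<Prod>i\<in>A. overlap (B i) (g (\<sigma> i)) (g (\<tau> i))))"
  proof (intro sum.cong refl)
    fix \<sigma> \<tau> assume "\<sigma> \<in> ?P" "\<tau> \<in> ?P"
    then show "(\<integral>x. of_int (sign \<sigma> * sign \<tau>) * (\<Prod>i\<in>A. ?t \<sigma> \<tau> i (x i)) \<partial>power_space A)
        = of_int (sign \<sigma> * sign \<tau>) * (\<Prod>i\<in>A. overlap (B i) (g (\<sigma> i)) (g (\<tau> i)))"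
      unfolding integral_mult_right_zero overlap_def by (subst product_integral_prod[OF A int]) auto
  qed
  finally have "complex_of_real (\<integral>x. ?f x \<partial>power_space A) = \<dots>" .
  moreover have "(\<integral>\<^sup>+ x. ennreal (?f x) \<partial>power_space A) = ennreal (\<integral>x. ?f x \<partial>power_space A)"
    using nonneg by (intro nn_integral_eq_integral[OF int_fr] AE_I2)
  moreover have "0 \<le> (\<integral>x. ?f x \<partial>power_space A)"
    using nonneg by (intro Bochner_Integration.integral_nonneg)
  ultimately show ?thesis by blast
qed

definition projection_density :: "nat set \<Rightarrow> (nat \<Rightarrow> 'a) \<Rightarrow> ennreal" where
  "projection_density S x = ennreal ((cmod (slater \<phi> S id x))\<^sup>2 / fact (card S))"

text \<open>
  The determinantal process with kernel \<open>\<Sum>\<^sub>s \<phi>\<^sub>s(x) \<phi>\<^sub>s(y)\<^sup>*\<close>, \<open>s \<in> S\<close>: its points are labelled by \<open>S\<close> itself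
  and have a joint density proportional to the squared modulus of the Slater determinant.
\<close>

definition projection_law :: "nat set \<Rightarrow> 'a measure measure" where
  "projection_law S = distr (density (power_space S) (projection_density S)) config_space (points S)"

lemma borel_measurable_projection_density:
  assumes "S \<subseteq> J"
  shows "projection_density S \<in> borel_measurable (power_space S)"
  unfolding projection_density_def[abs_def]
  by (intro measurable_compose[OF _ measurable_ennreal] borel_measurable_divide
      borel_measurable_slater_square borel_measurable_const) (use assms in auto)

lemma measurable_points:
  assumes "finite S"
  shows "points S \<in> measurable (power_space S) config_space"
proof (rule measurable_config_spaceI)
  show "points S \<in> space (power_space S) \<rightarrow> (point_configs :: 'a measure set)"
    using points_in_point_configs[OF assms] by auto
  fix A :: "'a set" assume A: "A \<in> sets borel"
  show "(\<lambda>\<omega>. emeasure (points S \<omega>) A) \<in> borel_measurable (power_space S)"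
    unfolding emeasure_points[OF assms A]
    by (intro borel_measurable_sum borel_measurable_indicator_component[OF A])
qed

lemma measurable_points_density:
  assumes "finite S"
  shows "points S \<in> measurable (density (power_space S) (projection_density S)) config_space"
  using measurable_points[OF assms] by simp

lemma nn_integral_projection_law:
  assumes "finite S" "S \<subseteq> J" "f \<in> borel_measurable config_space"
  shows "(\<integral>\<^sup>+ \<xi>. f \<xi> \<partial>projection_law S)
    = (\<integral>\<^sup>+ x. projection_density S x * f (points S x) \<partial>power_space S)"
  unfolding projection_law_def
  using measurable_points[OF assms(1)] measurable_compose[OF measurable_points[OF assms(1)] assms(3)]
  by (simp add: nn_integral_distr assms(3) nn_integral_density borel_measurable_projection_density[OF assms(2)])

text \<open>
  Prescribing that point number \<open>f i\<close> lies in \<open>D i\<close> is a product condition on all coordinates when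
  the remaining points are allowed to lie anywhere.
\<close>

lemma slater_square_integral_injection:
  fixes k :: nat
  assumes S: "finite S" "S \<subseteq> J" and f: "f \<in> {..<k} \<rightarrow> S" "inj_on f {..<k}"
    and D: "\<And>i. i < k \<Longrightarrow> D i \<in> sets borel"
  shows "\<exists>r\<ge>0. (\<integral>\<^sup>+ x. ennreal ((cmod (slater \<phi> S id x))\<^sup>2 * (\<Prod>i<k. indicator (D i) (x (f i)))) \<partial>power_space S)
      = ennreal r
    \<and> complex_of_real r = (\<Sum>\<sigma> | \<sigma> permutes S. signed_product_sum (\<lambda>i. overlap (D i)) {..<k} (\<sigma> \<circ> f))"
proof -
  \<comment> \<open>Unconstrained points get the constraint set \<open>UNIV\<close>, where \<open>overlap\<close> is the identity matrix.\<close>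
  define B where "B s = (if s \<in> f ` {..<k} then D (inv_into {..<k} f s) else UNIV)" for s
  have Bf: "B (f i) = D i" if "i < k" for i
    using that f(2) by (simp add: B_def)
  have B: "B s \<in> sets borel" for s
  proof (cases "s \<in> f ` {..<k}")
    case True
    then show ?thesis using Bf D by auto
  qed (simp add: B_def)
  have ind: "(\<Prod>s\<in>S. indicator (B s) (x s) :: real) = (\<Prod>i<k. indicator (D i) (x (f i)))" for x
  proof -
    have "(\<Prod>s\<in>S. indicator (B s) (x s) :: real) = (\<Prod>s\<in>f ` {..<k}. indicator (B s) (x s))"
      using S(1) f(1) by (intro prod.mono_neutral_right) (auto simp: B_def)
    also have "\<dots> = (\<Prod>i<k. indicator (D i) (x (f i)))"
      using f(2) by (simp add: prod.reindex Bf)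
    finally show ?thesis .
  qed
  have "(\<Sum>\<sigma> | \<sigma> permutes S. \<Sum>\<tau> | \<tau> permutes S.
        of_int (sign \<sigma> * sign \<tau>) * (\<Prod>s\<in>S. overlap (B s) (\<sigma> s) (\<tau> s)))
    = (\<Sum>\<sigma> | \<sigma> permutes S. signed_product_sum (\<lambda>i. overlap (D i)) {..<k} (\<sigma> \<circ> f))"
  proof (rule double_signed_sum[OF S(1) finite_lessThan f(2)])
    show "f ` {..<k} \<subseteq> S" using f(1) by auto
    show "overlap (B (f i)) = overlap (D i)" if "i \<in> {..<k}" for i using that by (simp add: Bf)
    show "overlap (B s) t u = of_bool (t = u)" if "s \<in> S - f ` {..<k}" "t \<in> S" "u \<in> S" for s t u
      using that overlap_UNIV[OF subsetD[OF S(2) that(2)] subsetD[OF S(2) that(3)]] by (simp add: B_def)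
  qed
  moreover have "id \<in> S \<rightarrow> J" using S(2) by auto
  ultimately show ?thesis
    using slater_square_integral[OF S(1), of id B] B by (simp add: ind)
qed

text \<open>
  The case of no prescribed point, \<open>k = 0\<close>, of the previous computation: the integral of the squared
  modulus is the number of permutations of \<open>S\<close>.
\<close>

lemma prob_space_projection_density:
  assumes S: "finite S" "S \<subseteq> J"
  shows "prob_space (density (power_space S) (projection_density S))"
proof
  obtain r where r: "(\<integral>\<^sup>+ x. ennreal ((cmod (slater \<phi> S id x))\<^sup>2) \<partial>power_space S) = ennreal r"
    "complex_of_real r = (\<Sum>\<sigma> | \<sigma> permutes S. signed_product_sum (\<lambda>i. overlap UNIV) {..<0::nat} (\<sigma> \<circ> id))"
    using slater_square_integral_injection[OF S, of id 0 "\<lambda>_. UNIV"] by auto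
  have "signed_product_sum (\<lambda>i. overlap UNIV) {..<0::nat} h = 1" for h
    by (simp add: signed_product_sum_def)
  then have "complex_of_real r = complex_of_real (fact (card S))"
    using r(2) S(1) by (simp add: card_permutations)
  then have rf: "r = fact (card S)" by (simp only: of_real_eq_iff)
  have meas: "(\<lambda>x. ennreal ((cmod (slater \<phi> S id x))\<^sup>2)) \<in> borel_measurable (power_space S)"
    using S(2) by (intro measurable_compose[OF _ measurable_ennreal] borel_measurable_slater_square) auto
  have "emeasure (density (power_space S) (projection_density S)) (space (density (power_space S) (projection_density S)))
      = (\<integral>\<^sup>+ x. projection_density S x \<partial>power_space S)"
    using borel_measurable_projection_density[OF S(2)]
    by (simp add: emeasure_density cong: nn_integral_cong)
  also have "\<dots> = (\<integral>\<^sup>+ x. ennreal ((cmod (slater \<phi> S id x))\<^sup>2) / ennreal (fact (card S)) \<partial>power_space S)"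
    unfolding projection_density_def by (intro nn_integral_cong divide_ennreal[symmetric]) auto
  also have "\<dots> = ennreal (fact (card S)) / ennreal (fact (card S))"
    by (subst nn_integral_divide[OF meas]) (simp only: r(1) rf)
  also have "\<dots> = 1" by (simp add: divide_ennreal)
  finally show "emeasure (density (power_space S) (projection_density S))
      (space (density (power_space S) (projection_density S))) = 1" .
qed

lemma prob_space_projection_law:
  assumes "finite S" "S \<subseteq> J"
  shows "prob_space (projection_law S)"
  unfolding projection_law_def
  by (intro prob_space.prob_space_distr prob_space_projection_density measurable_points_density assms)

lemma sets_projection_law: "sets (projection_law S) = sets config_space"
  by (simp add: projection_law_def)

text \<open>
  The density vanishes whenever two points coincide.
\<close>

lemma AE_projection_law:
  assumes S: "finite S" "S \<subseteq> J" and P: "{\<xi>\<in>space config_space. P \<xi>} \<in> sets config_space"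
    and inj: "\<And>x. inj_on x S \<Longrightarrow> P (points S x)"
  shows "AE \<xi> in projection_law S. P \<xi>"
proof -
  have "AE x in density (power_space S) (projection_density S). P (points S x)"
    unfolding AE_density[OF borel_measurable_projection_density[OF S(2)]]
  proof (rule AE_I2, rule impI)
    fix x assume "0 < projection_density S x"
    then have "slater \<phi> S id x \<noteq> 0" by (auto simp: projection_density_def)
    then have "inj_on x S" using slater_repeated_point[OF S(1)] by blast
    then show "P (points S x)" by (rule inj)
  qed
  then show ?thesis
    unfolding projection_law_def by (subst AE_distr_iff[OF measurable_points_density[OF S(1)] P])
qed

lemma AE_projection_law_simple:
  assumes S: "finite S" "S \<subseteq> J"
  shows "AE \<xi> in projection_law S. \<xi> \<in> simple_configs"
proof (rule AE_projection_law[OF S])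
  show "{\<xi>\<in>space config_space. \<xi> \<in> (simple_configs :: 'a measure set)} \<in> sets config_space"
    using pred_simple_configs unfolding pred_def .
qed (rule points_in_simple_configs[OF S(1)])

lemma AE_projection_law_card:
  assumes S: "finite S" "S \<subseteq> J"
  shows "AE \<xi> in projection_law S. emeasure \<xi> UNIV = of_nat (card S)"
proof (rule AE_projection_law[OF S])
  have "{\<xi>\<in>space config_space. emeasure \<xi> (UNIV :: 'a set) = of_nat (card S)}
      = (\<lambda>\<xi>. emeasure \<xi> (UNIV :: 'a set)) -` {of_nat (card S)} \<inter> space config_space" by auto
  also have "\<dots> \<in> sets config_space"
    by (rule measurable_sets[OF measurable_emeasure_config_space]) simp_all
  finally show "{\<xi>\<in>space config_space. emeasure \<xi> (UNIV :: 'a set) = of_nat (card S)} \<in> sets config_space" .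
  show "emeasure (points S x) UNIV = of_nat (card S)" for x :: "nat \<Rightarrow> 'a"
    using emeasure_points_nat[OF S(1), of UNIV x] by simp
qed

text \<open>
  The product of the counts expands into a sum over maps \<open>f\<close> assigning a point to every \<open>D i\<close>, and only
  injective \<open>f\<close> survive because the sets are disjoint.
\<close>

lemma projection_law_moments_real:
  fixes k :: nat
  assumes S: "finite S" "S \<subseteq> J"
    and D: "\<And>i. i < k \<Longrightarrow> D i \<in> sets borel" "disjoint_family_on D {..<k}"
  shows "\<exists>r\<ge>0. (\<integral>\<^sup>+ \<xi>. (\<Prod>i<k. emeasure \<xi> (D i)) \<partial>projection_law S) = ennreal r
    \<and> complex_of_real r = (\<Sum>g\<in>{..<k} \<rightarrow>\<^sub>E S. signed_product_sum (\<lambda>i. overlap (D i)) {..<k} g)"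
proof -
  let ?A = "{..<k}"
  let ?I = "{f. f \<in> ?A \<rightarrow>\<^sub>E S \<and> inj_on f ?A}"
  let ?h = "\<lambda>f x. (cmod (slater \<phi> S id x))\<^sup>2 * (\<Prod>i<k. indicator (D i) (x (f i)))"
  have finPiE: "finite (?A \<rightarrow>\<^sub>E S)" using S(1) by (intro finite_PiE) auto
  then have finI: "finite ?I" by (rule finite_subset[rotated]) auto
  have "\<exists>r. 0 \<le> r \<and> (\<integral>\<^sup>+ x. ennreal (?h f x) \<partial>power_space S) = ennreal r
      \<and> complex_of_real r = (\<Sum>\<sigma> | \<sigma> permutes S. signed_product_sum (\<lambda>i. overlap (D i)) ?A (\<sigma> \<circ> f))"
    if "f \<in> ?I" for f
    using slater_square_integral_injection[OF S, of f k D] that D(1) by (auto simp: PiE_iff Pi_iff)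
  then have "\<forall>f\<in>?I. \<exists>r. 0 \<le> r \<and> (\<integral>\<^sup>+ x. ennreal (?h f x) \<partial>power_space S) = ennreal r \<and> complex_of_real r = (\<Sum>\<sigma> | \<sigma> permutes S. signed_product_sum (\<lambda>i. overlap (D i)) ?A (\<sigma> \<circ> f))"
    by (intro ballI)
  from bchoice[OF this] obtain r where r: "\<forall>f\<in>?I. 0 \<le> r f \<and> (\<integral>\<^sup>+ x. ennreal (?h f x) \<partial>power_space S) = ennreal (r f) \<and> complex_of_real (r f) = (\<Sum>\<sigma> | \<sigma> permutes S. signed_product_sum (\<lambda>i. overlap (D i)) ?A (\<sigma> \<circ> f))"
    by (rule exE)
  have r0: "0 \<le> r f" and r1: "(\<integral>\<^sup>+ x. ennreal (?h f x) \<partial>power_space S) = ennreal (r f)"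
    and r2: "complex_of_real (r f) = (\<Sum>\<sigma> | \<sigma> permutes S. signed_product_sum (\<lambda>i. overlap (D i)) ?A (\<sigma> \<circ> f))" if "f \<in> ?I" for f
    using bspec[OF r that] by (simp_all only: simp_thms)
  have h_meas: "(\<lambda>x. ennreal (?h f x)) \<in> borel_measurable (power_space S)" if "f \<in> ?I" for f
    using S(2) that D(1)
    by (intro measurable_compose[OF _ measurable_ennreal] borel_measurable_times borel_measurable_slater_square
        borel_measurable_prod borel_measurable_indicator_component) auto
  have expand: "projection_density S x * (\<Prod>i<k. emeasure (points S x) (D i))
      = (\<Sum>f\<in>?I. ennreal (?h f x)) / ennreal (fact (card S))" for x
  proof -
    let ?d = "(cmod (slater \<phi> S id x))\<^sup>2"
    have "(\<Prod>i<k. emeasure (points S x) (D i)) = (\<Prod>i<k. \<Sum>s\<in>S. ennreal (indicator (D i) (x s)))"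
      using emeasure_points[OF S(1) D(1)] by (intro prod.cong) (auto simp: ennreal_indicator)
    also have "\<dots> = (\<Sum>f\<in>?A \<rightarrow>\<^sub>E S. \<Prod>i<k. ennreal (indicator (D i) (x (f i))))"
      using S(1) by (intro prod_sum_PiE) auto
    also have "\<dots> = (\<Sum>f\<in>?A \<rightarrow>\<^sub>E S. ennreal (\<Prod>i<k. indicator (D i) (x (f i))))"
      by (intro sum.cong refl prod_ennreal) auto
    also have "\<dots> = (\<Sum>f\<in>?I. ennreal (\<Prod>i<k. indicator (D i) (x (f i))))"
    proof (intro sum.mono_neutral_right finPiE ballI)
      fix f assume "f \<in> (?A \<rightarrow>\<^sub>E S) - ?I"
      then obtain i j where ij: "i < k" "j < k" "i \<noteq> j" "f i = f j" by (auto simp: inj_on_def)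
      then have "D i \<inter> D j = {}" using D(2) by (auto simp: disjoint_family_on_def)
      then have "indicator (D i) (x (f i)) = (0::real) \<or> indicator (D j) (x (f j)) = (0::real)"
        using ij(4) by (auto simp: indicator_def)
      then have "(\<Prod>i<k. indicator (D i) (x (f i)) :: real) = 0"
        using ij(1,2) by (auto intro!: prod_zero)
      then show "ennreal (\<Prod>i<k. indicator (D i) (x (f i))) = 0" by (simp only: ennreal_0)
    qed auto
    finally have "(\<Prod>i<k. emeasure (points S x) (D i)) = (\<Sum>f\<in>?I. ennreal (\<Prod>i<k. indicator (D i) (x (f i))))" .
    moreover have "projection_density S x = ennreal ?d / ennreal (fact (card S))"
      unfolding projection_density_def by (intro divide_ennreal[symmetric]) auto
    ultimately have "projection_density S x * (\<Prod>i<k. emeasure (points S x) (D i))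
        = (ennreal ?d * (\<Sum>f\<in>?I. ennreal (\<Prod>i<k. indicator (D i) (x (f i))))) / ennreal (fact (card S))"
      by (simp only: divide_ennreal_def mult_ac)
    also have "ennreal ?d * (\<Sum>f\<in>?I. ennreal (\<Prod>i<k. indicator (D i) (x (f i)))) = (\<Sum>f\<in>?I. ennreal (?h f x))"
      unfolding sum_distrib_left by (intro sum.cong refl ennreal_mult[symmetric] prod_nonneg) auto
    finally show ?thesis .
  qed
  have "(\<integral>\<^sup>+ \<xi>. (\<Prod>i<k. emeasure \<xi> (D i)) \<partial>projection_law S)
      = (\<integral>\<^sup>+ x. projection_density S x * (\<Prod>i<k. emeasure (points S x) (D i)) \<partial>power_space S)"
    using D(1) by (intro nn_integral_projection_law S borel_measurable_prod_ennreal
        measurable_emeasure_config_space) auto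
  also have "\<dots> = (\<integral>\<^sup>+ x. (\<Sum>f\<in>?I. ennreal (?h f x)) / ennreal (fact (card S)) \<partial>power_space S)"
    unfolding expand ..
  also have "\<dots> = (\<integral>\<^sup>+ x. (\<Sum>f\<in>?I. ennreal (?h f x)) \<partial>power_space S) / ennreal (fact (card S))"
    by (intro nn_integral_divide borel_measurable_sum h_meas)
  also have "(\<integral>\<^sup>+ x. (\<Sum>f\<in>?I. ennreal (?h f x)) \<partial>power_space S) = (\<Sum>f\<in>?I. ennreal (r f))"
    using r1 by (subst nn_integral_sum[OF h_meas]) auto
  also have "\<dots> = ennreal (\<Sum>f\<in>?I. r f)"
    using r0 by (intro sum_ennreal) auto
  also have "\<dots> / ennreal (fact (card S)) = ennreal ((\<Sum>f\<in>?I. r f) / fact (card S))"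
    using r0 by (intro divide_ennreal sum_nonneg) auto
  finally have 1: "(\<integral>\<^sup>+ \<xi>. (\<Prod>i<k. emeasure \<xi> (D i)) \<partial>projection_law S)
      = ennreal ((\<Sum>f\<in>?I. r f) / fact (card S))" .
  have "complex_of_real (\<Sum>f\<in>?I. r f) = (\<Sum>f\<in>?I. \<Sum>\<sigma> | \<sigma> permutes S.
      signed_product_sum (\<lambda>i. overlap (D i)) ?A (\<sigma> \<circ> f))"
    unfolding of_real_sum by (intro sum.cong refl r2)
  also have "\<dots> = fact (card S) * (\<Sum>g\<in>?A \<rightarrow>\<^sub>E S. signed_product_sum (\<lambda>i. overlap (D i)) ?A g)"
    by (rule sum_injections_permuted[OF S(1) finite_lessThan])
  finally have 2: "complex_of_real ((\<Sum>f\<in>?I. r f) / fact (card S))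
      = (\<Sum>g\<in>?A \<rightarrow>\<^sub>E S. signed_product_sum (\<lambda>i. overlap (D i)) ?A g)"
    by simp
  show ?thesis
    using 1 2 r0 by (intro exI[of _ "(\<Sum>f\<in>?I. r f) / fact (card S)"] conjI divide_nonneg_nonneg sum_nonneg) auto
qed

text \<open>
  The same sum of Gram matrix products arises from integrating the Cauchy--Binet expansion, which
  is how the two sides of \<open>projection_law_moments\<close> are compared.
\<close>

lemma intensity_integral_real:
  fixes k :: nat
  assumes S: "finite S" "S \<subseteq> J"
    and D: "\<And>i. i < k \<Longrightarrow> D i \<in> sets borel"
  shows "\<exists>r\<ge>0. set_nn_integral (power_space {..<k}) (\<Pi>\<^sub>E i\<in>{..<k}. D i) (intensity J \<phi> (\<lambda>s. of_bool (s \<in> S)) k) = ennreal r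
    \<and> complex_of_real r = (\<Sum>g\<in>{..<k} \<rightarrow>\<^sub>E S. signed_product_sum (\<lambda>i. overlap (D i)) {..<k} g)"
proof -
  let ?A = "{..<k}"
  let ?P = "?A \<rightarrow>\<^sub>E S"
  let ?h = "\<lambda>g x. (cmod (slater \<phi> ?A g x))\<^sup>2 * (\<Prod>i<k. indicator (D i) (x i))"
  have gJ: "g \<in> ?A \<rightarrow> J" if "g \<in> ?P" for g using that S(2) by auto
  have "\<exists>r. 0 \<le> r \<and> (\<integral>\<^sup>+ x. ennreal (?h g x) \<partial>power_space ?A) = ennreal r
      \<and> complex_of_real r = (\<Sum>\<sigma> | \<sigma> permutes ?A. signed_product_sum (\<lambda>i. overlap (D i)) ?A (g \<circ> \<sigma>))"
    if "g \<in> ?P" for g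
    using slater_square_integral[OF finite_lessThan gJ[OF that], of D] D
      double_signed_sum_same_index[of ?A "\<lambda>i. overlap (D i)" g] by auto
  then have "\<forall>g\<in>?P. \<exists>r. 0 \<le> r \<and> (\<integral>\<^sup>+ x. ennreal (?h g x) \<partial>power_space ?A) = ennreal r \<and> complex_of_real r = (\<Sum>\<sigma> | \<sigma> permutes ?A. signed_product_sum (\<lambda>i. overlap (D i)) ?A (g \<circ> \<sigma>))"
    by (intro ballI)
  from bchoice[OF this] obtain r where r: "\<forall>g\<in>?P. 0 \<le> r g \<and> (\<integral>\<^sup>+ x. ennreal (?h g x) \<partial>power_space ?A) = ennreal (r g) \<and> complex_of_real (r g) = (\<Sum>\<sigma> | \<sigma> permutes ?A. signed_product_sum (\<lambda>i. overlap (D i)) ?A (g \<circ> \<sigma>))"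
    by (rule exE)
  have r0: "0 \<le> r g" and r1: "(\<integral>\<^sup>+ x. ennreal (?h g x) \<partial>power_space ?A) = ennreal (r g)"
    and r2: "complex_of_real (r g) = (\<Sum>\<sigma> | \<sigma> permutes ?A. signed_product_sum (\<lambda>i. overlap (D i)) ?A (g \<circ> \<sigma>))" if "g \<in> ?P" for g
    using bspec[OF r that] by (simp_all only: simp_thms)
  have h_meas: "(\<lambda>x. ennreal (?h g x)) \<in> borel_measurable (power_space ?A)" if "g \<in> ?P" for g
    using gJ[OF that] D
    by (intro measurable_compose[OF _ measurable_ennreal] borel_measurable_times borel_measurable_slater_square
        borel_measurable_prod borel_measurable_indicator_component) auto
  have "set_nn_integral (power_space ?A) (\<Pi>\<^sub>E i\<in>?A. D i) (intensity J \<phi> (\<lambda>s. of_bool (s \<in> S)) k)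
      = (\<integral>\<^sup>+ x. (\<Sum>g\<in>?P. ennreal (?h g x)) / ennreal (fact k) \<partial>power_space ?A)"
  proof (rule nn_integral_cong)
    fix x assume x: "x \<in> space (power_space ?A)"
    have c1: "(\<Prod>i<k. of_bool (g i \<in> S)) = (1::real)" if "g \<in> ?P" for g
      using that by (intro prod.neutral) (auto simp: PiE_iff)
    have "intensity J \<phi> (\<lambda>s. of_bool (s \<in> S)) k x = ennreal (finite_intensity S \<phi> (\<lambda>s. of_bool (s \<in> S)) k x)"
      using S by (intro intensity_finite_support) auto
    also have "finite_intensity S \<phi> (\<lambda>s. of_bool (s \<in> S)) k x = (\<Sum>g\<in>?P. (cmod (slater \<phi> ?A g x))\<^sup>2) / fact k"
      unfolding finite_intensity_def by (intro arg_cong2[where f="(/)"] sum.cong refl) (simp only: c1 mult_1)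
    also have "ennreal \<dots> = ennreal (\<Sum>g\<in>?P. (cmod (slater \<phi> ?A g x))\<^sup>2) / ennreal (fact k)"
      by (intro divide_ennreal[symmetric] sum_nonneg zero_le_power2) simp
    also have "ennreal (\<Sum>g\<in>?P. (cmod (slater \<phi> ?A g x))\<^sup>2) = (\<Sum>g\<in>?P. ennreal ((cmod (slater \<phi> ?A g x))\<^sup>2))"
      by (intro sum_ennreal[symmetric] zero_le_power2)
    finally have i: "intensity J \<phi> (\<lambda>s. of_bool (s \<in> S)) k x =
      (\<Sum>g\<in>?P. ennreal ((cmod (slater \<phi> ?A g x))\<^sup>2)) / ennreal (fact k)" .
    have ind: "indicator (\<Pi>\<^sub>E i\<in>?A. D i) x = ennreal (\<Prod>i<k. indicator (D i) (x i))"
    proof (cases "x \<in> (\<Pi>\<^sub>E i\<in>?A. D i)")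
      case True
      then have "(\<Prod>i<k. indicator (D i) (x i) :: real) = 1" by (intro prod.neutral) (auto simp: PiE_iff)
      then show ?thesis using True by simp
    next
      case False
      then obtain i where "i < k" "x i \<notin> D i" using x by (auto simp: space_PiM PiE_iff)
      then have "(\<Prod>i<k. indicator (D i) (x i) :: real) = 0" by (intro prod_zero bexI[of _ i]) auto
      moreover have "indicator (\<Pi>\<^sub>E i\<in>?A. D i) x = (0 :: ennreal)"
        using False by (rule indicator_simps(2))
      ultimately show ?thesis by (simp only: ennreal_0)
    qed
    show "intensity J \<phi> (\<lambda>s. of_bool (s \<in> S)) k x * indicator (\<Pi>\<^sub>E i\<in>?A. D i) x
        = (\<Sum>g\<in>?P. ennreal (?h g x)) / ennreal (fact k)"
    proof -
      have "ennreal (?h g x) = ennreal ((cmod (slater \<phi> ?A g x))\<^sup>2) * ennreal (\<Prod>i<k. indicator (D i) (x i))" for g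
        by (intro ennreal_mult prod_nonneg) auto
      then have "(\<Sum>g\<in>?P. ennreal (?h g x)) = (\<Sum>g\<in>?P. ennreal ((cmod (slater \<phi> ?A g x))\<^sup>2)) * ennreal (\<Prod>i<k. indicator (D i) (x i))"
        by (simp only: sum_distrib_right)
      then show ?thesis unfolding i ind by (simp only: divide_ennreal_def mult_ac)
    qed
  qed
  also have "\<dots> = (\<integral>\<^sup>+ x. (\<Sum>g\<in>?P. ennreal (?h g x)) \<partial>power_space ?A) / ennreal (fact k)"
    by (intro nn_integral_divide borel_measurable_sum h_meas)
  also have "(\<integral>\<^sup>+ x. (\<Sum>g\<in>?P. ennreal (?h g x)) \<partial>power_space ?A) = (\<Sum>g\<in>?P. ennreal (r g))"
    using r1 by (subst nn_integral_sum[OF h_meas]) auto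
  also have "\<dots> = ennreal (\<Sum>g\<in>?P. r g)"
    using r0 by (intro sum_ennreal) auto
  also have "\<dots> / ennreal (fact k) = ennreal ((\<Sum>g\<in>?P. r g) / fact k)"
    using r0 by (intro divide_ennreal sum_nonneg) auto
  finally have 1: "set_nn_integral (power_space ?A) (\<Pi>\<^sub>E i\<in>?A. D i) (intensity J \<phi> (\<lambda>s. of_bool (s \<in> S)) k)
      = ennreal ((\<Sum>g\<in>?P. r g) / fact k)" .
  have "complex_of_real (\<Sum>g\<in>?P. r g) = (\<Sum>g\<in>?P. \<Sum>\<sigma> | \<sigma> permutes ?A.
      signed_product_sum (\<lambda>i. overlap (D i)) ?A (g \<circ> \<sigma>))"
    unfolding of_real_sum by (intro sum.cong refl r2)
  also have "\<dots> = (\<Sum>\<sigma> | \<sigma> permutes ?A. \<Sum>g\<in>?P. signed_product_sum (\<lambda>i. overlap (D i)) ?A (g \<circ> \<sigma>))"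
    by (rule sum.swap)
  also have "\<dots> = (\<Sum>\<sigma> | \<sigma> permutes ?A. \<Sum>g\<in>?P. signed_product_sum (\<lambda>i. overlap (D i)) ?A g)"
    by (rule sum.cong[OF refl], rule sum_PiE_compose_permutation)
      (auto intro: signed_product_sum_cong)
  also have "\<dots> = fact k * (\<Sum>g\<in>?P. signed_product_sum (\<lambda>i. overlap (D i)) ?A g)"
    by (simp add: card_permutations)
  finally have 2: "complex_of_real ((\<Sum>g\<in>?P. r g) / fact k)
      = (\<Sum>g\<in>?P. signed_product_sum (\<lambda>i. overlap (D i)) ?A g)"
    by simp
  show ?thesis
    using 1 2 r0 by (intro exI[of _ "(\<Sum>g\<in>?P. r g) / fact k"] conjI divide_nonneg_nonneg sum_nonneg) auto
qed

lemma projection_law_moments: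
  assumes S: "finite S" "S \<subseteq> J"
    and D: "\<And>i. i < k \<Longrightarrow> D i \<in> sets borel" "disjoint_family_on D {..<k}"
  shows "(\<integral>\<^sup>+ \<xi>. (\<Prod>i<k. emeasure \<xi> (D i)) \<partial>projection_law S)
    = set_nn_integral (power_space {..<k}) (\<Pi>\<^sub>E i\<in>{..<k}. D i) (intensity J \<phi> (\<lambda>s. of_bool (s \<in> S)) k)"
proof -
  obtain r where r: "(\<integral>\<^sup>+ \<xi>. (\<Prod>i<k. emeasure \<xi> (D i)) \<partial>projection_law S) = ennreal r"
    "complex_of_real r = (\<Sum>g\<in>{..<k} \<rightarrow>\<^sub>E S. signed_product_sum (\<lambda>i. overlap (D i)) {..<k} g)"
    using projection_law_moments_real[OF S, of k D] D by auto
  obtain r' where r': "set_nn_integral (power_space {..<k}) (\<Pi>\<^sub>E i\<in>{..<k}. D i)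
      (intensity J \<phi> (\<lambda>s. of_bool (s \<in> S)) k) = ennreal r'"
    "complex_of_real r' = (\<Sum>g\<in>{..<k} \<rightarrow>\<^sub>E S. signed_product_sum (\<lambda>i. overlap (D i)) {..<k} g)"
    using intensity_integral_real[OF S, of k D] D(1) by auto
  have "complex_of_real r = complex_of_real r'" using r(2) r'(2) by simp
  then show ?thesis unfolding r(1) r'(1) by (simp only: of_real_eq_iff)
qed

lemma summable_of_bool:
  fixes S :: "nat set"
  assumes "finite S"
  shows "(\<lambda>s. of_bool (s \<in> S) :: real) summable_on J"
proof -
  have "(\<lambda>s. of_bool (s \<in> S) :: real) summable_on (J \<inter> S)"
    using assms by (intro summable_on_finite) auto
  then show ?thesis
    by (rule summable_on_cong_neutral[THEN iffD1, rotated -1]) auto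
qed

lemma point_process_projection_law:
  assumes "finite S" "S \<subseteq> J"
  shows "point_process (projection_law S) (\<lambda>\<xi>. \<xi>)"
  unfolding point_process_def
  using prob_space_projection_law[OF assms] measurable_ident_sets[OF sets_projection_law[of S]] by simp

lemma determinantal_projection_law:
  assumes S: "finite S" "S \<subseteq> J"
  shows "determinantal_process (projection_law S) (\<lambda>\<xi>. \<xi>) \<mu> (spectral_kernel J (\<lambda>s. of_bool (s \<in> S)) \<phi>)"
  unfolding determinantal_process_def
proof (intro conjI exI allI impI)
  show "point_process (projection_law S) (\<lambda>\<xi>. \<xi>)"
    by (rule point_process_projection_law[OF S])
  show "simple_process (projection_law S) (\<lambda>\<xi>. \<xi>)"
    unfolding simple_process_def using AE_projection_law_simple[OF S]
    by eventually_elim (simp add: simple_configs_def)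
  let ?c = "\<lambda>s. of_bool (s \<in> S) :: real"
  let ?\<rho> = "\<lambda>k x. enn2real (intensity J \<phi> ?c k x)"
  have AE: "AE x in power_space {..<k}. intensity J \<phi> ?c k x < \<infinity> \<and>
    Determinant.det (mat k k (\<lambda>(i, j). spectral_kernel J ?c \<phi> (x i) (x j)))
      = complex_of_real (?\<rho> k x)" for k
    by (rule AE_det_spectral_kernel[OF _ summable_of_bool[OF S(1)]]) simp
  then show "AE x in power_space {..<k}. complex_of_real (?\<rho> k x) =
      Determinant.det (mat k k (\<lambda>(i, j). spectral_kernel J ?c \<phi> (x i) (x j)))" for k
    by (rule eventually_mono) simp
  show "joint_intensities (projection_law S) (\<lambda>\<xi>. \<xi>) \<mu> ?\<rho>"
    unfolding joint_intensities_def
  proof (intro allI impI conjI ballI)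
    fix k :: nat
    show "?\<rho> k \<in> borel_measurable (power_space {..<k})"
      by (intro borel_measurable_enn2real borel_measurable_intensity) simp
    show "0 \<le> ?\<rho> k x" for x by simp
    fix D :: "nat \<Rightarrow> 'a set"
    assume D: "\<forall>i<k. D i \<in> sets borel" "disjoint_family_on D {..<k}"
    have "(\<integral>\<^sup>+ \<xi>. (\<Prod>i<k. emeasure \<xi> (D i)) \<partial>projection_law S)
      = set_nn_integral (power_space {..<k}) (\<Pi>\<^sub>E i\<in>{..<k}. D i) (intensity J \<phi> ?c k)"
      using D by (intro projection_law_moments[OF S]) auto
    also have "\<dots> = set_nn_integral (power_space {..<k}) (\<Pi>\<^sub>E i\<in>{..<k}. D i) (\<lambda>x. ennreal (?\<rho> k x))"
      using AE[of k] by (intro nn_integral_cong_AE) (auto elim!: eventually_mono)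
    finally show "(\<integral>\<^sup>+ \<xi>. (\<Prod>i<k. emeasure \<xi> (D i)) \<partial>projection_law S)
      = set_nn_integral (power_space {..<k}) (\<Pi>\<^sub>E i\<in>{..<k}. D i) (\<lambda>x. ennreal (?\<rho> k x))" .
  qed
qed

end

section \<open>Independent Bernoulli selection of indices\<close>

locale bernoulli_selection = prob_space N for N :: "'v measure" +
  fixes J :: "nat set" and I :: "nat \<Rightarrow> 'v \<Rightarrow> bool" and lam :: "nat \<Rightarrow> real"
  assumes lam: "\<forall>k\<in>J. 0 \<le> lam k \<and> lam k \<le> 1"
    and lam_summable: "lam summable_on J"
    and indep: "indep_vars (\<lambda>_. count_space UNIV) I J"
    and bernoulli: "\<forall>k\<in>J. distr N (count_space UNIV) (I k) = measure_pmf (bernoulli_pmf (lam k))"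
begin

lemma measurable_I: "k \<in> J \<Longrightarrow> I k \<in> measurable N (count_space UNIV)"
  using indep unfolding indep_vars_def by blast

lemma nn_integral_I:
  assumes "k \<in> J"
  shows "(\<integral>\<^sup>+ \<omega>. h (I k \<omega>) \<partial>N) = h True * ennreal (lam k) + h False * ennreal (1 - lam k)"
proof -
  have "(\<integral>\<^sup>+ \<omega>. h (I k \<omega>) \<partial>N) = (\<integral>\<^sup>+ b. h b \<partial>distr N (count_space UNIV) (I k))"
    using measurable_I[OF assms] by (subst nn_integral_distr) auto
  also have "\<dots> = (\<integral>\<^sup>+ b. h b \<partial>bernoulli_pmf (lam k))"
    using bernoulli assms by simp
  finally show ?thesis using lam assms by simp
qed

lemma nn_integral_prod_I:
  assumes "finite T" "T \<subseteq> J"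
  shows "(\<integral>\<^sup>+ \<omega>. (\<Prod>k\<in>T. h (I k \<omega>)) \<partial>N)
    = (\<Prod>k\<in>T. h True * ennreal (lam k) + h False * ennreal (1 - lam k))"
proof -
  have "indep_vars (\<lambda>_. borel) (\<lambda>k \<omega>. h (I k \<omega>)) T"
    using indep_vars_subset[OF indep assms(2)] by (rule indep_vars_compose2) simp
  then have "(\<integral>\<^sup>+ \<omega>. (\<Prod>k\<in>T. h (I k \<omega>)) \<partial>N) = (\<Prod>k\<in>T. \<integral>\<^sup>+ \<omega>. h (I k \<omega>) \<partial>N)"
    using assms(1) by (intro indep_vars_nn_integral) auto
  also have "\<dots> = (\<Prod>k\<in>T. h True * ennreal (lam k) + h False * ennreal (1 - lam k))"
    using assms(2) by (intro prod.cong refl nn_integral_I) auto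
  finally show ?thesis .
qed

text \<open>
  Borel--Cantelli: the probabilities \<open>\<lambda>\<^sub>k\<close> are summable.
\<close>

lemma AE_finite_selection: "AE \<omega> in N. finite {k\<in>J. I k \<omega>}"
proof -
  define A where "A k = (if k \<in> J then {\<omega>\<in>space N. I k \<omega>} else {})" for k
  have sets: "A k \<in> sets N" for k
  proof (cases "k \<in> J")
    case True
    have "{\<omega>\<in>space N. I k \<omega>} = I k -` {True} \<inter> space N" by auto
    also have "\<dots> \<in> sets N" by (rule measurable_sets[OF measurable_I[OF True]]) simp
    finally show ?thesis using True by (simp add: A_def)
  qed (simp add: A_def)
  have prob: "measure N (A k) = (if k \<in> J then lam k else 0)" for k
  proof (cases "k \<in> J")
    case True
    have "emeasure N (A k) = (\<integral>\<^sup>+ \<omega>. indicator (A k) \<omega> \<partial>N)" using sets by simp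
    also have "\<dots> = (\<integral>\<^sup>+ \<omega>. of_bool (I k \<omega>) \<partial>N)"
      using True by (intro nn_integral_cong) (auto simp: A_def indicator_def)
    also have "\<dots> = ennreal (lam k)"
      using nn_integral_I[OF True, of of_bool] by simp
    finally show ?thesis using lam True by (simp add: measure_def)
  qed (simp add: A_def)
  have "(\<lambda>k. if k \<in> J then lam k else 0) summable_on UNIV"
    using lam_summable by (rule summable_on_cong_neutral[THEN iffD1, rotated -1]) auto
  then have "summable (\<lambda>k. measure N (A k))"
    unfolding prob by (rule summable_on_imp_summable)
  then have "AE \<omega> in N. \<forall>\<^sub>F k in sequentially. \<omega> \<in> space N - A k"
    using sets by (intro borel_cantelli_AE1) (auto simp: emeasure_eq_measure)
  then show ?thesis
  proof (rule AE_mp, intro AE_I2 impI)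
    fix \<omega> assume "\<omega> \<in> space N" "\<forall>\<^sub>F k in sequentially. \<omega> \<in> space N - A k"
    then obtain n where n: "\<And>k. k \<ge> n \<Longrightarrow> \<omega> \<notin> A k" by (auto simp: eventually_sequentially)
    have "{k\<in>J. I k \<omega>} \<subseteq> {..<n}"
    proof
      fix k assume k: "k \<in> {k\<in>J. I k \<omega>}"
      show "k \<in> {..<n}"
      proof (rule ccontr)
        assume "k \<notin> {..<n}"
        then have "\<omega> \<notin> A k" using n by simp
        then show False using k \<open>\<omega> \<in> space N\<close> by (simp add: A_def)
      qed
    qed
    then show "finite {k\<in>J. I k \<omega>}" by (rule finite_subset) simp
  qed
qed

text \<open>
  The null set of infinite selections is sent to the empty set, so that the values are always
  finite and range over a countable set.
\<close>

definition selected :: "(nat \<Rightarrow> bool) \<Rightarrow> nat set" where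
  "selected \<iota> = (if finite {k\<in>J. \<iota> k} then {k\<in>J. \<iota> k} else {})"

abbreviation outcomes :: "(nat \<Rightarrow> bool) measure" where
  "outcomes \<equiv> \<Pi>\<^sub>M k\<in>J. count_space UNIV"

abbreviation outcome :: "'v \<Rightarrow> nat \<Rightarrow> bool" where
  "outcome \<omega> \<equiv> \<lambda>k\<in>J. I k \<omega>"

abbreviation finite_selections :: "nat set set" where
  "finite_selections \<equiv> {S. finite S \<and> S \<subseteq> J}"

lemma countable_finite_selections: "countable finite_selections"
  by (rule countable_subset[OF _ countable_Collect_finite]) auto

lemma selected_in: "selected \<iota> \<in> finite_selections"
  by (auto simp: selected_def)

lemma measurable_selected: "selected \<in> measurable outcomes (count_space finite_selections)"
  unfolding measurable_count_space_eq_countable[OF countable_finite_selections]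
proof (intro conjI ballI)
  show "selected \<in> space outcomes \<rightarrow> finite_selections" using selected_in by blast
  fix S assume S: "S \<in> finite_selections"
  have comp: "Measurable.pred outcomes (\<lambda>\<iota>. \<iota> k)" if "k \<in> J" for k
    using measurable_component_singleton[OF that, of "\<lambda>_. count_space UNIV"] by simp
  have eq: "Measurable.pred outcomes (\<lambda>\<iota>. \<forall>k\<in>J. \<iota> k = (k \<in> S))"
  proof (rule pred_intros_countable_bounded(3))
    fix k assume "k \<in> J"
    then show "Measurable.pred outcomes (\<lambda>\<iota>. \<iota> k = (k \<in> S))"
      by (cases "k \<in> S") (auto intro: comp pred_intros_logic(2))
  qed
  have fin: "Measurable.pred outcomes (\<lambda>\<iota>. \<exists>n. \<forall>k\<in>J. n \<le> k \<longrightarrow> \<not> \<iota> k)"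
  proof (rule pred_intros_countable(2), rule pred_intros_countable_bounded(3))
    fix n k :: nat assume "k \<in> J"
    then show "Measurable.pred outcomes (\<lambda>\<iota>. n \<le> k \<longrightarrow> \<not> \<iota> k)"
      by (cases "n \<le> k") (auto intro: comp pred_intros_logic(2))
  qed
  have "finite {k\<in>J. \<iota> k} \<longleftrightarrow> (\<exists>n. \<forall>k\<in>J. n \<le> k \<longrightarrow> \<not> \<iota> k)" for \<iota>
    unfolding finite_nat_iff_bounded by (auto simp: subset_eq not_le[symmetric])
  moreover have "{k\<in>J. \<iota> k} = S \<longleftrightarrow> (\<forall>k\<in>J. \<iota> k = (k \<in> S))" for \<iota>
    using S by auto
  \<comment> \<open>The second alternative is the default value for infinite selections.\<close>
  ultimately have sel: "selected \<iota> = S \<longleftrightarrow>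
      (\<exists>n. \<forall>k\<in>J. n \<le> k \<longrightarrow> \<not> \<iota> k) \<and> (\<forall>k\<in>J. \<iota> k = (k \<in> S)) \<or>
      \<not> (\<exists>n. \<forall>k\<in>J. n \<le> k \<longrightarrow> \<not> \<iota> k) \<and> S = {}" for \<iota>
    by (auto simp: selected_def)
  have "Measurable.pred outcomes (\<lambda>\<iota>. (\<exists>n. \<forall>k\<in>J. n \<le> k \<longrightarrow> \<not> \<iota> k) \<and> (\<forall>k\<in>J. \<iota> k = (k \<in> S)) \<or>
      \<not> (\<exists>n. \<forall>k\<in>J. n \<le> k \<longrightarrow> \<not> \<iota> k) \<and> S = {})"
    by (rule pred_intros_logic(5)[OF pred_intros_logic(3)[OF fin eq]
          pred_intros_logic(3)[OF pred_intros_logic(2)[OF fin]]]) simp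
  then have "Measurable.pred outcomes (\<lambda>\<iota>. selected \<iota> = S)"
    unfolding sel .
  then have "{\<iota>\<in>space outcomes. selected \<iota> = S} \<in> sets outcomes"
    by (simp only: pred_def)
  moreover have "selected -` {S} \<inter> space outcomes = {\<iota>\<in>space outcomes. selected \<iota> = S}" by auto
  ultimately show "selected -` {S} \<inter> space outcomes \<in> sets outcomes" by simp
qed

lemma measurable_outcome: "outcome \<in> measurable N outcomes"
  by (rule measurable_restrict) (rule measurable_I)

lemma measurable_selected_outcome:
  "(\<lambda>\<omega>. selected (outcome \<omega>)) \<in> measurable N (count_space finite_selections)"
  by (rule measurable_compose[OF measurable_outcome measurable_selected])

lemma AE_selected_outcome: "AE \<omega> in N. selected (outcome \<omega>) = {k\<in>J. I k \<omega>}"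
  using AE_finite_selection
proof eventually_elim
  case (elim \<omega>)
  have "{k\<in>J. outcome \<omega> k} = {k\<in>J. I k \<omega>}" by auto
  then show ?case using elim by (simp add: selected_def)
qed

lemma nn_integral_all_selected:
  assumes "finite T" "T \<subseteq> J"
  shows "(\<integral>\<^sup>+ \<omega>. of_bool (T \<subseteq> selected (outcome \<omega>)) \<partial>N) = (\<Prod>k\<in>T. ennreal (lam k))"
proof -
  have "(\<integral>\<^sup>+ \<omega>. of_bool (T \<subseteq> selected (outcome \<omega>)) \<partial>N) = (\<integral>\<^sup>+ \<omega>. (\<Prod>k\<in>T. of_bool (I k \<omega>)) \<partial>N)"
  proof (rule nn_integral_cong_AE)
    show "AE \<omega> in N. of_bool (T \<subseteq> selected (outcome \<omega>)) = (\<Prod>k\<in>T. of_bool (I k \<omega>) :: ennreal)"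
      using AE_selected_outcome
    proof eventually_elim
      case (elim \<omega>)
      show ?case
      proof (cases "\<forall>k\<in>T. I k \<omega>")
        case True
        then show ?thesis using assms elim by auto
      next
        case False
        then obtain k where k: "k \<in> T" "\<not> I k \<omega>" by blast
        then have "(\<Prod>k\<in>T. of_bool (I k \<omega>)) = (0::ennreal)"
          using assms(1) by (intro prod_zero) auto
        moreover have "\<not> T \<subseteq> selected (outcome \<omega>)" unfolding elim using k by blast
        ultimately show ?thesis by (simp only: of_bool_eq simp_thms)
      qed
    qed
  qed
  then show ?thesis using nn_integral_prod_I[OF assms, of of_bool] by simp
qed

text \<open>
  The expectation over the first \<open>n\<close> indices is \<open>\<Prod>\<^sub>k (1 + \<lambda>\<^sub>k) \<le> exp (\<Sum>\<^sub>k \<lambda>\<^sub>k)\<close>, uniformly in \<open>n\<close>, and Fatou's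
  lemma passes to the limit.
\<close>

lemma nn_integral_power_selected_finite:
  "(\<integral>\<^sup>+ \<omega>. of_nat (2 ^ card (selected (outcome \<omega>))) \<partial>N) < \<infinity>"
proof -
  let ?T = "\<lambda>n. J \<inter> {..<n}"
  let ?h = "\<lambda>b. if b then 2 else 1 :: ennreal"
  have bound: "(\<integral>\<^sup>+ \<omega>. (\<Prod>k\<in>?T n. ?h (I k \<omega>)) \<partial>N) \<le> ennreal (exp (infsum lam J))" for n
  proof -
    have "(\<integral>\<^sup>+ \<omega>. (\<Prod>k\<in>?T n. ?h (I k \<omega>)) \<partial>N) = (\<Prod>k\<in>?T n. 2 * ennreal (lam k) + 1 * ennreal (1 - lam k))"
      by (subst nn_integral_prod_I) auto
    also have "\<dots> = (\<Prod>k\<in>?T n. ennreal (1 + lam k))"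
    proof (rule prod.cong[OF refl])
      fix k assume "k \<in> ?T n"
      then have k: "0 \<le> lam k" "lam k \<le> 1" using lam by auto
      have "2 * ennreal (lam k) + 1 * ennreal (1 - lam k) = ennreal (2 * lam k) + ennreal (1 - lam k)"
        using k by (simp add: ennreal_mult)
      also have "\<dots> = ennreal (2 * lam k + (1 - lam k))"
        using k by (intro ennreal_plus[symmetric]) auto
      finally show "2 * ennreal (lam k) + 1 * ennreal (1 - lam k) = ennreal (1 + lam k)"
        by (simp add: add.commute)
    qed
    also have "\<dots> = ennreal (\<Prod>k\<in>?T n. 1 + lam k)"
      using lam by (intro prod_ennreal) auto
    also have "\<dots> \<le> ennreal (exp (infsum lam J))"
    proof (rule ennreal_leI)
      have "(\<Prod>k\<in>?T n. 1 + lam k) \<le> (\<Prod>k\<in>?T n. exp (lam k))"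
        using lam by (intro prod_mono) auto
      also have "\<dots> = exp (\<Sum>k\<in>?T n. lam k)" by (rule exp_sum[symmetric]) simp
      also have "\<dots> \<le> exp (infsum lam J)"
        using lam lam_summable by (auto intro!: finite_sum_le_infsum)
      finally show "(\<Prod>k\<in>?T n. 1 + lam k) \<le> exp (infsum lam J)" .
    qed
    finally show ?thesis .
  qed
  have meas: "(\<lambda>\<omega>. \<Prod>k\<in>?T n. ?h (I k \<omega>)) \<in> borel_measurable N" for n
    by (intro borel_measurable_prod_ennreal measurable_compose[OF measurable_I]) auto
  have "(\<integral>\<^sup>+ \<omega>. of_nat (2 ^ card (selected (outcome \<omega>))) \<partial>N)
      = (\<integral>\<^sup>+ \<omega>. liminf (\<lambda>n. \<Prod>k\<in>?T n. ?h (I k \<omega>)) \<partial>N)"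
  proof (rule nn_integral_cong_AE)
    show "AE \<omega> in N. of_nat (2 ^ card (selected (outcome \<omega>))) = liminf (\<lambda>n. \<Prod>k\<in>?T n. ?h (I k \<omega>))"
      using AE_selected_outcome AE_finite_selection
    proof eventually_elim
      case (elim \<omega>)
      obtain m where m: "{k\<in>J. I k \<omega>} \<subseteq> {..<m}"
        using elim(2) unfolding finite_nat_iff_bounded by blast
      have "\<forall>\<^sub>F n in sequentially. (\<Prod>k\<in>?T n. ?h (I k \<omega>)) = of_nat (2 ^ card (selected (outcome \<omega>)))"
      proof (rule eventually_sequentiallyI)
        fix n assume "m \<le> n"
        then have "{k\<in>J. I k \<omega>} \<subseteq> ?T n" using m by auto
        then have "(\<Prod>k\<in>?T n. ?h (I k \<omega>)) = (\<Prod>k\<in>{k\<in>J. I k \<omega>}. ?h (I k \<omega>))"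
          by (intro prod.mono_neutral_right) auto
        also have "\<dots> = (\<Prod>k\<in>{k\<in>J. I k \<omega>}. 2)" by (intro prod.cong) auto
        also have "\<dots> = of_nat (2 ^ card (selected (outcome \<omega>)))" using elim(1) by simp
        finally show "(\<Prod>k\<in>?T n. ?h (I k \<omega>)) = of_nat (2 ^ card (selected (outcome \<omega>)))" .
      qed
      from Liminf_eq[OF this] show ?case by (simp only: Liminf_const[OF sequentially_bot])
    qed
  qed
  also have "\<dots> \<le> liminf (\<lambda>n. \<integral>\<^sup>+ \<omega>. (\<Prod>k\<in>?T n. ?h (I k \<omega>)) \<partial>N)"
    by (rule nn_integral_liminf[OF meas])
  also have "\<dots> \<le> liminf (\<lambda>n::nat. ennreal (exp (infsum lam J)))"
    by (intro Liminf_mono always_eventually allI bound)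
  also have "\<dots> < \<infinity>" by (simp add: Liminf_const)
  finally show ?thesis .
qed

lemma AE_infsum_I: "AE \<omega> in N. (\<Sum>\<^sub>\<infinity>k\<in>J. (of_bool (I k \<omega>) :: ennreal)) = of_nat (card (selected (outcome \<omega>)))"
  using AE_selected_outcome AE_finite_selection
proof eventually_elim
  case (elim \<omega>)
  have "(\<Sum>\<^sub>\<infinity>k\<in>J. (of_bool (I k \<omega>) :: ennreal)) = (\<Sum>\<^sub>\<infinity>k\<in>{k\<in>J. I k \<omega>}. 1)"
    by (intro infsum_cong_neutral) auto
  also have "\<dots> = of_nat (card {k\<in>J. I k \<omega>})" using elim(2) by simp
  finally show ?case using elim(1) by simp
qed

lemma borel_measurable_infsum_I:
  "(\<lambda>\<omega>. \<Sum>\<^sub>\<infinity>k\<in>J. (of_bool (I k \<omega>) :: ennreal)) \<in> borel_measurable N"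
proof -
  have "(\<lambda>\<omega>. SUP T\<in>finite_selections. \<Sum>k\<in>T. (of_bool (I k \<omega>) :: ennreal)) \<in> borel_measurable N"
    by (intro borel_measurable_SUP countable_finite_selections borel_measurable_sum
        measurable_compose[OF measurable_I]) auto
  then show ?thesis by (simp add: nonneg_infsum_complete)
qed

lemma distr_infsum_I:
  "distr N borel (\<lambda>\<omega>. \<Sum>\<^sub>\<infinity>k\<in>J. (of_bool (I k \<omega>) :: ennreal))
    = distr N borel (\<lambda>\<omega>. of_nat (card (selected (outcome \<omega>))))"
  by (intro distr_cong_AE refl AE_infsum_I borel_measurable_infsum_I
      measurable_compose[OF measurable_selected_outcome]) simp

end

section \<open>Mixtures of projection processes\<close>

locale spectral_mixture = orthonormal_system \<mu> J \<phi> + bernoulli_selection N J I lam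
  for \<mu> :: "'a::{second_countable_topology,t2_space} measure" and J \<phi>
    and N :: "'v measure" and I lam
begin

definition sampler :: "(nat \<Rightarrow> bool) \<Rightarrow> 'a measure measure" where
  "sampler \<iota> = projection_law (selected \<iota>)"

definition mixture :: "'a measure measure" where
  "mixture = selection_law N J I \<bind> sampler"

lemma finite_selected: "finite (selected \<iota>)" and selected_subset: "selected \<iota> \<subseteq> J"
  using selected_in by auto

lemma measurable_sampler: "sampler \<in> measurable outcomes (prob_algebra config_space)"
proof -
  have "projection_law \<in> measurable (count_space finite_selections) (prob_algebra config_space)"
    by (auto simp: space_prob_algebra sets_projection_law prob_space_projection_law)
  from measurable_compose[OF measurable_selected this] show ?thesis
    unfolding sampler_def[abs_def] .
qed

lemma selection_law_in_prob_algebra: "selection_law N J I \<in> space (prob_algebra outcomes)"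
  unfolding space_prob_algebra selection_law_def
  using prob_space_distr[OF measurable_outcome] by simp

lemma sets_selection_law: "sets (selection_law N J I) = sets outcomes"
  by (simp add: selection_law_def)

lemma measurable_sampler_selection_law: "sampler \<in> measurable (selection_law N J I) (subprob_algebra config_space)"
  unfolding measurable_cong_sets[OF sets_selection_law refl]
  by (rule measurable_prob_algebraD[OF measurable_sampler])

lemma prob_space_mixture: "prob_space mixture"
  unfolding mixture_def by (rule prob_space_bind'[OF selection_law_in_prob_algebra measurable_sampler])

lemma sets_mixture: "sets mixture = sets config_space"
  unfolding mixture_def by (rule sets_bind'[OF selection_law_in_prob_algebra measurable_sampler])

lemma point_process_mixture: "point_process mixture (\<lambda>\<xi>. \<xi>)"
  unfolding point_process_def using prob_space_mixture measurable_ident_sets[OF sets_mixture] by simp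

lemma nn_integral_mixture:
  assumes "f \<in> borel_measurable config_space"
  shows "(\<integral>\<^sup>+ \<xi>. f \<xi> \<partial>mixture) = (\<integral>\<^sup>+ \<omega>. \<integral>\<^sup>+ \<xi>. f \<xi> \<partial>projection_law (selected (outcome \<omega>)) \<partial>N)"
proof -
  have "(\<integral>\<^sup>+ \<xi>. f \<xi> \<partial>mixture) = (\<integral>\<^sup>+ \<iota>. \<integral>\<^sup>+ \<xi>. f \<xi> \<partial>sampler \<iota> \<partial>selection_law N J I)"
    unfolding mixture_def by (rule nn_integral_bind[OF assms measurable_sampler_selection_law])
  also have "\<dots> = (\<integral>\<^sup>+ \<omega>. \<integral>\<^sup>+ \<xi>. f \<xi> \<partial>sampler (outcome \<omega>) \<partial>N)"
  proof -
    have "(\<lambda>\<iota>. \<integral>\<^sup>+ \<xi>. f \<xi> \<partial>sampler \<iota>) \<in> borel_measurable outcomes"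
      by (rule measurable_compose[OF measurable_prob_algebraD[OF measurable_sampler]
        nn_integral_measurable_subprob_algebra[OF assms]])
    then show ?thesis
      unfolding selection_law_def by (intro nn_integral_distr[OF measurable_outcome]) simp
  qed
  finally show ?thesis by (simp only: sampler_def)
qed

lemma AE_mixture_simple: "AE \<xi> in mixture. \<xi> \<in> simple_configs"
proof -
  have "AE \<xi> in sampler \<iota>. \<xi> \<in> simple_configs" for \<iota>
    unfolding sampler_def by (rule AE_projection_law_simple[OF finite_selected selected_subset])
  then show ?thesis
    unfolding mixture_def AE_bind[OF measurable_sampler_selection_law pred_simple_configs] by simp
qed

lemma AE_projection_law_total_power:
  assumes "finite S" "S \<subseteq> J"
  shows "AE \<xi> in projection_law S. total_power \<xi> = of_nat (2 ^ card S)"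
  using AE_projection_law_card[OF assms] AE_projection_law_simple[OF assms]
proof eventually_elim
  case (elim \<xi>)
  have "emeasure \<xi> UNIV = of_nat (point_count \<xi> UNIV)"
    using elim(2) by (intro emeasure_point_count) (auto simp: simple_configs_def)
  then have "point_count \<xi> UNIV = card S"
    using elim(1) by (metis of_nat_eq_iff)
  then show ?case by (simp add: total_power_def)
qed

lemma nn_integral_projection_law_total_power:
  assumes "finite S" "S \<subseteq> J"
  shows "(\<integral>\<^sup>+ \<xi>. total_power \<xi> \<partial>projection_law S) = of_nat (2 ^ card S)"
proof -
  have "(\<integral>\<^sup>+ \<xi>. total_power \<xi> \<partial>projection_law S) = (\<integral>\<^sup>+ \<xi>. of_nat (2 ^ card S) \<partial>projection_law S)"
    by (rule nn_integral_cong_AE[OF AE_projection_law_total_power[OF assms]])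
  then show ?thesis
    using prob_space.emeasure_space_1[OF prob_space_projection_law[OF assms]] by simp
qed

lemma borel_measurable_total_power:
  "total_power \<in> borel_measurable (config_space :: 'a measure measure)"
  unfolding total_power_def[abs_def]
  by (rule measurable_compose[OF measurable_point_count]) auto

lemma mixture_total_power_finite: "(\<integral>\<^sup>+ \<xi>. total_power \<xi> \<partial>mixture) < \<infinity>"
proof -
  have "(\<integral>\<^sup>+ \<xi>. total_power \<xi> \<partial>mixture) = (\<integral>\<^sup>+ \<omega>. of_nat (2 ^ card (selected (outcome \<omega>))) \<partial>N)"
    unfolding nn_integral_mixture[OF borel_measurable_total_power]
    by (intro nn_integral_cong nn_integral_projection_law_total_power finite_selected selected_subset)
  then show ?thesis using nn_integral_power_selected_finite by simp
qed

text \<open>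
  The intensity is multilinear in the eigenvalues, because terms with repeated indices drop out:
  the Slater determinant vanishes for them. Independence then replaces each product of selection
  indicators by the product of the \<open>\<lambda>\<^sub>k\<close>.
\<close>

lemma nn_integral_intensity_selected:
  "(\<integral>\<^sup>+ \<omega>. intensity J \<phi> (\<lambda>s. of_bool (s \<in> selected (outcome \<omega>))) k x \<partial>N) = intensity J \<phi> lam k x"
proof -
  let ?G = "{..<k} \<rightarrow>\<^sub>E J"
  let ?sl = "\<lambda>g. (cmod (slater \<phi> {..<k} g x))\<^sup>2"
  let ?c = "\<lambda>\<omega> s. of_bool (s \<in> selected (outcome \<omega>)) :: real"
  have count: "countable ?G" by (intro countable_PiE) auto
  have c_eq: "(\<Prod>i<k. ?c \<omega> (g i)) = of_bool (g ` {..<k} \<subseteq> selected (outcome \<omega>))" for g \<omega>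
  proof (cases "g ` {..<k} \<subseteq> selected (outcome \<omega>)")
    case True
    then have "(\<Prod>i<k. ?c \<omega> (g i)) = 1" by (intro prod.neutral) auto
    then show ?thesis using True by simp
  next
    case False
    then obtain i where "i < k" "g i \<notin> selected (outcome \<omega>)" by auto
    then have "(\<Prod>i<k. ?c \<omega> (g i)) = 0" by (intro prod_zero bexI[of _ i]) auto
    then show ?thesis using False by (simp only: of_bool_eq simp_thms)
  qed
  have bool_meas: "(\<lambda>\<omega>. of_bool (T \<subseteq> selected (outcome \<omega>)) :: ennreal) \<in> borel_measurable N" for T
    by (rule measurable_compose[OF measurable_selected_outcome]) simp
  have term_eq: "ennreal ((\<Prod>i<k. ?c \<omega> (g i)) * ?sl g) = of_bool (g ` {..<k} \<subseteq> selected (outcome \<omega>)) * ennreal (?sl g)"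
    for g \<omega>
    unfolding c_eq by (cases "g ` {..<k} \<subseteq> selected (outcome \<omega>)") auto
  have "(\<integral>\<^sup>+ \<omega>. intensity J \<phi> (?c \<omega>) k x \<partial>N)
      = (\<integral>\<^sup>+ \<omega>. (\<integral>\<^sup>+ g. of_bool (g ` {..<k} \<subseteq> selected (outcome \<omega>)) * ennreal (?sl g) \<partial>count_space ?G) \<partial>N) / fact k"
    unfolding intensity_def term_eq
  proof (rule nn_integral_divide)
    show "(\<lambda>\<omega>. \<integral>\<^sup>+ g. of_bool (g ` {..<k} \<subseteq> selected (outcome \<omega>)) * ennreal (?sl g) \<partial>count_space ?G) \<in> borel_measurable N"
      by (rule measurable_compose[OF measurable_selected_outcome]) simp
  qed
  also have "(\<integral>\<^sup>+ \<omega>. (\<integral>\<^sup>+ g. of_bool (g ` {..<k} \<subseteq> selected (outcome \<omega>)) * ennreal (?sl g) \<partial>count_space ?G) \<partial>N)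
      = (\<integral>\<^sup>+ g. (\<integral>\<^sup>+ \<omega>. of_bool (g ` {..<k} \<subseteq> selected (outcome \<omega>)) * ennreal (?sl g) \<partial>N) \<partial>count_space ?G)"
    by (rule nn_integral_count_space_nn_integral[OF count])
      (intro borel_measurable_times_ennreal bool_meas borel_measurable_const)
  also have "\<dots> = (\<integral>\<^sup>+ g. ennreal ((\<Prod>i<k. lam (g i)) * ?sl g) \<partial>count_space ?G)"
  proof (rule nn_integral_cong)
    fix g assume "g \<in> space (count_space ?G)"
    then have g: "g \<in> ?G" by simp
    have gJ: "g ` {..<k} \<subseteq> J" using g by auto
    show "(\<integral>\<^sup>+ \<omega>. of_bool (g ` {..<k} \<subseteq> selected (outcome \<omega>)) * ennreal (?sl g) \<partial>N)
        = ennreal ((\<Prod>i<k. lam (g i)) * ?sl g)"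
    proof (cases "inj_on g {..<k}")
      case True
      have "(\<integral>\<^sup>+ \<omega>. of_bool (g ` {..<k} \<subseteq> selected (outcome \<omega>)) * ennreal (?sl g) \<partial>N)
          = (\<Prod>s\<in>g ` {..<k}. ennreal (lam s)) * ennreal (?sl g)"
        by (subst nn_integral_multc[OF bool_meas]) (simp only: nn_integral_all_selected[OF finite_imageI[OF finite_lessThan] gJ])
      also have "(\<Prod>s\<in>g ` {..<k}. ennreal (lam s)) = (\<Prod>i<k. ennreal (lam (g i)))"
        using True by (simp add: prod.reindex)
      also have "\<dots> = ennreal (\<Prod>i<k. lam (g i))"
        using lam gJ by (intro prod_ennreal) auto
      also have "\<dots> * ennreal (?sl g) = ennreal ((\<Prod>i<k. lam (g i)) * ?sl g)"
        using lam gJ by (intro ennreal_mult[symmetric] prod_nonneg) auto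
      finally show ?thesis .
    next
      case False
      then have "slater \<phi> {..<k} g x = 0" by (intro slater_repeated_index) auto
      then show ?thesis by simp
    qed
  qed
  finally show ?thesis unfolding intensity_def .
qed

lemma mixture_moments:
  assumes D: "\<And>i. i < k \<Longrightarrow> D i \<in> sets borel" "disjoint_family_on D {..<k}"
  shows "(\<integral>\<^sup>+ \<xi>. (\<Prod>i<k. emeasure \<xi> (D i)) \<partial>mixture)
    = set_nn_integral (power_space {..<k}) (\<Pi>\<^sub>E i\<in>{..<k}. D i) (intensity J \<phi> lam k)"
proof -
  let ?E = "\<Pi>\<^sub>E i\<in>{..<k}. D i"
  let ?F = "\<lambda>S x. intensity J \<phi> (\<lambda>s. of_bool (s \<in> S)) k x * indicator ?E x"
  interpret fin_prod: product_sigma_finite "\<lambda>_::nat. \<mu>" by (rule product)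
  interpret pw: sigma_finite_measure "power_space {..<k}" by (rule fin_prod.sigma_finite) simp
  interpret pair_sigma_finite N "power_space {..<k}" ..
  have E: "?E \<in> sets (power_space {..<k})"
    using D(1) sets_\<mu> by (intro sets_PiM_I_finite) auto
  have F_meas: "?F S \<in> borel_measurable (power_space {..<k})" for S
    using E by (intro borel_measurable_times_ennreal borel_measurable_intensity borel_measurable_indicator) auto
  \<comment> \<open>Joint measurability for Tonelli: the selection takes countably many values.\<close>
  have "case_prod ?F \<in> borel_measurable (count_space finite_selections \<Otimes>\<^sub>M power_space {..<k})"
    using F_meas by (intro measurable_pair_measure_countable1 countable_finite_selections) auto
  moreover have "(\<lambda>p. (selected (outcome (fst p)), snd p))
      \<in> measurable (N \<Otimes>\<^sub>M power_space {..<k}) (count_space finite_selections \<Otimes>\<^sub>M power_space {..<k})"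
    by (intro measurable_Pair measurable_compose[OF measurable_fst measurable_selected_outcome] measurable_snd)
  ultimately have "(\<lambda>p. case_prod ?F (selected (outcome (fst p)), snd p)) \<in> borel_measurable (N \<Otimes>\<^sub>M power_space {..<k})"
    by (rule measurable_compose[rotated])
  then have joint: "(\<lambda>(\<omega>, x). ?F (selected (outcome \<omega>)) x) \<in> borel_measurable (N \<Otimes>\<^sub>M power_space {..<k})"
    by (simp add: case_prod_beta)
  have prod_meas: "(\<lambda>\<xi>. \<Prod>i<k. emeasure \<xi> (D i)) \<in> borel_measurable config_space"
    using D(1) by (intro borel_measurable_prod_ennreal measurable_emeasure_config_space) auto
  have "(\<integral>\<^sup>+ \<xi>. (\<Prod>i<k. emeasure \<xi> (D i)) \<partial>mixture)
      = (\<integral>\<^sup>+ \<omega>. \<integral>\<^sup>+ x. ?F (selected (outcome \<omega>)) x \<partial>power_space {..<k} \<partial>N)"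
    unfolding nn_integral_mixture[OF prod_meas]
    using D by (intro nn_integral_cong projection_law_moments finite_selected selected_subset)
  also have "\<dots> = (\<integral>\<^sup>+ x. \<integral>\<^sup>+ \<omega>. ?F (selected (outcome \<omega>)) x \<partial>N \<partial>power_space {..<k})"
    by (rule Fubini'[OF joint, symmetric])
  also have "\<dots> = set_nn_integral (power_space {..<k}) ?E (intensity J \<phi> lam k)"
  proof (rule nn_integral_cong)
    fix x
    have "(\<lambda>\<omega>. intensity J \<phi> (\<lambda>s. of_bool (s \<in> selected (outcome \<omega>))) k x) \<in> borel_measurable N"
      by (rule measurable_compose[OF measurable_selected_outcome]) simp
    then show "(\<integral>\<^sup>+ \<omega>. ?F (selected (outcome \<omega>)) x \<partial>N) = intensity J \<phi> lam k x * indicator ?E x"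
      by (subst nn_integral_multc) (simp_all only: nn_integral_intensity_selected)
  qed
  finally show ?thesis .
qed

lemma law_eq_mixture:
  assumes X: "determinantal_process M X \<mu> (spectral_kernel J lam \<phi>)"
  shows "distr M config_space X = mixture"
proof -
  have "same_moments M X mixture (\<lambda>\<xi>. \<xi>)"
    unfolding same_moments_def
  proof (intro allI impI)
    fix k :: nat and D :: "nat \<Rightarrow> 'a set"
    assume k: "1 \<le> k" and D: "\<forall>i<k. D i \<in> sets borel" "disjoint_family_on D {..<k}"
    have "(\<integral>\<^sup>+ \<omega>. (\<Prod>i<k. emeasure (X \<omega>) (D i)) \<partial>M)
        = set_nn_integral (power_space {..<k}) (\<Pi>\<^sub>E i\<in>{..<k}. D i) (intensity J \<phi> lam k)"
      using lam lam_summable D by (intro determinantal_process_moments[OF _ _ X k]) auto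
    also have "\<dots> = (\<integral>\<^sup>+ \<xi>. (\<Prod>i<k. emeasure \<xi> (D i)) \<partial>mixture)"
      using D by (intro mixture_moments[symmetric]) auto
    finally show "(\<integral>\<^sup>+ \<omega>. (\<Prod>i<k. emeasure (X \<omega>) (D i)) \<partial>M) = (\<integral>\<^sup>+ \<xi>. (\<Prod>i<k. emeasure \<xi> (D i)) \<partial>mixture)" .
  qed
  then have "distr M config_space X = distr mixture config_space (\<lambda>\<xi>. \<xi>)"
    using X by (intro law_eq_of_same_moments_simple point_process_mixture AE_mixture_simple mixture_total_power_finite)
      (auto simp: determinantal_process_def)
  then show ?thesis by (simp add: distr_id2 sets_mixture)
qed

text \<open>
  Any version of the conditional law of the process given the selection is of this form, so the
  mixture does not depend on the chosen version.
\<close>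

lemma determinantal_law_eq_projection_law:
  assumes S: "finite S" "S \<subseteq> J"
    and Q: "determinantal_process Q (\<lambda>\<xi>. \<xi>) \<mu> (spectral_kernel J (\<lambda>s. of_bool (s \<in> S)) \<phi>)"
    and sets: "sets Q = sets config_space"
  shows "Q = projection_law S"
proof -
  have "same_moments Q (\<lambda>\<xi>. \<xi>) (projection_law S) (\<lambda>\<xi>. \<xi>)"
    unfolding same_moments_def
  proof (intro allI impI)
    fix k :: nat and D :: "nat \<Rightarrow> 'a set"
    assume k: "1 \<le> k" and D: "\<forall>i<k. D i \<in> sets borel" "disjoint_family_on D {..<k}"
    have "(\<integral>\<^sup>+ \<xi>. (\<Prod>i<k. emeasure \<xi> (D i)) \<partial>Q)
        = set_nn_integral (power_space {..<k}) (\<Pi>\<^sub>E i\<in>{..<k}. D i) (intensity J \<phi> (\<lambda>s. of_bool (s \<in> S)) k)"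
      using D by (intro determinantal_process_moments[OF _ summable_of_bool[OF S(1)] Q k]) auto
    also have "\<dots> = (\<integral>\<^sup>+ \<xi>. (\<Prod>i<k. emeasure \<xi> (D i)) \<partial>projection_law S)"
      using D by (intro projection_law_moments[OF S, symmetric]) auto
    finally show "(\<integral>\<^sup>+ \<xi>. (\<Prod>i<k. emeasure \<xi> (D i)) \<partial>Q) = (\<integral>\<^sup>+ \<xi>. (\<Prod>i<k. emeasure \<xi> (D i)) \<partial>projection_law S)" .
  qed
  moreover have "(\<integral>\<^sup>+ \<xi>. total_power \<xi> \<partial>projection_law S) < \<infinity>"
    unfolding nn_integral_projection_law_total_power[OF S] by (simp add: of_nat_less_top del: of_nat_power)
  ultimately have "distr Q config_space (\<lambda>\<xi>. \<xi>) = distr (projection_law S) config_space (\<lambda>\<xi>. \<xi>)"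
    using Q by (intro law_eq_of_same_moments_simple point_process_projection_law[OF S] AE_projection_law_simple[OF S])
      (auto simp: determinantal_process_def)
  then show ?thesis by (simp add: distr_id2 sets sets_projection_law)
qed

lemma AE_selection_law:
  "AE \<iota> in selection_law N J I. \<iota> \<in> space outcomes \<and> selected \<iota> = {k\<in>J. \<iota> k}"
proof -
  have "{\<iota>\<in>space outcomes. \<iota> \<in> space outcomes \<and> selected \<iota> = {k\<in>J. \<iota> k}}
      = space outcomes - ((selected -` {{}} \<inter> space outcomes) - {\<iota>\<in>space outcomes. \<forall>k\<in>J. \<not> \<iota> k})"
    by (auto simp: selected_def)
  moreover have "selected -` {{}} \<inter> space outcomes \<in> sets outcomes"
    by (rule measurable_sets[OF measurable_selected]) simp
  moreover have "{\<iota>\<in>space outcomes. \<forall>k\<in>J. \<not> \<iota> k} \<in> sets outcomes"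
  proof -
    have "Measurable.pred outcomes (\<lambda>\<iota>. \<iota> k)" if "k \<in> J" for k
      using measurable_component_singleton[OF that, of "\<lambda>_. count_space UNIV"] by simp
    then have "Measurable.pred outcomes (\<lambda>\<iota>. \<forall>k\<in>J. \<not> \<iota> k)"
      by (intro pred_intros_countable_bounded(3) pred_intros_logic(2))
    then show ?thesis by (simp only: pred_def)
  qed
  ultimately have "{\<iota>\<in>space outcomes. \<iota> \<in> space outcomes \<and> selected \<iota> = {k\<in>J. \<iota> k}} \<in> sets outcomes"
    by auto
  moreover have "AE \<omega> in N. outcome \<omega> \<in> space outcomes \<and> selected (outcome \<omega>) = {k\<in>J. outcome \<omega> k}"
    using AE_selected_outcome AE_space
  proof eventually_elim
    case (elim \<omega>)
    have "{k\<in>J. outcome \<omega> k} = {k\<in>J. I k \<omega>}" by auto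
    then show ?case using elim measurable_space[OF measurable_outcome] by simp
  qed
  ultimately show ?thesis
    unfolding selection_law_def by (simp add: AE_distr_iff[OF measurable_outcome])
qed

lemma spectral_kernel_selected:
  assumes "selected \<iota> = {k\<in>J. \<iota> k}"
  shows "spectral_kernel J (\<lambda>k. of_bool (\<iota> k)) \<phi> = spectral_kernel J (\<lambda>k. of_bool (k \<in> selected \<iota>)) \<phi>"
  unfolding spectral_kernel_def[abs_def] assms by (intro ext infsum_cong) auto

lemma determinantal_sampler_sampler:
  "determinantal_sampler \<mu> J \<phi> (selection_law N J I) sampler"
  unfolding determinantal_sampler_def
proof (intro conjI measurable_sampler)
  show "AE \<iota> in selection_law N J I.
      determinantal_process (sampler \<iota>) (\<lambda>\<xi>. \<xi>) \<mu> (spectral_kernel J (\<lambda>k. of_bool (\<iota> k)) \<phi>)"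
    using AE_selection_law
  proof eventually_elim
    case (elim \<iota>)
    then show ?case
      using determinantal_projection_law[OF finite_selected selected_subset, of \<iota>]
      by (simp add: spectral_kernel_selected sampler_def)
  qed
qed

lemma bind_determinantal_sampler:
  assumes Q: "determinantal_sampler \<mu> J \<phi> (selection_law N J I) Q"
  shows "selection_law N J I \<bind> Q = mixture"
  unfolding mixture_def
proof (rule bind_cong_AE'[OF selection_law_in_prob_algebra])
  show Qm: "Q \<in> measurable outcomes (prob_algebra config_space)"
    using Q by (simp add: determinantal_sampler_def)
  show "sampler \<in> measurable outcomes (prob_algebra config_space)" by (rule measurable_sampler)
  have "AE \<iota> in selection_law N J I.
      determinantal_process (Q \<iota>) (\<lambda>\<xi>. \<xi>) \<mu> (spectral_kernel J (\<lambda>k. of_bool (\<iota> k)) \<phi>)"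
    using Q by (simp add: determinantal_sampler_def)
  then show "AE \<iota> in selection_law N J I. Q \<iota> = sampler \<iota>"
    using AE_selection_law
  proof eventually_elim
    case (elim \<iota>)
    have "sets (Q \<iota>) = sets config_space"
      using measurable_space[OF Qm, of \<iota>] elim(2) by (simp add: space_prob_algebra)
    then show ?case
      unfolding sampler_def using elim
      by (intro determinantal_law_eq_projection_law finite_selected selected_subset)
        (simp_all add: spectral_kernel_selected)
  qed
qed

lemma distr_mixture_total_count:
  "distr mixture borel (\<lambda>\<xi>. emeasure \<xi> UNIV)
    = distr N borel (\<lambda>\<omega>. \<Sum>\<^sub>\<infinity>k\<in>J. (of_bool (I k \<omega>) :: ennreal))"
proof -
  let ?U = "\<lambda>\<xi>::'a measure. emeasure \<xi> UNIV"
  have U: "?U \<in> borel_measurable config_space"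
    by (rule measurable_emeasure_config_space) simp
  have card: "(\<lambda>\<omega>. of_nat (card (selected (outcome \<omega>))) :: ennreal) \<in> borel_measurable N"
    by (rule measurable_compose[OF measurable_selected_outcome]) simp
  have "distr mixture borel ?U = distr N borel (\<lambda>\<omega>. of_nat (card (selected (outcome \<omega>))))"
  proof (rule measure_eqI)
    fix B :: "ennreal set" assume "B \<in> sets (distr mixture borel ?U)"
    then have B: "B \<in> sets borel" by simp
    have U': "?U \<in> borel_measurable mixture"
      using U measurable_cong_sets[OF sets_mixture refl] by blast
    have ind: "(\<lambda>\<xi>. indicator B (?U \<xi>) :: ennreal) \<in> borel_measurable config_space"
      using measurable_compose[OF U borel_measurable_indicator[OF B]] .
    have "emeasure (distr mixture borel ?U) B = (\<integral>\<^sup>+ y. indicator B y \<partial>distr mixture borel ?U)"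
      using B by simp
    also have "\<dots> = (\<integral>\<^sup>+ \<xi>. indicator B (?U \<xi>) \<partial>mixture)"
      using B by (intro nn_integral_distr[OF U']) simp
    also have "\<dots> = (\<integral>\<^sup>+ \<omega>. \<integral>\<^sup>+ \<xi>. indicator B (?U \<xi>) \<partial>projection_law (selected (outcome \<omega>)) \<partial>N)"
      by (rule nn_integral_mixture[OF ind])
    also have "\<dots> = (\<integral>\<^sup>+ \<omega>. indicator B (of_nat (card (selected (outcome \<omega>)))) \<partial>N)"
    proof (rule nn_integral_cong)
      fix \<omega>
      let ?S = "selected (outcome \<omega>)"
      have "(\<integral>\<^sup>+ \<xi>. indicator B (?U \<xi>) \<partial>projection_law ?S) = (\<integral>\<^sup>+ \<xi>. indicator B (of_nat (card ?S)) \<partial>projection_law ?S)"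
        using AE_projection_law_card[OF finite_selected selected_subset, of "outcome \<omega>"]
        by (intro nn_integral_cong_AE) (auto elim!: eventually_mono)
      then show "(\<integral>\<^sup>+ \<xi>. indicator B (?U \<xi>) \<partial>projection_law ?S) = indicator B (of_nat (card ?S))"
        using prob_space.emeasure_space_1[OF prob_space_projection_law[OF finite_selected selected_subset, of "outcome \<omega>"]]
        by simp
    qed
    also have "\<dots> = (\<integral>\<^sup>+ y. indicator B y \<partial>distr N borel (\<lambda>\<omega>. of_nat (card (selected (outcome \<omega>)))))"
      using B by (intro nn_integral_distr[OF card, symmetric]) simp
    also have "\<dots> = emeasure (distr N borel (\<lambda>\<omega>. of_nat (card (selected (outcome \<omega>))))) B"
      using B by simp
    finally show "emeasure (distr mixture borel ?U) B = \<dots>" .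
  qed simp
  then show ?thesis unfolding distr_infsum_I .
qed

end

section \<open>Sampling the spectrum of a determinantal process\<close>

text \<open>
  Every point has a neighbourhood inside a compact set, and countably many of these neighbourhoods
  cover the space by the Lindelof property.
\<close>

lemma sigma_finite_radon_measure:
  fixes \<mu> :: "'a::{second_countable_topology,t2_space} measure"
  assumes loc: "locally_compact_space (euclidean :: 'a topology)" and radon: "radon_measure \<mu>"
  shows "sigma_finite_measure \<mu>"
proof -
  have sets: "sets \<mu> = sets borel" and compact: "\<And>C. compact C \<Longrightarrow> emeasure \<mu> C < \<infinity>"
    using radon by (auto simp: radon_measure_def)
  have "\<exists>U K. open U \<and> compact K \<and> x \<in> U \<and> U \<subseteq> K" for x :: 'a
    using loc unfolding locally_compact_space_def by (auto simp: compactin_euclidean_iff)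
  then obtain U K where U: "\<And>x::'a. open (U x)" "\<And>x. compact (K x)" "\<And>x. x \<in> U x" "\<And>x. U x \<subseteq> K x"
    by metis
  obtain \<F> where \<F>: "\<F> \<subseteq> range U" "countable \<F>" "\<Union>\<F> = \<Union>(range U)"
    using Lindelof[of "range U"] U(1) by auto
  have univ: "\<Union>\<F> = UNIV" unfolding \<F>(3) using U(3) by auto
  show ?thesis
  proof (rule sigma_finite_measure.intro, intro exI conjI ballI)
    show "countable \<F>" by fact
    show "\<F> \<subseteq> sets \<mu>" using \<F>(1) U(1) sets by auto
    show "\<Union>\<F> = space \<mu>" using univ sets_eq_imp_space_eq[OF sets] by simp
    fix V assume "V \<in> \<F>"
    then obtain x where V: "V = U x" using \<F>(1) by auto
    have "emeasure \<mu> V \<le> emeasure \<mu> (K x)"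
      unfolding V using U(2,4) sets by (intro emeasure_mono) (auto intro: borel_closed compact_imp_closed)
    also have "\<dots> < \<infinity>" by (rule compact[OF U(2)])
    finally show "emeasure \<mu> V \<noteq> \<infinity>" by simp
  qed
qed

theorem theorem7:
  fixes \<mu> :: "'a::polish_space measure"
    and n :: enat
    and \<phi> :: "nat \<Rightarrow> 'a \<Rightarrow> complex"
    and lam :: "nat \<Rightarrow> real"
    and M :: "'w measure" and X :: "'w \<Rightarrow> 'a measure"
    and N :: "'v measure" and I :: "nat \<Rightarrow> 'v \<Rightarrow> bool"
  defines "J \<equiv> index_range n"
  assumes "locally_compact_space (euclidean :: 'a topology)"
    and "radon_measure \<mu>"
    and "1 \<le> n"
    and "orthonormal_L2 \<mu> J \<phi>"
    and "\<forall>k\<in>J. 0 \<le> lam k \<and> lam k \<le> 1"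
    and "lam summable_on J"
    and "determinantal_process M X \<mu> (spectral_kernel J lam \<phi>)"
    and "prob_space N"
    and "prob_space.indep_vars N (\<lambda>_. count_space UNIV) I J"
    and "\<forall>k\<in>J. distr N (count_space UNIV) (I k) = measure_pmf (bernoulli_pmf (lam k))"
  shows "(\<exists>Q. determinantal_sampler \<mu> J \<phi> (selection_law N J I) Q) \<and>
    (\<forall>Q. determinantal_sampler \<mu> J \<phi> (selection_law N J I) Q \<longrightarrow>
      distr M config_space X = selection_law N J I \<bind> Q) \<and>
    distr M borel (\<lambda>\<omega>. emeasure (X \<omega>) UNIV) =
      distr N borel (\<lambda>\<omega>. \<Sum>\<^sub>\<infinity>k\<in>J. (of_bool (I k \<omega>) :: ennreal))"
proof -
  interpret spectral_mixture \<mu> J \<phi> N I lam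
  proof (intro spectral_mixture.intro orthonormal_system.intro
      bernoulli_selection.intro bernoulli_selection_axioms.intro)
    show "sigma_finite_measure \<mu>"
      by (rule sigma_finite_radon_measure[OF assms(2,3)])
    show "sets \<mu> = sets borel"
      using assms(3) by (simp add: radon_measure_def)
  qed (use assms in auto)
  have X: "X \<in> measurable M config_space"
    using assms(8) by (simp add: determinantal_process_def point_process_def)
  have U: "(\<lambda>\<xi>. emeasure \<xi> (UNIV :: 'a set)) \<in> borel_measurable config_space"
    by (rule measurable_emeasure_config_space) simp
  have law: "distr M config_space X = mixture"
    by (rule law_eq_mixture[OF assms(8)])
  have "distr M borel (\<lambda>\<omega>. emeasure (X \<omega>) UNIV) = distr mixture borel (\<lambda>\<xi>. emeasure \<xi> UNIV)"
    unfolding law[symmetric] using X U by (simp add: distr_distr comp_def)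
  then show ?thesis
    using determinantal_sampler_sampler bind_determinantal_sampler law distr_mixture_total_count
    by auto
qed

end
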